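(* In the setting described in the context (where $B(t)=\alpha(t)B_1$), assume that $A_1+B_1$ is maximal quasi-monotone in $\mathcal H$ with a dense domain in $\mathcal H$, and that there exist two mappings $D\in C^1([0,\infty);\mathcal L(\mathcal H))$ and $\tilde D\in C([0,\infty);\mathcal L(\mathcal H))$ such that $D'$ and $\tilde D$ are locally Lipschitz and, for all $t\ge0$, $D(t)$ and $\tilde D(t)$ are invertible, $D(t)\tilde D(t)$ is symmetric positive definite, for all $T>0$ there exists a constant $c_T>0$ such that $$(\tilde D(t)^{-1}D(t)^{-1}x,x)_{\mathcal H}\ge c_T\|x\|_{\mathcal H}^2\qquad\forall x\in\mathcal H,\ t\in[0,T],$$ and finally $$(A_1+\alpha(t)B_1)D(t)^{-1}=\tilde D(t)(A_1+B_1)\qquad\forall t\ge 0.$$ Then for all $x_0\in D(\mathcal A_B(0))$ the problem $$\frac{dx}{dt}(t)+A_1x(t)+B(t)x(t)=0\ \text{ in }\mathcal H,\ t\ge 0,\qquad x(0)=x_0,$$ has a unique solution $x$ such that $x\in C([0,\infty),\mathcal H)$, $x(t)\in D(\mathcal A_B(t))$ for all $t\in[0,\infty)$, and $x'(t)=-\mathcal A_B(t)x(t)$ exists in $\mathcal H$ and is continuous except at a countable number of points $t$.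
   Context: Setting. $\mathcal H,\mathcal V$ are real Hilbert spaces with $\mathcal V$ densely and continuously embedded into $\mathcal H$; $\mathcal H$ is identified with its dual, so $\mathcal V\hookrightarrow\mathcal H=\mathcal H'\hookrightarrow\mathcal V'$, and $\langle\cdot,\cdot\rangle$ is the $\mathcal V'$–$\mathcal V$ duality pairing, with $\langle u,v\rangle=(u,v)_{\mathcal H}$ for $u,v\in\mathcal H$. The control space is $U=\prod_{j=1}^J U_j$ ($J\ge1$), where $U_j$ is a closed subspace of $L^2(X_j,\mu_j)^{N_j}$ (real-valued functions), $N_j\ge 1$, $X_j$ is a metric space and $(X_j,\mathcal A_j,\mu_j)$ is a measure space with $\mu_j(X_j)<\infty$. $\mathcal V$ is continuously embedded into $U$: $I_U:\mathcal V\to U$ denotes the corresponding bounded linear map (injectivity is not required), and $(I_Uu)_j$ is the $j$-th component of $I_Uu$. For each $j$, $g_j:\mathbb R^{N_j}\to\mathbb R^{N_j}$ is continuous with $(g_j(x)-g_j(y))\cdot(x-y)\ge0$ for all $x,y$, $g_j(0)=0$, and $|g_j(x)|\le M(1+|x|)$ for all $x$, for some $M>0$. The function $\alpha\in C^1([0,\infty);(0,\infty))$ has locally Lipschitz derivative: for all $T>0$ there is $\nu(T)>0$ with $|\alpha'(t)-\alpha'(s)|\le\nu(T)|t-s|$ for all $s,t\in[0,T]$. The nonlinear operator $B_1:\mathcal V\to\mathcal V'$ is $$\langle B_1u,v\rangle=\sum_{j=1}^J\int_{X_j}g_j((I_Uu)_j(x_j))\cdot(I_Uv)_j(x_j)\,d\mu_j(x_j),\quad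 u,v\in\mathcal V,$$ and $B(t)=\alpha(t)B_1$. $A_1:\mathcal V\to\mathcal V'$ is a bounded linear operator with $\langle A_1u,u\rangle=0$ for all $u\in\mathcal V$. The operator $\mathcal A_B(t)$ in $\mathcal H$ is $\mathcal A_B(t)v=(A_1+B(t))v$ with domain $D(\mathcal A_B(t))=\{v\in\mathcal V:(A_1+B(t))v\in\mathcal H\}$. Likewise $A_1+B_1$ is regarded as an operator in $\mathcal H$ with domain $D(A_1+B_1)=\{v\in\mathcal V:(A_1+B_1)v\in\mathcal H\}$; it is maximal quasi-monotone if $A_1+B_1+\omega_1\mathbb I$ is maximal monotone in $\mathcal H$ for some $\omega_1\ge0$. The identity $(A_1+\alpha(t)B_1)D(t)^{-1}=\tilde D(t)(A_1+B_1)$ is an identity of operators in $\mathcal H$, domains included: $D(t)^{-1}x\in D(\mathcal A_B(t))$ if and only if $x\in D(A_1+B_1)$, and both sides agree on such $x$. Locally Lipschitz means Lipschitz on each $[0,T]$ with values in $\mathcal L(\mathcal H)$ (bounded linear operators on $\mathcal H$). *)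

theory Defs
  imports "HOL-Analysis.Analysis"
begin

text \<open>
  The number of components varies with the index of the control component, so
  $\mathbb{R}^n$ is rendered as \<^const>\<open>Euclidean_space\<close>: sequences that vanish from
  index \<open>n\<close> on.
\<close>

definition dot :: "nat \<Rightarrow> (nat \<Rightarrow> real) \<Rightarrow> (nat \<Rightarrow> real) \<Rightarrow> real"
  where "dot n x y = (\<Sum>i<n. x i * y i)"

definition vnorm :: "nat \<Rightarrow> (nat \<Rightarrow> real) \<Rightarrow> real"
  where "vnorm n x = L2_set x {..<n}"

text \<open>
  Elements of $L^2(X,\mu)^n$ are handled through representatives; everything below respects
  equality almost everywhere.
\<close>

definition L2_fun :: "'x measure \<Rightarrow> nat \<Rightarrow> ('x \<Rightarrow> nat \<Rightarrow> real) set"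
  where "L2_fun M n = {f. (\<forall>x\<in>space M. f x \<in> topspace (Euclidean_space n)) \<and>
    (\<forall>i<n. (\<lambda>x. f x i) \<in> borel_measurable M) \<and> integrable M (\<lambda>x. (vnorm n (f x))\<^sup>2)}"

definition L2_norm :: "'x measure \<Rightarrow> nat \<Rightarrow> ('x \<Rightarrow> nat \<Rightarrow> real) \<Rightarrow> real"
  where "L2_norm M n f = sqrt (\<integral>x. (vnorm n (f x))\<^sup>2 \<partial>M)"

text \<open>
  Closedness under limits in the seminorm includes closedness under equality almost everywhere,
  hence such a set is a union of equivalence classes.
\<close>

definition closed_L2_subspace :: "'x measure \<Rightarrow> nat \<Rightarrow> ('x \<Rightarrow> nat \<Rightarrow> real) set \<Rightarrow> bool"
  where "closed_L2_subspace M n S \<longleftrightarrow>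
    S \<subseteq> L2_fun M n \<and>
    (\<lambda>x i. 0) \<in> S \<and>
    (\<forall>f\<in>S. \<forall>h\<in>S. (\<lambda>x i. f x i + h x i) \<in> S) \<and>
    (\<forall>f\<in>S. \<forall>c. (\<lambda>x i. c * f x i) \<in> S) \<and>
    (\<forall>F h. (\<forall>k::nat. F k \<in> S) \<and> h \<in> L2_fun M n \<and>
       (\<lambda>k. L2_norm M n (\<lambda>x i. F k x i - h x i)) \<longlonglongrightarrow> 0 \<longrightarrow> h \<in> S)"

text \<open>
  All the sets $X_j$ live in one type, which is no restriction for a finite family.
  No relation between the metric and the $\sigma$-algebra on $X_j$ is assumed.
\<close>

locale control_setting =
  fixes \<iota> :: "'v :: {real_inner, complete_space} \<Rightarrow>\<^sub>L 'h :: {real_inner, complete_space}"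
    and J :: nat
    and N :: "nat \<Rightarrow> nat"
    and \<mu> :: "nat \<Rightarrow> 'x measure"
    and d :: "nat \<Rightarrow> 'x \<Rightarrow> 'x \<Rightarrow> real"
    and U :: "nat \<Rightarrow> ('x \<Rightarrow> nat \<Rightarrow> real) set"
    and I\<^sub>U :: "'v \<Rightarrow> nat \<Rightarrow> 'x \<Rightarrow> nat \<Rightarrow> real"
    and g :: "nat \<Rightarrow> (nat \<Rightarrow> real) \<Rightarrow> (nat \<Rightarrow> real)"
  assumes embedding_inj: "inj (blinfun_apply \<iota>)"
    and embedding_dense: "closure (range (blinfun_apply \<iota>)) = UNIV"
    and J_pos: "J \<ge> 1"
    and N_pos: "\<And>j. j < J \<Longrightarrow> N j \<ge> 1"
    and metric: "\<And>j. j < J \<Longrightarrow> Metric_space (space (\<mu> j)) (d j)"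
    and finite_measure: "\<And>j. j < J \<Longrightarrow> finite_measure (\<mu> j)"
    and U_subspace: "\<And>j. j < J \<Longrightarrow> closed_L2_subspace (\<mu> j) (N j) (U j)"
    and I_in_U: "\<And>v j. j < J \<Longrightarrow> I\<^sub>U v j \<in> U j"
    and I_add: "\<And>v w j. j < J \<Longrightarrow>
      AE x in \<mu> j. \<forall>i<N j. I\<^sub>U (v + w) j x i = I\<^sub>U v j x i + I\<^sub>U w j x i"
    and I_scale: "\<And>c v j. j < J \<Longrightarrow>
      AE x in \<mu> j. \<forall>i<N j. I\<^sub>U (c *\<^sub>R v) j x i = c * I\<^sub>U v j x i"
    and I_bounded: "\<exists>C. \<forall>v. sqrt (\<Sum>j<J. (L2_norm (\<mu> j) (N j) (I\<^sub>U v j))\<^sup>2) \<le> C * norm v"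
    and g_cont: "\<And>j. j < J \<Longrightarrow>
      continuous_map (Euclidean_space (N j)) (Euclidean_space (N j)) (g j)"
    and g_mono: "\<And>j x y. j < J \<Longrightarrow> x \<in> topspace (Euclidean_space (N j)) \<Longrightarrow>
      y \<in> topspace (Euclidean_space (N j)) \<Longrightarrow>
      dot (N j) (\<lambda>i. g j x i - g j y i) (\<lambda>i. x i - y i) \<ge> 0"
    and g_zero: "\<And>j. j < J \<Longrightarrow> g j (\<lambda>i. 0) = (\<lambda>i. 0)"
    and g_growth: "\<And>j. j < J \<Longrightarrow>
      \<exists>M>0. \<forall>x\<in>topspace (Euclidean_space (N j)). vnorm (N j) (g j x) \<le> M * (1 + vnorm (N j) x)"

definition B\<^sub>1_form :: "nat \<Rightarrow> (nat \<Rightarrow> nat) \<Rightarrow> (nat \<Rightarrow> 'x measure) \<Rightarrow>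
    ('v \<Rightarrow> nat \<Rightarrow> 'x \<Rightarrow> nat \<Rightarrow> real) \<Rightarrow> (nat \<Rightarrow> (nat \<Rightarrow> real) \<Rightarrow> (nat \<Rightarrow> real)) \<Rightarrow>
    'v \<Rightarrow> 'v \<Rightarrow> real"
  where "B\<^sub>1_form J N \<mu> I\<^sub>U g u v =
    (\<Sum>j<J. \<integral>x. dot (N j) (g j (I\<^sub>U u j x)) (I\<^sub>U v j x) \<partial>\<mu> j)"

text \<open>
  The dual of \<open>'v\<close> is \<^typ>\<open>'v \<Rightarrow>\<^sub>L real\<close>. The lemma \<open>control_setting.B\<^sub>1_apply\<close> below shows that
  the form is bounded and linear in its second argument, so that \<^const>\<open>Blinfun\<close> is harmless.
\<close>

definition B\<^sub>1_op :: "nat \<Rightarrow> (nat \<Rightarrow> nat) \<Rightarrow> (nat \<Rightarrow> 'x measure) \<Rightarrow>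
    ('v \<Rightarrow> nat \<Rightarrow> 'x \<Rightarrow> nat \<Rightarrow> real) \<Rightarrow> (nat \<Rightarrow> (nat \<Rightarrow> real) \<Rightarrow> (nat \<Rightarrow> real)) \<Rightarrow>
    'v :: real_normed_vector \<Rightarrow> ('v \<Rightarrow>\<^sub>L real)"
  where "B\<^sub>1_op J N \<mu> I\<^sub>U g u = Blinfun (B\<^sub>1_form J N \<mu> I\<^sub>U g u)"

text \<open>Operators in \<open>'h\<close> are identified with their graphs.\<close>

definition part_in_H :: "('v :: real_normed_vector \<Rightarrow>\<^sub>L 'h :: real_inner) \<Rightarrow>
    ('v \<Rightarrow> ('v \<Rightarrow>\<^sub>L real)) \<Rightarrow> ('h \<times> 'h) set"
  where "part_in_H \<iota> F = {(blinfun_apply \<iota> v, h) | v h.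
    \<forall>w. blinfun_apply (F v) w = h \<bullet> blinfun_apply \<iota> w}"

definition op_apply :: "('h \<times> 'h) set \<Rightarrow> 'h \<Rightarrow> 'h"
  where "op_apply A x = (THE y. (x, y) \<in> A)"

definition monotone_graph :: "('h :: real_inner \<times> 'h) set \<Rightarrow> bool"
  where "monotone_graph A \<longleftrightarrow>
    (\<forall>(x, y)\<in>A. \<forall>(x', y')\<in>A. (y - y') \<bullet> (x - x') \<ge> 0)"

definition maximal_monotone :: "('h :: real_inner \<times> 'h) set \<Rightarrow> bool"
  where "maximal_monotone A \<longleftrightarrow>
    monotone_graph A \<and> (\<forall>A'. monotone_graph A' \<and> A \<subseteq> A' \<longrightarrow> A' = A)"

definition maximal_quasi_monotone :: "('h :: real_inner \<times> 'h) set \<Rightarrow> bool"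
  where "maximal_quasi_monotone A \<longleftrightarrow>
    (\<exists>\<omega>\<ge>0. maximal_monotone {(x, y + \<omega> *\<^sub>R x) | x y. (x, y) \<in> A})"

definition blinfun_invertible :: "('h :: real_normed_vector \<Rightarrow>\<^sub>L 'h) \<Rightarrow> bool"
  where "blinfun_invertible S \<longleftrightarrow> (\<exists>R. S o\<^sub>L R = id_blinfun \<and> R o\<^sub>L S = id_blinfun)"

definition blinfun_inv :: "('h :: real_normed_vector \<Rightarrow>\<^sub>L 'h) \<Rightarrow> ('h \<Rightarrow>\<^sub>L 'h)"
  where "blinfun_inv S = (THE R. S o\<^sub>L R = id_blinfun \<and> R o\<^sub>L S = id_blinfun)"

text \<open>Derivatives at \<open>0\<close> are one-sided.\<close>

definition C1_halfline :: "(real \<Rightarrow> 'b :: real_normed_vector) \<Rightarrow> (real \<Rightarrow> 'b) \<Rightarrow> bool"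
  where "C1_halfline f f' \<longleftrightarrow>
    (\<forall>t\<ge>0. (f has_vector_derivative f' t) (at t within {0..})) \<and> continuous_on {0..} f'"

definition locally_Lipschitz_halfline :: "(real \<Rightarrow> 'b :: metric_space) \<Rightarrow> bool"
  where "locally_Lipschitz_halfline f \<longleftrightarrow> (\<forall>T>0. \<exists>L. L-lipschitz_on {0..T} f)"

text \<open>
  Outside a countable set, \<open>x'(t)\<close> exists, equals \<open>- A(t) x(t)\<close>, and this function of time, which
  is defined on the whole half-line, is continuous at \<open>t\<close>.
\<close>

definition is_solution :: "(real \<Rightarrow> ('h :: real_normed_vector \<times> 'h) set) \<Rightarrow> 'h \<Rightarrow> (real \<Rightarrow> 'h) \<Rightarrow> bool"
  where "is_solution A x\<^sub>0 x \<longleftrightarrow>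
    continuous_on {0..} x \<and> x 0 = x\<^sub>0 \<and> (\<forall>t\<ge>0. x t \<in> Domain (A t)) \<and>
    (\<exists>E. countable E \<and> (\<forall>t\<in>{0..} - E.
      (x has_vector_derivative - op_apply (A t) (x t)) (at t within {0..}) \<and>
      continuous (at t within {0..}) (\<lambda>s. - op_apply (A s) (x s))))"

lemma blinfun_inv_unique:
  assumes "S o\<^sub>L R = id_blinfun" "R o\<^sub>L S = id_blinfun"
  shows "blinfun_inv S = R"
  unfolding blinfun_inv_def
proof (rule the_equality)
  fix R' assume "S o\<^sub>L R' = id_blinfun \<and> R' o\<^sub>L S = id_blinfun"
  then have "blinfun_apply R' y = blinfun_apply R y" for y
    using assms by (metis blinfun_apply_blinfun_compose blinfun_apply_id_blinfun id_apply)
  then show "R' = R" by (rule blinfun_eqI)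
qed (use assms in blast)

lemma (in control_setting) part_in_H_unique:
  assumes "(x, y) \<in> part_in_H \<iota> F" "(x, y') \<in> part_in_H \<iota> F"
  shows "y = y'"
proof -
  obtain v where v: "x = blinfun_apply \<iota> v" "\<And>w. blinfun_apply (F v) w = y \<bullet> blinfun_apply \<iota> w"
    using assms(1) by (auto simp: part_in_H_def)
  obtain v' where v': "x = blinfun_apply \<iota> v'"
    "\<And>w. blinfun_apply (F v') w = y' \<bullet> blinfun_apply \<iota> w"
    using assms(2) by (auto simp: part_in_H_def)
  have "v = v'" using v(1) v'(1) embedding_inj by (metis injD)
  then have eq: "(y - y') \<bullet> z = 0" if "z \<in> range (blinfun_apply \<iota>)" for z
    using that v(2) v'(2) by (auto simp: inner_diff_left)
  have "closed {z. (y - y') \<bullet> z = 0}" by (rule closed_hyperplane)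
  then have "closure (range (blinfun_apply \<iota>)) \<subseteq> {z. (y - y') \<bullet> z = 0}"
    using eq by (intro closure_minimal) auto
  then have "(y - y') \<bullet> (y - y') = 0" using embedding_dense by blast
  then show ?thesis by simp
qed

lemma (in control_setting) op_apply_part_in_H:
  assumes "(x, y) \<in> part_in_H \<iota> F"
  shows "op_apply (part_in_H \<iota> F) x = y"
  unfolding op_apply_def using assms part_in_H_unique by blast

lemma vnorm_sq: "(vnorm n x)\<^sup>2 = (\<Sum>i<n. (x i)\<^sup>2)"
  by (simp add: vnorm_def L2_set_def sum_nonneg)

lemma abs_dot_le: "\<bar>dot n x y\<bar> \<le> ((vnorm n x)\<^sup>2 + (vnorm n y)\<^sup>2) / 2"
proof -
  have "\<bar>x i * y i\<bar> \<le> ((x i)\<^sup>2 + (y i)\<^sup>2) / 2" for i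
    using sum_squares_bound[of "\<bar>x i\<bar>" "\<bar>y i\<bar>"] by (simp add: abs_mult)
  then have "\<bar>dot n x y\<bar> \<le> (\<Sum>i<n. ((x i)\<^sup>2 + (y i)\<^sup>2) / 2)"
    unfolding dot_def by (intro order_trans[OF sum_abs] sum_mono)
  then show ?thesis
    by (simp add: vnorm_sq sum.distrib sum_divide_distrib[symmetric])
qed

context control_setting
begin

lemma I_L2: "j < J \<Longrightarrow> I\<^sub>U v j \<in> L2_fun (\<mu> j) (N j)"
  using I_in_U[of j v] U_subspace[of j] unfolding closed_L2_subspace_def by blast

lemma I_meas: "j < J \<Longrightarrow> i < N j \<Longrightarrow> (\<lambda>x. I\<^sub>U v j x i) \<in> borel_measurable (\<mu> j)"
  using I_L2 by (auto simp: L2_fun_def)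

lemma g_meas:
  assumes j: "j < J" and i: "i < N j"
  shows "(\<lambda>x. g j (I\<^sub>U u j x) i) \<in> borel_measurable (\<mu> j)"
proof -
  let ?n = "N j"
  let ?P = "\<lambda>(x::nat \<Rightarrow> real) k. if k < ?n then x k else 0"
  have P: "continuous_map euclidean (Euclidean_space ?n) ?P"
    using continuous_map_componentwise_Euclidean_space[of euclidean ?n "\<lambda>x. x"]
    by (auto simp: continuous_map_iff_continuous2[symmetric])
  have c: "continuous_map euclidean euclidean (\<lambda>x. (g j \<circ> ?P) x i)"
    using continuous_map_compose[OF P g_cont[OF j]]
    unfolding Euclidean_space_def continuous_map_in_subtopology
    by (auto simp: continuous_map_componentwise_UNIV)
  then have "continuous_on UNIV (\<lambda>x. (g j \<circ> ?P) x i)" by simp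
  then have 1: "(\<lambda>x. (g j \<circ> ?P) x i) \<in> borel_measurable borel"
    by (rule borel_measurable_continuous_onI)
  have 2: "(\<lambda>x. ?P (I\<^sub>U u j x)) \<in> borel_measurable (\<mu> j)"
  proof (rule measurable_coordinatewise_then_product)
    show "(\<lambda>x. ?P (I\<^sub>U u j x) k) \<in> borel_measurable (\<mu> j)" for k
      using I_meas[OF j] by (cases "k < ?n") auto
  qed
  have "(\<lambda>x. (g j \<circ> ?P) (?P (I\<^sub>U u j x)) i) \<in> borel_measurable (\<mu> j)"
    using measurable_compose[OF 2 1] .
  moreover have "(g j \<circ> ?P) (?P (I\<^sub>U u j x)) i = g j (I\<^sub>U u j x) i" if "x \<in> space (\<mu> j)" for x
  proof -
    have "\<forall>k\<ge>?n. I\<^sub>U u j x k = 0"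
      using I_L2[OF j, of u] that by (auto simp: L2_fun_def topspace_Euclidean_space)
    then have "?P (?P (I\<^sub>U u j x)) = I\<^sub>U u j x" by (auto simp: fun_eq_iff)
    then show ?thesis by (metis comp_apply)
  qed
  ultimately show ?thesis by (subst measurable_cong[symmetric]) auto
qed

lemma g_sq_integrable:
  assumes j: "j < J"
  shows "integrable (\<mu> j) (\<lambda>x. (vnorm (N j) (g j (I\<^sub>U u j x)))\<^sup>2)"
proof -
  interpret finite_measure "\<mu> j" using finite_measure[OF j] .
  obtain M where M: "M > 0"
    "\<And>x. x \<in> topspace (Euclidean_space (N j)) \<Longrightarrow> vnorm (N j) (g j x) \<le> M * (1 + vnorm (N j) x)"
    using g_growth[OF j] by blast
  have I: "I\<^sub>U u j \<in> L2_fun (\<mu> j) (N j)" by (rule I_L2[OF j])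
  show ?thesis
  proof (rule Bochner_Integration.integrable_bound)
    show "integrable (\<mu> j) (\<lambda>x. 2 * M\<^sup>2 + 2 * M\<^sup>2 * (vnorm (N j) (I\<^sub>U u j x))\<^sup>2)"
      using I by (auto simp: L2_fun_def)
    show "(\<lambda>x. (vnorm (N j) (g j (I\<^sub>U u j x)))\<^sup>2) \<in> borel_measurable (\<mu> j)"
      unfolding vnorm_sq using g_meas[OF j] by (intro borel_measurable_sum) auto
    show "AE x in \<mu> j. norm ((vnorm (N j) (g j (I\<^sub>U u j x)))\<^sup>2)
        \<le> norm (2 * M\<^sup>2 + 2 * M\<^sup>2 * (vnorm (N j) (I\<^sub>U u j x))\<^sup>2)"
    proof (rule AE_I2)
      fix x assume x: "x \<in> space (\<mu> j)"
      let ?a = "vnorm (N j) (I\<^sub>U u j x)" and ?b = "vnorm (N j) (g j (I\<^sub>U u j x))"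
      have "?b \<le> M * (1 + ?a)" "0 \<le> ?b"
        using M(2) I x by (auto simp: L2_fun_def vnorm_def)
      then have "?b\<^sup>2 \<le> (M * (1 + ?a))\<^sup>2" by (rule power_mono)
      also have "\<dots> = M\<^sup>2 * (1 + 2 * ?a + ?a\<^sup>2)" by (simp add: power2_eq_square algebra_simps)
      also have "\<dots> \<le> M\<^sup>2 * (2 + 2 * ?a\<^sup>2)"
        using sum_squares_bound[of 1 ?a] by (intro mult_left_mono) auto
      finally show "norm (?b\<^sup>2) \<le> norm (2 * M\<^sup>2 + 2 * M\<^sup>2 * ?a\<^sup>2)"
        by (simp add: algebra_simps)
    qed
  qed
qed

lemma dot_integrable:
  assumes j: "j < J"
  shows "integrable (\<mu> j) (\<lambda>x. dot (N j) (g j (I\<^sub>U u j x)) (I\<^sub>U v j x))"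
proof (rule Bochner_Integration.integrable_bound)
  show "integrable (\<mu> j)
      (\<lambda>x. ((vnorm (N j) (g j (I\<^sub>U u j x)))\<^sup>2 + (vnorm (N j) (I\<^sub>U v j x))\<^sup>2) / 2)"
    using g_sq_integrable[OF j] I_L2[OF j] by (auto simp: L2_fun_def)
  show "(\<lambda>x. dot (N j) (g j (I\<^sub>U u j x)) (I\<^sub>U v j x)) \<in> borel_measurable (\<mu> j)"
    unfolding dot_def using g_meas[OF j] I_meas[OF j] by (intro borel_measurable_sum) auto
qed (use abs_dot_le in auto)

lemma B\<^sub>1_form_add: "B\<^sub>1_form J N \<mu> I\<^sub>U g u (v + w) = B\<^sub>1_form J N \<mu> I\<^sub>U g u v + B\<^sub>1_form J N \<mu> I\<^sub>U g u w"
proof -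
  have "(\<integral>x. dot (N j) (g j (I\<^sub>U u j x)) (I\<^sub>U (v + w) j x) \<partial>\<mu> j) =
    (\<integral>x. dot (N j) (g j (I\<^sub>U u j x)) (I\<^sub>U v j x) \<partial>\<mu> j) +
    (\<integral>x. dot (N j) (g j (I\<^sub>U u j x)) (I\<^sub>U w j x) \<partial>\<mu> j)" if j: "j < J" for j
  proof -
    have "(\<integral>x. dot (N j) (g j (I\<^sub>U u j x)) (I\<^sub>U (v + w) j x) \<partial>\<mu> j) =
      (\<integral>x. dot (N j) (g j (I\<^sub>U u j x)) (I\<^sub>U v j x) + dot (N j) (g j (I\<^sub>U u j x)) (I\<^sub>U w j x) \<partial>\<mu> j)"
    proof (rule integral_cong_AE)
      show "AE x in \<mu> j. dot (N j) (g j (I\<^sub>U u j x)) (I\<^sub>U (v + w) j x) =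
        dot (N j) (g j (I\<^sub>U u j x)) (I\<^sub>U v j x) + dot (N j) (g j (I\<^sub>U u j x)) (I\<^sub>U w j x)"
        using I_add[OF j, of v w]
        by eventually_elim (simp add: dot_def algebra_simps sum.distrib)
    qed (use dot_integrable[OF j] in auto)
    then show ?thesis using dot_integrable[OF j] by simp
  qed
  then show ?thesis by (simp add: B\<^sub>1_form_def sum.distrib)
qed

lemma B\<^sub>1_form_scale: "B\<^sub>1_form J N \<mu> I\<^sub>U g u (c *\<^sub>R v) = c *\<^sub>R B\<^sub>1_form J N \<mu> I\<^sub>U g u v"
proof -
  have "(\<integral>x. dot (N j) (g j (I\<^sub>U u j x)) (I\<^sub>U (c *\<^sub>R v) j x) \<partial>\<mu> j) =
    c * (\<integral>x. dot (N j) (g j (I\<^sub>U u j x)) (I\<^sub>U v j x) \<partial>\<mu> j)" if j: "j < J" for j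
  proof -
    have "(\<integral>x. dot (N j) (g j (I\<^sub>U u j x)) (I\<^sub>U (c *\<^sub>R v) j x) \<partial>\<mu> j) =
      (\<integral>x. c * dot (N j) (g j (I\<^sub>U u j x)) (I\<^sub>U v j x) \<partial>\<mu> j)"
    proof (rule integral_cong_AE)
      show "AE x in \<mu> j. dot (N j) (g j (I\<^sub>U u j x)) (I\<^sub>U (c *\<^sub>R v) j x) =
        c * dot (N j) (g j (I\<^sub>U u j x)) (I\<^sub>U v j x)"
        using I_scale[OF j, of c v]
        by eventually_elim (simp add: dot_def sum_distrib_left algebra_simps)
    qed (use dot_integrable[OF j] in auto)
    then show ?thesis by simp
  qed
  then show ?thesis by (simp add: B\<^sub>1_form_def sum_distrib_left)
qed

lemma B\<^sub>1_form_bounded: "\<exists>K. \<forall>v. \<bar>B\<^sub>1_form J N \<mu> I\<^sub>U g u v\<bar> \<le> norm v * K"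
proof -
  obtain C where C: "\<And>v. sqrt (\<Sum>j<J. (L2_norm (\<mu> j) (N j) (I\<^sub>U v j))\<^sup>2) \<le> C * norm v"
    using I_bounded by blast
  define G where "G = (\<Sum>j<J. \<integral>x. (vnorm (N j) (g j (I\<^sub>U u j x)))\<^sup>2 \<partial>\<mu> j)"
  have unit: "\<bar>B\<^sub>1_form J N \<mu> I\<^sub>U g u w\<bar> \<le> (G + C\<^sup>2) / 2" if w: "norm w = 1" for w
  proof -
    have "\<bar>B\<^sub>1_form J N \<mu> I\<^sub>U g u w\<bar> \<le>
      (\<Sum>j<J. \<bar>\<integral>x. dot (N j) (g j (I\<^sub>U u j x)) (I\<^sub>U w j x) \<partial>\<mu> j\<bar>)"
      unfolding B\<^sub>1_form_def by (rule sum_abs)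
    also have "\<dots> \<le> (\<Sum>j<J. ((\<integral>x. (vnorm (N j) (g j (I\<^sub>U u j x)))\<^sup>2 \<partial>\<mu> j) +
        (L2_norm (\<mu> j) (N j) (I\<^sub>U w j))\<^sup>2) / 2)"
    proof (rule sum_mono)
      fix j assume "j \<in> {..<J}"
      then have j: "j < J" by simp
      have i1: "integrable (\<mu> j) (\<lambda>x. (vnorm (N j) (I\<^sub>U w j x))\<^sup>2)"
        using I_L2[OF j] by (auto simp: L2_fun_def)
      have "\<bar>\<integral>x. dot (N j) (g j (I\<^sub>U u j x)) (I\<^sub>U w j x) \<partial>\<mu> j\<bar> \<le>
        (\<integral>x. \<bar>dot (N j) (g j (I\<^sub>U u j x)) (I\<^sub>U w j x)\<bar> \<partial>\<mu> j)"
        by (rule integral_abs_bound)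
      also have "\<dots> \<le> (\<integral>x. ((vnorm (N j) (g j (I\<^sub>U u j x)))\<^sup>2 + (vnorm (N j) (I\<^sub>U w j x))\<^sup>2) / 2 \<partial>\<mu> j)"
        using dot_integrable[OF j] g_sq_integrable[OF j] i1
        by (intro integral_mono abs_dot_le) auto
      also have "\<dots> = ((\<integral>x. (vnorm (N j) (g j (I\<^sub>U u j x)))\<^sup>2 \<partial>\<mu> j) +
          (L2_norm (\<mu> j) (N j) (I\<^sub>U w j))\<^sup>2) / 2"
        using g_sq_integrable[OF j] i1 by (simp add: L2_norm_def)
      finally show "\<bar>\<integral>x. dot (N j) (g j (I\<^sub>U u j x)) (I\<^sub>U w j x) \<partial>\<mu> j\<bar> \<le> \<dots>" .
    qed
    also have "\<dots> = (G + (\<Sum>j<J. (L2_norm (\<mu> j) (N j) (I\<^sub>U w j))\<^sup>2)) / 2"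
      by (simp add: G_def sum.distrib sum_divide_distrib[symmetric])
    also have "\<dots> \<le> (G + C\<^sup>2) / 2"
    proof -
      have "(\<Sum>j<J. (L2_norm (\<mu> j) (N j) (I\<^sub>U w j))\<^sup>2) \<le> C\<^sup>2"
        using C[of w] w by (simp add: sqrt_le_D)
      then show ?thesis by simp
    qed
    finally show ?thesis .
  qed
  have "\<bar>B\<^sub>1_form J N \<mu> I\<^sub>U g u v\<bar> \<le> norm v * ((G + C\<^sup>2) / 2)" for v
  proof (cases "v = 0")
    case True
    then show ?thesis using B\<^sub>1_form_scale[of u 0 v] by simp
  next
    case False
    have "B\<^sub>1_form J N \<mu> I\<^sub>U g u v = norm v * B\<^sub>1_form J N \<mu> I\<^sub>U g u (sgn v)"
      using B\<^sub>1_form_scale[of u "norm v" "sgn v"] False by (simp add: sgn_div_norm)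
    then show ?thesis
      using unit[of "sgn v"] False
      by (simp add: abs_mult norm_sgn mult_left_mono del: times_divide_eq_right)
  qed
  then show ?thesis by blast
qed

lemma B\<^sub>1_apply:
  "blinfun_apply (B\<^sub>1_op J N \<mu> I\<^sub>U g u) v =
    (\<Sum>j<J. \<integral>x. dot (N j) (g j (I\<^sub>U u j x)) (I\<^sub>U v j x) \<partial>\<mu> j)"
proof -
  obtain K where "\<And>v. \<bar>B\<^sub>1_form J N \<mu> I\<^sub>U g u v\<bar> \<le> norm v * K"
    using B\<^sub>1_form_bounded by blast
  then have "bounded_linear (B\<^sub>1_form J N \<mu> I\<^sub>U g u)"
    by (intro bounded_linear_intro[of _ K]) (auto simp: B\<^sub>1_form_add B\<^sub>1_form_scale)
  then show ?thesis
    by (simp add: B\<^sub>1_op_def bounded_linear_Blinfun_apply B\<^sub>1_form_def)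
qed

end

end

theory Submission
  imports Defs
begin

text \<open>
  Let \<open>M = A\<^sub>1 + B\<^sub>1 + \<omega>\<close> be maximal monotone. With $y = D x$, $S = D \tilde D$ and $P = S^{-1}$ the problem
  becomes $P y' + M y = Q y$ for a locally Lipschitz family \<open>Q\<close> of bounded operators: the domain no longer
  depends on time, and \<open>S(t) M\<close> is monotone for the inner product $(P(t) x, y)$, which is Lipschitz in \<open>t\<close>.
  Replacing \<open>M\<close> by its Yosida approximations $M_\varepsilon$ gives Lipschitz equations. Their solutions satisfy
  $\Psi(t) \le e^{C (t - a)} \Psi(a)$ for the energy $\Psi = (P y', y') + (P y, y)$, and this bound makes
  them converge uniformly to a Lipschitz solution with weakly continuous \<open>M y\<close>. The energy bound passes to the
  limit; restarting at any time shows that $e^{-C t} \Psi(t)$ is nonincreasing, hence continuous off a countable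
  set. Weak convergence together with convergence of the norms is strong convergence, so off that
  set \<open>M y\<close> is strongly continuous and \<open>y\<close> is differentiable.
\<close>

section \<open>Minty's theorem and the Yosida approximation\<close>

text \<open>Write A for the part of \<open>A\<^sub>1 + B\<^sub>1\<close> in H. Differentiating y = D
  x gives y' = D' D^-1 y - S A y; applying P and adding \<omega> y to both sides gives the
  transformed equation with M = A + \<omega> and Q = \<omega> + P D' D^-1. The families P and S are
  only Lipschitz in time and the Yosida terms only Lipschitz in space, with constant 1 / \<epsilon>.
  So the approximate equation cannot be differentiated to control y', and that constant must not
  survive in any bound. One-sided Dini estimates and the sign of increments of the Yosida term
  replace the differentiation. The term (P y, y) belongs to the energy because increments of Q y
  involve the norm of y itself. The limit has to keep the exact initial energy: a bound with a
  factor above 1 at the initial time would not give monotonicity after restarting. Exactness comes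
  from strong convergence of the Yosida values at the initial point to the only element of M there;
  M is single-valued because V is dense in H. Weak limits are replaced by points common to the
  closed convex hulls of all tails of a bounded sequence.\<close>

lemma convex_norm_sq:
  fixes x y :: "'a::real_inner"
  assumes "u \<ge> 0" "v \<ge> 0" "u + v = 1"
  shows "(norm (u *\<^sub>R x + v *\<^sub>R y))\<^sup>2 \<le> u * (norm x)\<^sup>2 + v * (norm y)\<^sup>2"
proof -
  have v: "v = 1 - u" using assms by simp
  have "u * (norm x)\<^sup>2 + v * (norm y)\<^sup>2 - (norm (u *\<^sub>R x + v *\<^sub>R y))\<^sup>2 = u * v * (norm (x - y))\<^sup>2"
    unfolding power2_norm_eq_inner v
    by (simp add: inner_left_distrib inner_right_distrib inner_diff_left inner_diff_right
        inner_commute[of y x] algebra_simps)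
  moreover have "u * v * (norm (x - y))\<^sup>2 \<ge> 0" using assms by simp
  ultimately show ?thesis by linarith
qed

lemma parallelogram_midpoint:
  fixes x y :: "'a::real_inner"
  shows "(norm (x - y))\<^sup>2 = 2 * (norm x)\<^sup>2 + 2 * (norm y)\<^sup>2 - 4 * (norm ((1/2) *\<^sub>R (x + y)))\<^sup>2"
  unfolding power2_norm_eq_inner
  by (simp add: inner_left_distrib inner_right_distrib inner_diff_left inner_diff_right
        inner_commute[of y x] algebra_simps)

text \<open>Almost minimal elements of the sets form a Cauchy sequence, so no weak compactness is needed.\<close>

lemma decreasing_closed_convex_Inter_nonempty:
  fixes K :: "nat \<Rightarrow> 'a::{real_inner,complete_space} set"
  assumes ne: "\<And>n. K n \<noteq> {}" and cl: "\<And>n. closed (K n)" and cv: "\<And>n. convex (K n)"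
    and dec: "\<And>m n. m \<le> n \<Longrightarrow> K n \<subseteq> K m" and bd: "bounded (K 0)"
  shows "(\<Inter>n. K n) \<noteq> {}"
proof -
  define \<delta> where "\<delta> n = (INF x\<in>K n. (norm x)\<^sup>2)" for n
  obtain R where R: "\<And>x. x \<in> K 0 \<Longrightarrow> norm x \<le> R" using bd by (auto simp: bounded_iff)
  have bb: "bdd_below ((\<lambda>x. (norm x)\<^sup>2) ` K n)" for n by (intro bdd_belowI2[of _ 0]) auto
  have \<delta>_le: "\<delta> n \<le> (norm x)\<^sup>2" if "x \<in> K n" for n x
    unfolding \<delta>_def using bb that by (rule cINF_lower)
  have \<delta>_inc: "incseq \<delta>"
    unfolding \<delta>_def incseq_def using dec by (auto intro!: cINF_superset_mono ne bb)
  have \<delta>_bd: "\<delta> n \<le> R\<^sup>2" for n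
  proof -
    obtain x where x: "x \<in> K n" using ne by blast
    then have "norm x \<le> R" using R dec[of 0 n] by auto
    then show ?thesis using \<delta>_le[OF x] power_mono[of "norm x" R 2] by simp
  qed
  have "\<exists>x\<in>K n. (norm x)\<^sup>2 < \<delta> n + 1 / Suc n" for n
    using cINF_less_iff[OF ne bb, of n "\<delta> n + 1 / Suc n"] by (simp add: \<delta>_def)
  then obtain p where p: "\<And>n. p n \<in> K n" "\<And>n. (norm (p n))\<^sup>2 < \<delta> n + 1 / Suc n" by metis
  obtain l where l: "\<delta> \<longlonglongrightarrow> l" and \<delta>l: "\<And>n. \<delta> n \<le> l"
    using incseq_convergent[OF \<delta>_inc] \<delta>_bd by blast
  \<comment> \<open>The midpoint of two points of \<open>K n\<close> lies in \<open>K n\<close>, so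
    its squared norm is at least \<open>\<delta> n\<close>; the parallelogram law turns almost
    minimality of both points into closeness.\<close>
  have est: "(norm (p m - p n))\<^sup>2 \<le> 4 * (l - \<delta> n) + 4 / Suc n" if "n \<le> m" for m n
  proof -
    have "p m \<in> K n" using p(1) dec[OF that] by blast
    then have "(1/2) *\<^sub>R (p m + p n) \<in> K n"
      using convexD[OF cv[of n], of "p m" "p n" "1/2" "1/2"] p(1)[of n]
      by (simp add: scaleR_add_right)
    then have "\<delta> n \<le> (norm ((1/2) *\<^sub>R (p m + p n)))\<^sup>2" by (rule \<delta>_le)
    moreover have "1 / Suc m \<le> 1 / real (Suc n)" using that by (simp add: frac_le)
    moreover have "4 / Suc n = 4 * (1 / real (Suc n))" by simp
    moreover have "X \<le> 4 * (l - \<delta> n) + E'" if "\<delta> n \<le> Z" "e \<le> e'" "E' = 4 * e'"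
      "X = 2 * x + 2 * y - 4 * Z" "x < \<delta> m + e" "y < \<delta> n + e'" for X Z x y e e' E'
      using that \<delta>l[of m] \<delta>l[of n] by argo
    ultimately show ?thesis
      using parallelogram_midpoint[of "p m" "p n"] p(2)[of m] p(2)[of n] by blast
  qed
  have lim0: "(\<lambda>n. 4 * (l - \<delta> n) + 4 / Suc n) \<longlonglongrightarrow> 0"
    using tendsto_add[OF tendsto_mult[OF tendsto_const tendsto_diff[OF tendsto_const l]]
        LIMSEQ_Suc[OF lim_const_over_n[of 4]], of 4 l] by simp
  have "Cauchy p"
  proof (rule metric_CauchyI)
    fix e :: real assume e: "e > 0"
    have "\<forall>\<^sub>F n in sequentially. 4 * (l - \<delta> n) + 4 / Suc n < (e/2)\<^sup>2"
      by (rule order_tendstoD[OF lim0]) (use e in simp)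
    then obtain k where k: "4 * (l - \<delta> k) + 4 / Suc k < (e/2)\<^sup>2"
      by (auto simp: eventually_sequentially)
    have "norm (p m - p k) < e/2" if "m \<ge> k" for m
      using est[OF that] k e by (intro power2_less_imp_less[of _ "e/2"]) auto
    then have "dist (p m) (p n) < e" if "m \<ge> k" "n \<ge> k" for m n
      using that norm_triangle_half_l[of "p m" "p k" e "p n"] by (auto simp: dist_norm)
    then show "\<exists>M. \<forall>m\<ge>M. \<forall>n\<ge>M. dist (p m) (p n) < e" by blast
  qed
  then obtain q where q: "p \<longlonglongrightarrow> q" using Cauchy_convergent convergent_def by blast
  have "q \<in> K n" for n
  proof (rule closed_sequentially[OF cl])
    show "(\<lambda>i. p (i + n)) \<longlonglongrightarrow> q" using q by (rule LIMSEQ_ignore_initial_segment)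
    show "p (i + n) \<in> K n" for i using p(1)[of "i + n"] dec[of n "i + n"] by auto
  qed
  then show ?thesis by blast
qed

text \<open>
  Proximal point of a convex function given by its (not necessarily full) epigraph: a minimiser
  $(w_0,r_0)$ of $r + \frac12\|w\|^2$ on \<open>E\<close> satisfies the stated first order condition.
\<close>

lemma epigraph_proximal_point:
  fixes E :: "('a::{real_inner,complete_space} \<times> real) set"
  assumes cl: "closed E" and cv: "convex E" and ne: "E \<noteq> {}"
    and lb: "\<And>w r. (w, r) \<in> E \<Longrightarrow> r \<ge> - k * norm w - l"
  shows "\<exists>w0 r0. (w0, r0) \<in> E \<and> (\<forall>w r. (w, r) \<in> E \<longrightarrow> r \<ge> r0 - w0 \<bullet> (w - w0))"
proof -
  define G where "G p = snd p + (norm (fst p))\<^sup>2 / 2" for p :: "'a \<times> real"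
  \<comment> \<open>Completing the square: the quadratic term beats the linear lower bound, so
    \<open>G\<close> is bounded below and its sublevel sets in \<open>E\<close> are bounded.\<close>
  have Glb: "G p \<ge> (norm (fst p) - k)\<^sup>2 / 2 - k\<^sup>2 / 2 - l" if "p \<in> E" for p
    using lb[of "fst p" "snd p"] that unfolding G_def by (simp add: power2_eq_square algebra_simps)
  have Glb': "G p \<ge> - k\<^sup>2 / 2 - l" if "p \<in> E" for p
    using Glb[OF that] zero_le_power2[of "norm (fst p) - k"] by linarith
  define m where "m = (INF p\<in>E. G p)"
  have bb: "bdd_below (G ` E)" using Glb' by (rule bdd_belowI2)
  have m_le: "m \<le> G p" if "p \<in> E" for p unfolding m_def using bb that by (rule cINF_lower)
  define K where "K n = E \<inter> {p. G p \<le> m + 1 / Suc n}" for n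
  have contG: "continuous_on UNIV G" unfolding G_def by (intro continuous_intros) auto
  have "(\<Inter>n. K n) \<noteq> {}"
  proof (rule decreasing_closed_convex_Inter_nonempty)
    show "K n \<noteq> {}" for n
    proof -
      have "\<exists>p\<in>E. G p < m + 1 / Suc n"
        using cINF_less_iff[OF ne bb, of "m + 1 / Suc n"] by (simp add: m_def)
      then show ?thesis by (auto simp: K_def intro: less_imp_le)
    qed
    show "closed (K n)" for n
      unfolding K_def by (intro closed_Int cl closed_Collect_le contG continuous_on_const)
    show "convex (K n)" for n
      unfolding K_def
    proof (rule convex_Int[OF cv], rule convexI, clarsimp)
      fix w r w' r' and u v :: real
      assume *: "G (w, r) \<le> m + 1 / (1 + real n)" "G (w', r') \<le> m + 1 / (1 + real n)"
        "0 \<le> u" "0 \<le> v" "u + v = 1"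
      have "G (u *\<^sub>R w + v *\<^sub>R w', u * r + v * r') \<le> u * G (w, r) + v * G (w', r')"
        using convex_norm_sq[OF *(3-5), of w w'] by (simp add: G_def algebra_simps)
      also have "\<dots> \<le> u * (m + 1 / (1 + real n)) + v * (m + 1 / (1 + real n))"
        using * by (intro add_mono mult_left_mono)
      also have "\<dots> = m + 1 / (1 + real n)" using *(5) by (metis distrib_right mult_1)
      finally show "G (u *\<^sub>R w + v *\<^sub>R w', u * r + v * r') \<le> m + 1 / (1 + real n)" .
    qed
    show "K j \<subseteq> K i" if "i \<le> j" for i j
    proof -
      have "1 / real (Suc j) \<le> 1 / Suc i" using that by (simp add: frac_le)
      then show ?thesis unfolding K_def by (auto intro: order_trans)
    qed
    show "bounded (K 0)"
    proof -
      define R where "R = k\<^sup>2 / 2 + l + m + 1"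
      have "norm (w, r) \<le> (\<bar>k\<bar> + sqrt (2 * \<bar>R\<bar>)) + (\<bar>k\<bar> * (\<bar>k\<bar> + sqrt (2 * \<bar>R\<bar>)) + \<bar>l\<bar> + \<bar>m + 1\<bar>)"
        if p: "(w, r) \<in> K 0" for w r
      proof -
        have E: "(w, r) \<in> E" and G: "G (w, r) \<le> m + 1" using p by (auto simp: K_def)
        have "(norm w - k)\<^sup>2 \<le> 2 * R" using Glb[OF E] G by (simp add: R_def)
        then have "(norm w - k)\<^sup>2 \<le> 2 * \<bar>R\<bar>" by linarith
        then have "\<bar>norm w - k\<bar> \<le> sqrt (2 * \<bar>R\<bar>)" by (metis real_sqrt_abs real_sqrt_le_iff)
        then have w: "norm w \<le> \<bar>k\<bar> + sqrt (2 * \<bar>R\<bar>)" by linarith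
        have "r \<le> m + 1" using G zero_le_power2[of "norm w"] unfolding G_def fst_conv snd_conv by linarith
        moreover have "r \<ge> - (\<bar>k\<bar> * (\<bar>k\<bar> + sqrt (2 * \<bar>R\<bar>))) - l"
        proof -
          have "k * norm w \<le> \<bar>k\<bar> * (\<bar>k\<bar> + sqrt (2 * \<bar>R\<bar>))" using w by (intro mult_mono) auto
          then show ?thesis using lb[OF E] by linarith
        qed
        moreover have "0 \<le> \<bar>k\<bar> * (\<bar>k\<bar> + sqrt (2 * \<bar>R\<bar>))" by simp
        ultimately have "\<bar>r\<bar> \<le> \<bar>k\<bar> * (\<bar>k\<bar> + sqrt (2 * \<bar>R\<bar>)) + \<bar>l\<bar> + \<bar>m + 1\<bar>" by linarith
        then show ?thesis using w norm_Pair_le[of w r] by simp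
      qed
      then show ?thesis unfolding bounded_iff by fast
    qed
  qed
  then obtain w0 r0 where wr: "\<And>n. (w0, r0) \<in> K n" by fast
  have E0: "(w0, r0) \<in> E" using wr by (auto simp: K_def)
  have "(\<lambda>n. m + 1 / Suc n) \<longlonglongrightarrow> m"
    using tendsto_add[OF tendsto_const LIMSEQ_Suc[OF lim_1_over_n], of m] by simp
  then have G0: "G (w0, r0) \<le> m"
    by (rule LIMSEQ_le_const) (use wr in \<open>auto simp: K_def\<close>)
  have "r \<ge> r0 - w0 \<bullet> (w - w0)" if wrE: "(w, r) \<in> E" for w r
  proof -
    \<comment> \<open>The minimiser is compared with the point at fraction \<tau> of the segment
      towards (w, r). Division by \<tau> leaves one error term of order \<tau>, removed by \<tau>
      \<rightarrow> 0.\<close>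
    have *: "0 \<le> (r - r0 + w0 \<bullet> (w - w0)) + \<tau> * ((norm (w - w0))\<^sup>2 / 2)" if \<tau>: "0 < \<tau>" "\<tau> < 1" for \<tau>
    proof -
      have "(1 - \<tau>) *\<^sub>R (w0, r0) + \<tau> *\<^sub>R (w, r) \<in> E"
        using cv E0 wrE \<tau> unfolding convex_alt by (metis less_eq_real_def)
      then have "m \<le> G ((1 - \<tau>) *\<^sub>R (w0, r0) + \<tau> *\<^sub>R (w, r))" by (rule m_le)
      also have "(1 - \<tau>) *\<^sub>R (w0, r0) + \<tau> *\<^sub>R (w, r) = (w0 + \<tau> *\<^sub>R (w - w0), r0 + \<tau> * (r - r0))"
        by (simp add: algebra_simps)
      also have "G \<dots> = G (w0, r0) + \<tau> * ((r - r0 + w0 \<bullet> (w - w0)) + \<tau> * ((norm (w - w0))\<^sup>2 / 2))"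
        unfolding G_def power2_norm_eq_inner
        by (simp add: inner_left_distrib inner_right_distrib inner_diff_left inner_diff_right
            inner_commute[of w w0] algebra_simps add_divide_distrib diff_divide_distrib)
      finally have "0 \<le> \<tau> * ((r - r0 + w0 \<bullet> (w - w0)) + \<tau> * ((norm (w - w0))\<^sup>2 / 2))"
        using G0 by linarith
      then show ?thesis using \<tau>(1) by (meson linorder_not_less zero_le_mult_iff)
    qed
    have "((\<lambda>\<tau>. (r - r0 + w0 \<bullet> (w - w0)) + \<tau> * ((norm (w - w0))\<^sup>2 / 2)) \<longlongrightarrow>
        (r - r0 + w0 \<bullet> (w - w0)) + 0 * ((norm (w - w0))\<^sup>2 / 2)) (at_right 0)"
      by (intro tendsto_intros)
    moreover have "\<forall>\<^sub>F \<tau> in at_right 0. 0 \<le> (r - r0 + w0 \<bullet> (w - w0)) + \<tau> * ((norm (w - w0))\<^sup>2 / 2)"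
      by (rule eventually_mono[OF eventually_at_right_real[of 0 1]]) (auto intro: *[simplified])
    ultimately have "0 \<le> (r - r0 + w0 \<bullet> (w - w0)) + 0 * ((norm (w - w0))\<^sup>2 / 2)"
      by (intro tendsto_lowerbound) auto
    then show ?thesis by simp
  qed
  then show ?thesis using E0 by blast
qed

text \<open>The graph of -f is a closed convex set with a linear lower bound, so it has a proximal
  point. Its first order condition holds in the directions h and -h, hence is an equality, and the
  proximal point itself represents f.\<close>

lemma Riesz_representation:
  fixes f :: "'a::{real_inner,complete_space} \<Rightarrow> real"
  assumes f: "bounded_linear f"
  shows "\<exists>r. \<forall>x. f x = r \<bullet> x"
proof -
  interpret bounded_linear f by (rule f)
  define E where "E = {p :: 'a \<times> real. snd p = - f (fst p)}"
  obtain k where k: "\<And>x. norm (f x) \<le> norm x * k" using bounded by blast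
  have "closed E" unfolding E_def
    by (intro closed_Collect_eq continuous_intros bounded_linear.continuous_on[OF f])
  moreover have "convex E"
    unfolding E_def by (rule convexI) (simp add: add scaleR algebra_simps)
  moreover have "E \<noteq> {}" by (auto simp: E_def intro!: exI[of _ 0])
  moreover have "r \<ge> - k * norm w - 0" if "(w, r) \<in> E" for w r
    using that k[of w] by (auto simp: E_def algebra_simps)
  ultimately obtain w0 r0 where E0: "(w0, r0) \<in> E"
      and min: "\<And>w r. (w, r) \<in> E \<Longrightarrow> r \<ge> r0 - w0 \<bullet> (w - w0)"
    using epigraph_proximal_point[of E k 0] by blast
  have le: "f h \<le> w0 \<bullet> h" for h
    using min[of "w0 + h" "- f (w0 + h)"] E0 by (simp add: E_def add)
  have "f h = w0 \<bullet> h" for h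
    using le[of h] le[of "- h"] by (simp add: neg)
  then show ?thesis by blast
qed

lemma monotone_graphD:
  assumes "monotone_graph M" "(x, y) \<in> M" "(x', y') \<in> M"
  shows "(y - y') \<bullet> (x - x') \<ge> 0"
  using bspec[OF bspec[OF assms(1)[unfolded monotone_graph_def] assms(2), simplified] assms(3)]
  by simp

text \<open>Maximality can be tested one point at a time: adjoining a point that is monotonically
  related to every element of the graph keeps the graph monotone. All later uses of maximality take
  this form.\<close>

lemma maximal_monotone_iff:
  "maximal_monotone M \<longleftrightarrow> monotone_graph M \<and>
    (\<forall>x y. (\<forall>(u, v)\<in>M. (y - v) \<bullet> (x - u) \<ge> 0) \<longrightarrow> (x, y) \<in> M)"
  (is "_ \<longleftrightarrow> _ \<and> ?R")
proof (intro iffI conjI)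
  assume m: "maximal_monotone M"
  then show mono: "monotone_graph M" by (simp add: maximal_monotone_def)
  show ?R
  proof (intro allI impI)
    fix x y assume *: "\<forall>(u, v)\<in>M. (y - v) \<bullet> (x - u) \<ge> 0"
    have sym: "(v - y) \<bullet> (u - x) = (y - v) \<bullet> (x - u)" for u v
      by (simp add: inner_diff_left inner_diff_right)
    have "monotone_graph (insert (x, y) M)"
      using mono * unfolding monotone_graph_def by (auto simp: sym)
    then show "(x, y) \<in> M" using m unfolding maximal_monotone_def by blast
  qed
next
  assume "monotone_graph M \<and> ?R"
  then show "maximal_monotone M"
    unfolding maximal_monotone_def monotone_graph_def by fast
qed

lemma maximal_monotone_nonempty:
  assumes "maximal_monotone M"
  shows "M \<noteq> {}"
  using assms unfolding maximal_monotone_iff by auto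

text \<open>
  The Fitzpatrick function of \<open>M\<close>, here given by its epigraph, dominates the duality product;
  its proximal point at the origin has the form $(x,-x)$ and lies on the graph.
\<close>

lemma maximal_monotone_zero_in_range:
  fixes M :: "('a::{real_inner,complete_space} \<times> 'a) set"
  assumes M: "maximal_monotone M"
  shows "\<exists>x. (x, - x) \<in> M"
proof -
  have mono: "\<And>u v u' v'. (u, v) \<in> M \<Longrightarrow> (u', v') \<in> M \<Longrightarrow> (v - v') \<bullet> (u - u') \<ge> 0"
    and max: "\<And>x y. (\<And>u v. (u, v) \<in> M \<Longrightarrow> (y - v) \<bullet> (x - u) \<ge> 0) \<Longrightarrow> (x, y) \<in> M"
    using M monotone_graphD[of M] unfolding maximal_monotone_iff by blast+
  obtain b b' where b: "(b, b') \<in> M" using maximal_monotone_nonempty[OF M] by auto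
  \<comment> \<open>The Fitzpatrick function at (x, y) is the supremum of v x + u y - u v over the
    graph, so its epigraph is an intersection of closed half-spaces.\<close>
  define E where "E = (\<Inter>(u, v)\<in>M. {p :: ('a \<times> 'a) \<times> real. (v, u) \<bullet> fst p - u \<bullet> v \<le> snd p})"
  have inE: "((x, y), r) \<in> E \<longleftrightarrow> (\<forall>(u, v)\<in>M. v \<bullet> x + u \<bullet> y - u \<bullet> v \<le> r)" for x y r
    by (auto simp: E_def)
  have graphE: "((u, v), u \<bullet> v) \<in> E" if uv: "(u, v) \<in> M" for u v
    unfolding inE
  proof clarify
    fix u' v' assume "(u', v') \<in> M"
    from mono[OF uv this] show "v' \<bullet> u + u' \<bullet> v - u' \<bullet> v' \<le> u \<bullet> v"
      by (simp add: inner_diff_left inner_diff_right inner_commute)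
  qed
  have "closed E" unfolding E_def
    by (intro closed_INT ballI, clarify, intro closed_Collect_le continuous_intros)
  moreover have "convex E" unfolding E_def
  proof (intro convex_INT, clarify, rule convexI, clarsimp)
    fix u v x y x' y' :: 'a and r r' s t :: real
    assume *: "v \<bullet> x + u \<bullet> y - u \<bullet> v \<le> r" "v \<bullet> x' + u \<bullet> y' - u \<bullet> v \<le> r'"
      "0 \<le> s" "0 \<le> t" "s + t = 1"
    have "s * (v \<bullet> x + u \<bullet> y - u \<bullet> v) + t * (v \<bullet> x' + u \<bullet> y' - u \<bullet> v) \<le> s * r + t * r'"
      using * by (intro add_mono mult_left_mono) auto
    moreover have "s * (u \<bullet> v) + t * (u \<bullet> v) = u \<bullet> v" using *(5) by (metis distrib_right mult_1)
    ultimately show "v \<bullet> (s *\<^sub>R x + t *\<^sub>R x') + u \<bullet> (s *\<^sub>R y + t *\<^sub>R y') - u \<bullet> v \<le> s * r + t * r'"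
      by (simp add: inner_right_distrib algebra_simps)
  qed
  moreover have "E \<noteq> {}" using graphE[OF b] by blast
  moreover have "r \<ge> - norm (b', b) * norm w - b \<bullet> b'" if "(w, r) \<in> E" for w r
  proof -
    have "(b', b) \<bullet> w - b \<bullet> b' \<le> r" using that b by (cases w) (auto simp: inE)
    moreover have "- (norm (b', b) * norm w) \<le> (b', b) \<bullet> w"
      using Cauchy_Schwarz_ineq2[of "(b', b)" w] by linarith
    ultimately show ?thesis by linarith
  qed
  ultimately obtain w0 r0 where w0: "(w0, r0) \<in> E"
      and min: "\<And>w r. (w, r) \<in> E \<Longrightarrow> r \<ge> r0 - w0 \<bullet> (w - w0)"
    using epigraph_proximal_point[of E "norm (b', b)" "b \<bullet> b'"] by blast
  obtain x p where xp: "w0 = (x, p)" by (cases w0)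
  \<comment> \<open>A smaller value would make (x, p) strictly monotonically related to all of M.
    Maximality would then put it on the graph, where the strict inequality fails against the point
    itself.\<close>
  have r0: "r0 \<ge> x \<bullet> p"
  proof (rule ccontr)
    assume "\<not> ?thesis"
    then have lt: "r0 < x \<bullet> p" by simp
    have *: "(p - v) \<bullet> (x - u) > 0" if "(u, v) \<in> M" for u v
    proof -
      have "v \<bullet> x + u \<bullet> p - u \<bullet> v \<le> r0" using w0 that by (auto simp: xp inE)
      then show ?thesis using lt
        by (simp add: inner_diff_left inner_diff_right inner_commute)
    qed
    then have "(x, p) \<in> M" by (meson less_imp_le max)
    from *[OF this] show False by simp
  qed
  \<comment> \<open>The first order condition at the points of \<open>E\<close> over the graph. It
    says that (-p, -x) is monotonically related to M, hence belongs to M; taken at that very point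
    its left side is zero, which forces p = -x.\<close>
  have key: "(- x - v) \<bullet> (- p - u) \<ge> (norm (x + p))\<^sup>2" if "(u, v) \<in> M" for u v
  proof -
    have "u \<bullet> v \<ge> r0 - (x, p) \<bullet> ((u, v) - (x, p))" using min[OF graphE[OF that]] by (simp add: xp)
    then show ?thesis using r0 unfolding power2_norm_eq_inner
      by (simp add: inner_left_distrib inner_right_distrib inner_diff_left inner_diff_right
          inner_commute algebra_simps)
  qed
  then have "(- p, - x) \<in> M" by (intro max order_trans[OF zero_le_power2])
  moreover from key[OF this] have "p = - x" by (simp add: eq_neg_iff_add_eq_0 add.commute)
  ultimately show ?thesis by auto
qed

text \<open>The equation x + \<epsilon> y = z on M is y' = -x on the graph obtained from M by
  scaling the values with \<epsilon> and subtracting z; scaling and translation preserve maximal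
  monotonicity.\<close>

theorem Minty:
  fixes M :: "('a::{real_inner,complete_space} \<times> 'a) set"
  assumes M: "maximal_monotone M" and "\<epsilon> > 0"
  shows "\<exists>x y. (x, y) \<in> M \<and> x + \<epsilon> *\<^sub>R y = z"
proof -
  define M' where "M' = {(x, \<epsilon> *\<^sub>R y - z) | x y. (x, y) \<in> M}"
  have [simp]: "\<epsilon> *\<^sub>R y - z - (\<epsilon> *\<^sub>R y' - z) = \<epsilon> *\<^sub>R (y - y')" for y y' by (simp add: algebra_simps)
  have "maximal_monotone M'"
    unfolding maximal_monotone_iff
  proof (intro conjI allI impI)
    show "monotone_graph M'"
      unfolding monotone_graph_def M'_def
    proof clarsimp
      fix x y x' y' assume "(x, y) \<in> M" "(x', y') \<in> M"
      then have "(y - y') \<bullet> (x - x') \<ge> 0"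
        using monotone_graphD M unfolding maximal_monotone_def by blast
      then show "0 \<le> \<epsilon> * ((y - y') \<bullet> (x - x'))" using \<open>\<epsilon> > 0\<close> by simp
    qed
    fix x y assume *: "\<forall>(u, v)\<in>M'. (y - v) \<bullet> (x - u) \<ge> 0"
    define y' where "y' = (1/\<epsilon>) *\<^sub>R (y + z)"
    have y: "y = \<epsilon> *\<^sub>R y' - z" using \<open>\<epsilon> > 0\<close> by (simp add: y'_def)
    have "\<forall>(u, v)\<in>M. (y' - v) \<bullet> (x - u) \<ge> 0"
    proof clarify
      fix u v assume "(u, v) \<in> M"
      then have "(y - (\<epsilon> *\<^sub>R v - z)) \<bullet> (x - u) \<ge> 0" using * by (auto simp: M'_def)
      then show "(y' - v) \<bullet> (x - u) \<ge> 0" using \<open>\<epsilon> > 0\<close> by (simp add: y zero_le_mult_iff)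
    qed
    then have "(x, y') \<in> M" using M unfolding maximal_monotone_iff by blast
    then show "(x, y) \<in> M'" by (auto simp: M'_def y)
  qed
  then obtain x y where "(x, y) \<in> M" "- x = \<epsilon> *\<^sub>R y - z"
    using maximal_monotone_zero_in_range by (force simp: M'_def)
  moreover then have "x + \<epsilon> *\<^sub>R y = z" by (simp add: algebra_simps neg_eq_iff_add_eq_0)
  ultimately show ?thesis by blast
qed

text \<open>The point p plays the role of a weak limit: every closed half-space that contains a tail
  of m also contains p. Monotonicity against a fixed graph point is such a condition up to an error
  that vanishes as u tends to y. Membership in the hulls stays in the conclusion so that further
  closed convex constraints on m can be transferred to p.\<close>

lemma maximal_monotone_demiclosed:
  fixes M :: "('a::{real_inner,complete_space} \<times> 'a) set"
  assumes M: "maximal_monotone M" and um: "\<And>n. (u n, m n) \<in> M" and u: "u \<longlonglongrightarrow> y"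
    and C: "\<And>n. norm (m n) \<le> C"
  shows "\<exists>p. (y, p) \<in> M \<and> (\<forall>n. p \<in> closure (convex hull (m ` {n..})))"
proof -
  define K where "K n = closure (convex hull (m ` {n..}))" for n
  have K_le: "K n \<subseteq> S" if "\<And>i. i \<ge> n \<Longrightarrow> m i \<in> S" "closed S" "convex S" for n S
    unfolding K_def using that by (intro closure_minimal hull_minimal) auto
  have "(\<Inter>n. K n) \<noteq> {}"
  proof (rule decreasing_closed_convex_Inter_nonempty)
    show "K n \<noteq> {}" for n by (simp add: K_def)
    show "closed (K n)" for n by (simp add: K_def)
    show "convex (K n)" for n by (simp add: K_def convex_closure)
    show "K j \<subseteq> K i" if "i \<le> j" for i j
      unfolding K_def using that by (intro closure_mono hull_mono image_mono) auto
    have "K 0 \<subseteq> cball 0 C" by (rule K_le) (use C in auto)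
    then show "bounded (K 0)" using bounded_subset bounded_cball by blast
  qed
  then obtain p where p: "\<And>n. p \<in> K n" by blast
  have "(y, p) \<in> M"
  proof -
    have "(p - b) \<bullet> (y - a) \<ge> 0" if ab: "(a, b) \<in> M" for a b
    proof -
      \<comment> \<open>Replacing \<open>u i\<close> by its limit y costs at most (|b| + C) |y - u
        i|, which is below e on a tail.\<close>
      have "p \<bullet> (a - y) \<le> b \<bullet> (a - y) + e" if e: "e > 0" for e
      proof -
        have "(\<lambda>n. (norm b + C) * norm (y - u n)) \<longlonglongrightarrow> (norm b + C) * norm (y - y)"
          by (intro tendsto_intros u)
        then have "\<forall>\<^sub>F n in sequentially. (norm b + C) * norm (y - u n) < e"
          by (rule order_tendstoD) (use e in simp)
        then obtain n where n: "\<And>i. i \<ge> n \<Longrightarrow> (norm b + C) * norm (y - u i) < e"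
          by (auto simp: eventually_sequentially)
        have "K n \<subseteq> {q. (a - y) \<bullet> q \<le> b \<bullet> (a - y) + e}"
        proof (rule K_le)
          fix i assume i: "i \<ge> n"
          have "(b - m i) \<bullet> (a - u i) \<ge> 0"
            using monotone_graphD[OF _ ab um] M by (simp add: maximal_monotone_def)
          moreover have "(b - m i) \<bullet> (y - u i) \<le> (norm b + C) * norm (y - u i)"
          proof -
            have "norm (b - m i) \<le> norm b + C" using norm_triangle_ineq4[of b "m i"] C[of i] by simp
            then show ?thesis
              using norm_cauchy_schwarz[of "b - m i" "y - u i"]
              by (meson mult_right_mono norm_ge_zero order_trans)
          qed
          moreover have "(b - m i) \<bullet> (a - u i) = (b - m i) \<bullet> (a - y) + (b - m i) \<bullet> (y - u i)"
            by (simp add: inner_diff_right)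
          ultimately have "(b - m i) \<bullet> (a - y) \<ge> - e" using n[OF i] by linarith
          then show "m i \<in> {q. (a - y) \<bullet> q \<le> b \<bullet> (a - y) + e}"
            by (simp only: mem_Collect_eq inner_commute[of "a - y"] inner_diff_left[of b])
        qed (auto intro: closed_halfspace_le convex_halfspace_le)
        then show ?thesis using p[of n] by (auto simp: inner_commute)
      qed
      then have "p \<bullet> (a - y) \<le> b \<bullet> (a - y)" by (rule field_le_epsilon)
      then show ?thesis by (simp add: inner_diff_left inner_diff_right)
    qed
    then show ?thesis using M unfolding maximal_monotone_iff by blast
  qed
  then show ?thesis using p by (auto simp: K_def)
qed

lemma maximal_monotone_closed_bounded:
  fixes M :: "('a::{real_inner,complete_space} \<times> 'a) set"
  assumes M: "maximal_monotone M" and um: "\<And>n. (u n, m n) \<in> M" and u: "u \<longlonglongrightarrow> y"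
    and C: "\<And>n. norm (m n) \<le> C"
  shows "\<exists>p. (y, p) \<in> M \<and> norm p \<le> C"
proof -
  obtain p where p: "(y, p) \<in> M" "p \<in> closure (convex hull (m ` {0..}))"
    using maximal_monotone_demiclosed[OF assms] by blast
  have "closure (convex hull (m ` {0..})) \<subseteq> cball 0 C"
    using C by (intro closure_minimal hull_minimal) auto
  then have "p \<in> cball 0 C" using p(2) by (rule subsetD)
  then show ?thesis using p(1) by (auto simp: mem_cball_0)
qed

text \<open>A failing sequence would keep m in the half-space where (m - p) w \<ge> e.
  Demiclosedness then yields an element of M over y in that half-space, whereas p is the only
  element there. The \<delta> formulation serves arbitrary filters, not only sequences.\<close>

lemma maximal_monotone_demicontinuous:
  fixes M :: "('a::{real_inner,complete_space} \<times> 'a) set"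
  assumes M: "maximal_monotone M" and sv: "single_valued M" and p: "(y, p) \<in> M" and e: "e > 0"
  shows "\<exists>\<delta>>0. \<forall>u m. (u, m) \<in> M \<longrightarrow> norm (u - y) < \<delta> \<longrightarrow> norm m \<le> C \<longrightarrow> \<bar>(m - p) \<bullet> w\<bar> < e"
proof -
  have one: "\<exists>\<delta>>0. \<forall>u m. (u, m) \<in> M \<longrightarrow> norm (u - y) < \<delta> \<longrightarrow> norm m \<le> C \<longrightarrow> (m - p) \<bullet> w < e" for w
  proof (rule ccontr)
    assume "\<not> ?thesis"
    then have "\<exists>u m. (u, m) \<in> M \<and> norm (u - y) < 1 / Suc n \<and> norm m \<le> C \<and> (m - p) \<bullet> w \<ge> e" for n
      by (metis not_less of_nat_0_less_iff zero_less_Suc zero_less_divide_1_iff)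
    then obtain u m where um: "\<And>n. (u n, m n) \<in> M" "\<And>n. norm (u n - y) < 1 / Suc n"
      "\<And>n. norm (m n) \<le> C" "\<And>n. (m n - p) \<bullet> w \<ge> e" by metis
    have "(\<lambda>n. u n - y) \<longlonglongrightarrow> 0"
    proof (rule Lim_null_comparison)
      show "(\<lambda>n. 1 / real (Suc n)) \<longlonglongrightarrow> 0" by (rule LIMSEQ_Suc[OF lim_1_over_n])
      show "\<forall>\<^sub>F n in sequentially. norm (u n - y) \<le> 1 / real (Suc n)"
        using um(2) by (intro always_eventually allI less_imp_le)
    qed
    then have "u \<longlonglongrightarrow> y" by (rule LIM_zero_cancel)
    then obtain q where q: "(y, q) \<in> M" "q \<in> closure (convex hull (m ` {0..}))"
      using maximal_monotone_demiclosed[of M u m y, OF M um(1) _ um(3)] by blast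
    have "closure (convex hull (m ` {0..})) \<subseteq> {q. w \<bullet> q \<ge> w \<bullet> p + e}"
    proof (intro closure_minimal hull_minimal closed_halfspace_ge convex_halfspace_ge)
      show "m ` {0..} \<subseteq> {q. w \<bullet> q \<ge> w \<bullet> p + e}"
        using um(4) by (auto simp: inner_diff_left inner_commute[of w] algebra_simps)
    qed
    moreover have "q = p" using sv q(1) p by (rule single_valuedD)
    ultimately show False using q e by auto
  qed
  obtain \<delta>1 \<delta>2 where "\<delta>1 > 0" "\<And>u m. (u, m) \<in> M \<Longrightarrow> norm (u - y) < \<delta>1 \<Longrightarrow> norm m \<le> C \<Longrightarrow> (m - p) \<bullet> w < e"
    "\<delta>2 > 0" "\<And>u m. (u, m) \<in> M \<Longrightarrow> norm (u - y) < \<delta>2 \<Longrightarrow> norm m \<le> C \<Longrightarrow> (m - p) \<bullet> (- w) < e"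
    using one[of w] one[of "- w"] by metis
  then have "min \<delta>1 \<delta>2 > 0 \<and> (\<forall>u m. (u, m) \<in> M \<longrightarrow> norm (u - y) < min \<delta>1 \<delta>2 \<longrightarrow> norm m \<le> C \<longrightarrow>
      \<bar>(m - p) \<bullet> w\<bar> < e)"
    by (auto simp: abs_less_iff)
  then show ?thesis by blast
qed

section \<open>Resolvents and Yosida approximations\<close>

definition resolvent :: "('a::real_vector \<times> 'a) set \<Rightarrow> real \<Rightarrow> 'a \<Rightarrow> 'a"
  where "resolvent M \<epsilon> z = (SOME x. (x, (1 / \<epsilon>) *\<^sub>R (z - x)) \<in> M)"

definition yosida :: "('a::real_vector \<times> 'a) set \<Rightarrow> real \<Rightarrow> 'a \<Rightarrow> 'a"
  where "yosida M \<epsilon> z = (1 / \<epsilon>) *\<^sub>R (z - resolvent M \<epsilon> z)"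

context
  fixes M :: "('a::{real_inner,complete_space} \<times> 'a) set"
  assumes M: "maximal_monotone M"
begin

text \<open>Minty's theorem provides the point that \<open>resolvent\<close> chooses, namely the
  value of (1 + \<epsilon> M)^-1 at z. Yosida values are thus elements of M, but over the resolvent
  and not over z.\<close>

lemma yosida_in_graph:
  assumes "\<epsilon> > 0"
  shows "(resolvent M \<epsilon> z, yosida M \<epsilon> z) \<in> M"
proof -
  obtain x y where xy: "(x, y) \<in> M" "x + \<epsilon> *\<^sub>R y = z" using Minty[OF M assms] by blast
  then have "(1 / \<epsilon>) *\<^sub>R (z - x) = y" using assms by auto
  then show ?thesis unfolding yosida_def resolvent_def using xy by (metis (mono_tags, lifting) someI_ex)
qed

lemma resolvent_yosida: "\<epsilon> > 0 \<Longrightarrow> z = resolvent M \<epsilon> z + \<epsilon> *\<^sub>R yosida M \<epsilon> z"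
  by (simp add: yosida_def)

lemma monotoneD: "(x, y) \<in> M \<Longrightarrow> (x', y') \<in> M \<Longrightarrow> (y - y') \<bullet> (x - x') \<ge> 0"
  using M monotone_graphD unfolding maximal_monotone_def by blast

lemma yosida_inner_ge:
  assumes "\<epsilon> > 0" "\<eta> > 0"
  shows "(yosida M \<epsilon> z - yosida M \<eta> z') \<bullet> (z - z') \<ge>
    (yosida M \<epsilon> z - yosida M \<eta> z') \<bullet> (\<epsilon> *\<^sub>R yosida M \<epsilon> z - \<eta> *\<^sub>R yosida M \<eta> z')"
proof -
  have "z - z' = (resolvent M \<epsilon> z - resolvent M \<eta> z') +
      (\<epsilon> *\<^sub>R yosida M \<epsilon> z - \<eta> *\<^sub>R yosida M \<eta> z')"
    using resolvent_yosida[OF assms(1), of z] resolvent_yosida[OF assms(2), of z']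
    by (simp add: algebra_simps)
  then show ?thesis
    using monotoneD[OF yosida_in_graph[OF assms(1)] yosida_in_graph[OF assms(2)], of z z']
    by (simp add: inner_right_distrib)
qed

text \<open>Cocoercivity, the case of equal parameters. It contains monotonicity and, through
  Cauchy-Schwarz, the Lipschitz constant 1 / \<epsilon>.\<close>

lemma yosida_monotone_strong:
  assumes "\<epsilon> > 0"
  shows "(yosida M \<epsilon> z - yosida M \<epsilon> z') \<bullet> (z - z') \<ge> \<epsilon> * (norm (yosida M \<epsilon> z - yosida M \<epsilon> z'))\<^sup>2"
  using yosida_inner_ge[OF assms assms, of z z']
  by (simp add: power2_norm_eq_inner flip: scaleR_diff_right)

lemma yosida_monotone: "\<epsilon> > 0 \<Longrightarrow> (yosida M \<epsilon> z - yosida M \<epsilon> z') \<bullet> (z - z') \<ge> 0"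
  using yosida_monotone_strong[of \<epsilon> z z'] by (smt (verit) mult_nonneg_nonneg zero_le_power2)

lemma yosida_lipschitz:
  assumes "\<epsilon> > 0"
  shows "norm (yosida M \<epsilon> z - yosida M \<epsilon> z') \<le> (1 / \<epsilon>) * norm (z - z')"
proof -
  let ?d = "norm (yosida M \<epsilon> z - yosida M \<epsilon> z')"
  have "\<epsilon> * ?d * ?d \<le> ?d * norm (z - z')"
    using yosida_monotone_strong[OF assms, of z z']
      norm_cauchy_schwarz[of "yosida M \<epsilon> z - yosida M \<epsilon> z'" "z - z'"]
    by (simp add: power2_eq_square mult.assoc)
  then have "\<epsilon> * ?d \<le> norm (z - z')"
    by (cases "?d = 0") (auto simp: mult.commute mult_le_cancel_left)
  then show ?thesis using assms by (simp add: field_simps)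
qed

text \<open>Since z minus its resolvent is \<epsilon> times the Yosida value, monotonicity between z
  and the resolvent says that p minus the Yosida value pairs nonnegatively with that value. The
  bound is independent of \<epsilon> and controls the initial energies.\<close>

lemma norm_yosida_le:
  assumes "\<epsilon> > 0" "(z, p) \<in> M"
  shows "norm (yosida M \<epsilon> z) \<le> norm p"
proof -
  let ?y = "yosida M \<epsilon> z"
  have "z - resolvent M \<epsilon> z = \<epsilon> *\<^sub>R ?y" using assms(1) by (simp add: yosida_def)
  then have "0 \<le> \<epsilon> * ((p - ?y) \<bullet> ?y)"
    using monotoneD[OF assms(2) yosida_in_graph[OF assms(1)], of z] by simp
  then have "0 \<le> (p - ?y) \<bullet> ?y" using assms(1) by (simp add: zero_le_mult_iff)
  then have "norm ?y * norm ?y \<le> norm p * norm ?y"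
    using norm_cauchy_schwarz[of p ?y]
    by (simp add: inner_diff_left power2_norm_eq_inner flip: power2_eq_square)
  then show ?thesis by (cases "norm ?y = 0") (auto simp: mult_le_cancel_right)
qed

lemma norm_resolvent_diff: "\<epsilon> > 0 \<Longrightarrow> norm (resolvent M \<epsilon> z - z) = \<epsilon> * norm (yosida M \<epsilon> z)"
  by (simp add: yosida_def norm_minus_commute)

text \<open>Demicontinuity with test vector p gives convergence of the product with p; together with
  norms at most |p|, expanding the square upgrades this to strong convergence.\<close>

lemma yosida_tendsto:
  assumes sv: "single_valued M" and p: "(z, p) \<in> M"
  shows "((\<lambda>\<epsilon>. yosida M \<epsilon> z) \<longlongrightarrow> p) (at_right 0)"
proof (rule tendstoI)
  fix e :: real assume e: "e > 0"
  obtain \<delta> where \<delta>: "\<delta> > 0" and *: "\<And>u m. (u, m) \<in> M \<Longrightarrow> norm (u - z) < \<delta> \<Longrightarrow> norm m \<le> norm p \<Longrightarrow>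
      \<bar>(m - p) \<bullet> p\<bar> < e\<^sup>2 / 2"
    using maximal_monotone_demicontinuous[OF M sv p, of "e\<^sup>2 / 2" "norm p" p] e by auto
  \<comment> \<open>The resolvent moves z by \<epsilon> times a norm at most |p|, so this range
    keeps it within \<delta> of z.\<close>
  have "\<forall>\<^sub>F \<epsilon> in at_right 0. \<epsilon> \<in> {0<..<\<delta> / (norm p + 1)}"
    using \<delta> by (intro eventually_at_right_real divide_pos_pos) (auto simp: add_nonneg_pos)
  then show "\<forall>\<^sub>F \<epsilon> in at_right 0. dist (yosida M \<epsilon> z) p < e"
  proof eventually_elim
    case (elim \<epsilon>)
    let ?y = "yosida M \<epsilon> z"
    have \<epsilon>: "\<epsilon> > 0" using elim by simp
    have y: "norm ?y \<le> norm p" by (rule norm_yosida_le[OF \<epsilon> p])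
    have "norm (resolvent M \<epsilon> z - z) \<le> \<epsilon> * (norm p + 1)"
      using y \<epsilon> by (simp add: norm_resolvent_diff)
    also have "\<dots> < \<delta>" using elim norm_ge_zero[of p] by (simp add: pos_less_divide_eq add_nonneg_pos)
    finally have "\<bar>(?y - p) \<bullet> p\<bar> < e\<^sup>2 / 2" by (rule *[OF yosida_in_graph[OF \<epsilon>] _ y])
    moreover have "(norm ?y)\<^sup>2 \<le> (norm p)\<^sup>2" using y by (simp add: power_mono)
    moreover have "(norm (?y - p))\<^sup>2 = (norm ?y)\<^sup>2 - (norm p)\<^sup>2 - 2 * ((?y - p) \<bullet> p)"
      unfolding power2_norm_eq_inner by (simp add: inner_diff_left inner_diff_right inner_commute)
    ultimately have "(norm (?y - p))\<^sup>2 < e\<^sup>2" by linarith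
    then show ?case using e by (simp add: dist_norm power2_less_imp_less)
  qed
qed

end

lemma maximal_monotone_weak_tendsto:
  fixes M :: "('a::{real_inner,complete_space} \<times> 'a) set"
  assumes M: "maximal_monotone M" and sv: "single_valued M" and p: "(y, p) \<in> M"
    and um: "\<forall>\<^sub>F i in F. (u i, m i) \<in> M \<and> norm (m i) \<le> C" and u: "(u \<longlongrightarrow> y) F"
  shows "((\<lambda>i. m i \<bullet> x) \<longlongrightarrow> p \<bullet> x) F"
proof (rule tendstoI)
  fix e :: real assume "e > 0"
  then obtain \<delta> where \<delta>: "\<delta> > 0" "\<And>u m. (u, m) \<in> M \<Longrightarrow> norm (u - y) < \<delta> \<Longrightarrow> norm m \<le> C \<Longrightarrow>
      \<bar>(m - p) \<bullet> x\<bar> < e"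
    using maximal_monotone_demicontinuous[OF M sv p] by metis
  from um tendstoD[OF u \<delta>(1)] show "\<forall>\<^sub>F i in F. dist (m i \<bullet> x) (p \<bullet> x) < e"
    by eventually_elim (use \<delta>(2) in \<open>auto simp: dist_norm inner_diff_left\<close>)
qed

lemma weak_strong_inner_tendsto:
  fixes m :: "'i \<Rightarrow> 'a::real_inner"
  assumes m: "((\<lambda>i. m i \<bullet> x) \<longlongrightarrow> l) F" and C: "\<forall>\<^sub>F i in F. norm (m i) \<le> C" and X: "(X \<longlongrightarrow> x) F"
  shows "((\<lambda>i. m i \<bullet> X i) \<longlongrightarrow> l) F"
proof (rule Lim_transform[OF m])
  have ev: "\<forall>\<^sub>F i in F. norm (m i \<bullet> X i - m i \<bullet> x) \<le> C * norm (X i - x)"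
    using C
  proof eventually_elim
    case (elim i)
    have "norm (m i \<bullet> X i - m i \<bullet> x) \<le> norm (m i) * norm (X i - x)"
      using Cauchy_Schwarz_ineq2[of "m i" "X i - x"] by (simp add: inner_diff_right)
    also have "\<dots> \<le> C * norm (X i - x)" using elim by (intro mult_right_mono) auto
    finally show ?case .
  qed
  have "((\<lambda>i. C * norm (X i - x)) \<longlongrightarrow> C * norm (x - x)) F" by (intro tendsto_intros X)
  then have "((\<lambda>i. C * norm (X i - x)) \<longlongrightarrow> 0) F" by simp
  with ev show "((\<lambda>i. m i \<bullet> X i - m i \<bullet> x) \<longlongrightarrow> 0) F" by (rule Lim_null_comparison)
qed

section \<open>Ordinary differential equations in a Hilbert space\<close>

text \<open>A scalar mean value inequality, tested with the vector q that is to be estimated: it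
  gives |q|^2 \<le> B |s - t| |q|. In this way weak derivatives yield norm estimates.\<close>

lemma weak_derivative_bound:
  fixes y v :: "real \<Rightarrow> 'a::real_inner"
  assumes der: "\<And>r w. r \<in> {a..b} \<Longrightarrow>
      ((\<lambda>s. y s \<bullet> w) has_real_derivative v r \<bullet> w) (at r within {a..b})"
    and st: "s \<in> {a..b}" "t \<in> {a..b}"
    and bd: "\<And>r. r \<in> closed_segment t s \<Longrightarrow> norm (v r - z) \<le> B"
  shows "norm (y s - y t - (s - t) *\<^sub>R z) \<le> B * \<bar>s - t\<bar>"
proof -
  define q where "q = y s - y t - (s - t) *\<^sub>R z"
  have sub: "closed_segment t s \<subseteq> {a..b}" using st by (auto simp: closed_segment_eq_real_ivl)
  have "norm ((y s \<bullet> q - s * (z \<bullet> q)) - (y t \<bullet> q - t * (z \<bullet> q))) \<le> (B * norm q) * norm (s - t)"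
  proof (rule field_differentiable_bound)
    show "convex (closed_segment t s)" by simp
    fix r assume r: "r \<in> closed_segment t s"
    have "((\<lambda>s. y s \<bullet> q) has_real_derivative v r \<bullet> q) (at r within closed_segment t s)"
      using der[of r q] r sub by (blast intro: has_field_derivative_subset)
    then show "((\<lambda>s. y s \<bullet> q - s * (z \<bullet> q)) has_real_derivative (v r - z) \<bullet> q)
        (at r within closed_segment t s)"
      by (auto intro!: derivative_eq_intros simp: inner_diff_left)
    show "norm ((v r - z) \<bullet> q) \<le> B * norm q"
      using bd[OF r] Cauchy_Schwarz_ineq2[of "v r - z" q]
      by (smt (verit) mult_right_mono norm_ge_zero real_norm_def)
  qed auto
  moreover have "(y s \<bullet> q - s * (z \<bullet> q)) - (y t \<bullet> q - t * (z \<bullet> q)) = (norm q)\<^sup>2"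
    unfolding power2_norm_eq_inner by (simp add: q_def inner_diff_left algebra_simps)
  ultimately have "norm q * norm q \<le> norm q * (B * \<bar>s - t\<bar>)"
    by (simp add: power2_eq_square mult_ac)
  moreover have "B \<ge> 0" using order_trans[OF norm_ge_zero bd[of t]] by simp
  ultimately have "norm q \<le> B * \<bar>s - t\<bar>"
    by (cases "norm q = 0") (auto simp: mult_le_cancel_left)
  then show ?thesis by (simp add: q_def)
qed

text \<open>Near t all velocities are within e of \<open>v t\<close>, so the mean value bound with z
  = \<open>v t\<close> is differentiability. Continuity of v at the single point t is enough, which
  fits times outside a countable set.\<close>

lemma weak_derivative_imp_has_vector_derivative:
  fixes y v :: "real \<Rightarrow> 'a::real_inner"
  assumes der: "\<And>r w. r \<in> {a..b} \<Longrightarrow>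
      ((\<lambda>s. y s \<bullet> w) has_real_derivative v r \<bullet> w) (at r within {a..b})"
    and t: "t \<in> {a..b}" and c: "continuous (at t within {a..b}) v"
  shows "(y has_vector_derivative v t) (at t within {a..b})"
  unfolding has_vector_derivative_def has_derivative_within_alt
proof (intro conjI allI impI bounded_linear_scaleR_left)
  fix e :: real assume "e > 0"
  then obtain d where d: "d > 0" "\<And>r. r \<in> {a..b} \<Longrightarrow> dist r t < d \<Longrightarrow> dist (v r) (v t) < e"
    using c unfolding continuous_within_eps_delta by blast
  have "norm (y s - y t - (s - t) *\<^sub>R v t) \<le> e * norm (s - t)" if s: "s \<in> {a..b}" "norm (s - t) < d" for s
    unfolding real_norm_def
  proof (rule weak_derivative_bound[OF der s(1) t])
    fix r assume "r \<in> closed_segment t s"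
    then have "r \<in> {a..b}" "dist r t < d"
      using s t by (auto simp: closed_segment_eq_real_ivl dist_real_def split: if_splits)
    then show "norm (v r - v t) \<le> e" using d(2)[of r] by (simp add: dist_norm)
  qed
  then show "\<exists>d>0. \<forall>s\<in>{a..b}. norm (s - t) < d \<longrightarrow> norm (y s - y t - (s - t) *\<^sub>R v t) \<le> e * norm (s - t)"
    using d(1) by blast
qed

text \<open>
  The type variable is not of class \<^class>\<open>banach\<close>, so the integral of a vector valued function is
  not available and is obtained weakly.
\<close>

lemma has_antiderivative:
  fixes f :: "real \<Rightarrow> 'a::{real_inner,complete_space}"
  assumes ab: "a \<le> b" and f: "continuous_on {a..b} f"
  shows "\<exists>F. F a = 0 \<and> (\<forall>t\<in>{a..b}. (F has_vector_derivative f t) (at t within {a..b}))"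
proof -
  have "bounded (f ` {a..b})"
    by (intro compact_imp_bounded compact_continuous_image f) simp
  then obtain B where B: "\<And>t. t \<in> {a..b} \<Longrightarrow> norm (f t) \<le> B" by (fastforce simp: bounded_iff)
  have fw: "continuous_on {a..t} (\<lambda>s. f s \<bullet> w)" if "t \<le> b" for t w
    using that by (intro continuous_intros continuous_on_subset[OF f]) auto
  \<comment> \<open>For fixed t the scalar integrals form a bounded linear functional of w; its
    Riesz vector is the value of the antiderivative.\<close>
  have "\<exists>r. \<forall>w. integral {a..t} (\<lambda>s. f s \<bullet> w) = r \<bullet> w" if t: "t \<in> {a..b}" for t
  proof (rule Riesz_representation, rule bounded_linear_intro)
    have i: "(\<lambda>s. f s \<bullet> w) integrable_on {a..t}" for w
      using t by (intro integrable_continuous_interval fw) auto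
    show "integral {a..t} (\<lambda>s. f s \<bullet> (x + y)) = integral {a..t} (\<lambda>s. f s \<bullet> x) + integral {a..t} (\<lambda>s. f s \<bullet> y)"
      for x y using integral_add[OF i i] by (simp add: inner_right_distrib)
    show "integral {a..t} (\<lambda>s. f s \<bullet> (r *\<^sub>R x)) = r *\<^sub>R integral {a..t} (\<lambda>s. f s \<bullet> x)" for r x
      by simp
    show "norm (integral {a..t} (\<lambda>s. f s \<bullet> x)) \<le> norm x * (B * (t - a))" for x
    proof -
      have "norm (f s \<bullet> x) \<le> B * norm x" if "s \<in> {a..t}" for s
        using Cauchy_Schwarz_ineq2[of "f s" x] B[of s] t that
        by (smt (verit, best) atLeastAtMost_iff mult_right_mono norm_ge_zero real_norm_def)
      then have "norm (integral {a..t} (\<lambda>s. f s \<bullet> x)) \<le> (B * norm x) * (t - a)"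
        using t by (intro integral_bound fw) auto
      then show ?thesis by (simp add: mult_ac)
    qed
  qed
  then obtain F where F: "\<And>t w. t \<in> {a..b} \<Longrightarrow> integral {a..t} (\<lambda>s. f s \<bullet> w) = F t \<bullet> w" by metis
  have "((\<lambda>s. F s \<bullet> w) has_real_derivative f t \<bullet> w) (at t within {a..b})" if t: "t \<in> {a..b}" for t w
  proof -
    have "((\<lambda>u. integral {a..u} (\<lambda>s. f s \<bullet> w)) has_vector_derivative f t \<bullet> w) (at t within {a..b})"
      using fw t by (intro integral_has_vector_derivative) auto
    then have "((\<lambda>s. F s \<bullet> w) has_vector_derivative f t \<bullet> w) (at t within {a..b})"
      by (rule has_vector_derivative_transform[OF t F[symmetric], rotated])
    then show ?thesis by (simp add: has_real_derivative_iff_has_vector_derivative)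
  qed
  then have "\<forall>t\<in>{a..b}. (F has_vector_derivative f t) (at t within {a..b})"
    using f by (auto intro!: weak_derivative_imp_has_vector_derivative simp: continuous_on_eq_continuous_within)
  moreover have "F a \<bullet> F a = 0" using F[of a "F a"] ab by simp
  ultimately show ?thesis by auto
qed

lemma has_vector_derivative_Icc_continuous_on:
  assumes "\<And>t. t \<in> {a..b} \<Longrightarrow> (y has_vector_derivative y' t) (at t within {a..b})"
  shows "continuous_on {a..b} y"
  using assms by (force simp: continuous_on_eq_continuous_within intro: has_vector_derivative_continuous)

text \<open>
  The Picard map is a contraction with factor \<open>1/2\<close> for the weight \<open>exp (2 L (t - a))\<close>.
\<close>

theorem global_Picard_Lindelof:
  fixes F :: "real \<Rightarrow> 'a::{real_inner,complete_space} \<Rightarrow> 'a"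
  assumes ab: "a \<le> b" and L: "L > 0"
    and cont: "\<And>y. continuous_on {a..b} y \<Longrightarrow> continuous_on {a..b} (\<lambda>t. F t (y t))"
    and lip: "\<And>t x y. t \<in> {a..b} \<Longrightarrow> norm (F t x - F t y) \<le> L * norm (x - y)"
  shows "\<exists>y. y a = y0 \<and> (\<forall>t\<in>{a..b}. (y has_vector_derivative F t (y t)) (at t within {a..b}))"
proof -
  have "\<exists>z. continuous_on {a..b} y \<longrightarrow> z a = y0 \<and>
      (\<forall>t\<in>{a..b}. (z has_vector_derivative F t (y t)) (at t within {a..b}))" for y
  proof (cases "continuous_on {a..b} y")
    case True
    then obtain z where "z a = 0" "\<forall>t\<in>{a..b}. (z has_vector_derivative F t (y t)) (at t within {a..b})"
      using has_antiderivative[OF ab cont] by blast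
    then show ?thesis
      by (intro exI[of _ "\<lambda>t. y0 + z t"]) (auto intro!: derivative_eq_intros)
  qed auto
  then obtain \<Phi> where \<Phi>0: "\<And>y. continuous_on {a..b} y \<Longrightarrow> \<Phi> y a = y0"
    and \<Phi>: "\<And>y t. continuous_on {a..b} y \<Longrightarrow> t \<in> {a..b} \<Longrightarrow>
      (\<Phi> y has_vector_derivative F t (y t)) (at t within {a..b})" by metis
  have \<Phi>c: "continuous_on {a..b} (\<Phi> y)" if "continuous_on {a..b} y" for y
    using \<Phi>[OF that] by (rule has_vector_derivative_Icc_continuous_on)
  \<comment> \<open>L times the weight is the derivative of half the weight; this is the origin of
    the factor 1/2.\<close>
  have contraction: "norm (\<Phi> y t - \<Phi> z t) \<le> K / 2 * exp (2 * L * (t - a))"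
    if y: "continuous_on {a..b} y" and z: "continuous_on {a..b} z" and t: "t \<in> {a..b}" and K: "K \<ge> 0"
      and bd: "\<And>t. t \<in> {a..b} \<Longrightarrow> norm (y t - z t) \<le> K * exp (2 * L * (t - a))" for y z t K
  proof (cases "t = a")
    case True
    then show ?thesis using K by (simp add: \<Phi>0[OF y] \<Phi>0[OF z])
  next
    case False
    let ?\<phi> = "\<lambda>s. K / 2 * exp (2 * L * (s - a))"
    have "norm ((\<Phi> y t - \<Phi> z t) - (\<Phi> y a - \<Phi> z a)) \<le> ?\<phi> t - ?\<phi> a"
    proof (rule differentiable_bound_general)
      show "a < t" using False t by simp
      show "continuous_on {a..t} (\<lambda>s. \<Phi> y s - \<Phi> z s)"
        using t by (intro continuous_intros continuous_on_subset[OF \<Phi>c[OF y]]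
            continuous_on_subset[OF \<Phi>c[OF z]]) auto
      show "continuous_on {a..t} ?\<phi>" by (intro continuous_intros)
      fix s assume s: "a < s" "s < t"
      have ds: "at s within {a..b} = at s" using s t by (intro at_within_Icc_at) auto
      show "((\<lambda>s. \<Phi> y s - \<Phi> z s) has_vector_derivative F s (y s) - F s (z s)) (at s)"
        using \<Phi>[OF y, of s] \<Phi>[OF z, of s] s t unfolding ds by (auto intro!: derivative_intros)
      have "(?\<phi> has_real_derivative L * (K * exp (2 * L * (s - a)))) (at s)"
        by (auto intro!: derivative_eq_intros)
      then show "(?\<phi> has_vector_derivative L * (K * exp (2 * L * (s - a)))) (at s)"
        by (simp add: has_real_derivative_iff_has_vector_derivative)
      have "norm (F s (y s) - F s (z s)) \<le> L * norm (y s - z s)" using s t by (intro lip) auto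
      also have "\<dots> \<le> L * (K * exp (2 * L * (s - a)))"
        using s t L by (intro mult_left_mono bd) auto
      finally show "norm (F s (y s) - F s (z s)) \<le> \<dots>" .
    qed
    then show ?thesis using K by (simp add: \<Phi>0[OF y] \<Phi>0[OF z])
  qed
  define Y where "Y n = (\<Phi> ^^ n) (\<lambda>_. y0)" for n
  have Y_Suc: "Y (Suc n) = \<Phi> (Y n)" for n by (simp add: Y_def)
  have Yc: "continuous_on {a..b} (Y n)" for n
    by (induction n) (auto simp: Y_Suc \<Phi>c, simp add: Y_def)
  have "bounded ((\<lambda>t. Y 1 t - Y 0 t) ` {a..b})"
    by (intro compact_imp_bounded compact_continuous_image continuous_intros Yc) simp
  then obtain K0 where K0: "\<And>t. t \<in> {a..b} \<Longrightarrow> norm (Y 1 t - Y 0 t) \<le> K0"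
    by (fastforce simp: bounded_iff)
  have K0': "K0 \<ge> 0" using order_trans[OF norm_ge_zero K0[of a]] ab by simp
  have step: "norm (Y (Suc n) t - Y n t) \<le> K0 / 2 ^ n * exp (2 * L * (t - a))" if "t \<in> {a..b}" for n t
    using that
  proof (induction n arbitrary: t)
    case 0
    have "1 \<le> exp (2 * L * (t - a))" using 0 L by simp
    then have "K0 * 1 \<le> K0 * exp (2 * L * (t - a))" using K0' by (intro mult_left_mono)
    then show ?case using K0[OF 0] by simp
  next
    case (Suc n)
    have "norm (\<Phi> (Y (Suc n)) t - \<Phi> (Y n) t) \<le> (K0 / 2 ^ n) / 2 * exp (2 * L * (t - a))"
      using Suc K0' by (intro contraction Yc) auto
    then show ?case by (simp add: Y_Suc mult_ac)
  qed
  \<comment> \<open>\<open>A\<close> absorbs the largest value of the weight on the interval.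
    Consecutive differences are then at most A / 2 / 2^n, and their tails sum to at most A /
    2^n.\<close>
  define A where "A = 2 * (K0 * exp (2 * L * (b - a)))"
  have A: "A \<ge> 0" using K0' by (simp add: A_def)
  have step': "norm (Y (Suc n) t - Y n t) \<le> A / 2 / 2 ^ n" if t: "t \<in> {a..b}" for n t
  proof -
    have "K0 / 2 ^ n * exp (2 * L * (t - a)) \<le> K0 / 2 ^ n * exp (2 * L * (b - a))"
      using t L K0' by (intro mult_left_mono) auto
    then show ?thesis using step[OF t, of n] by (simp add: A_def mult_ac)
  qed
  have tail: "norm (Y (n + k) t - Y n t) \<le> A / 2 ^ n * (1 - 1 / 2 ^ k)" if t: "t \<in> {a..b}" for n k t
  proof (induction k)
    case (Suc k)
    have "norm (Y (n + Suc k) t - Y n t) \<le> norm (Y (Suc (n + k)) t - Y (n + k) t) + norm (Y (n + k) t - Y n t)"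
      using norm_triangle_ineq[of "Y (Suc (n + k)) t - Y (n + k) t" "Y (n + k) t - Y n t"] by simp
    also have "\<dots> \<le> A / 2 / 2 ^ (n + k) + A / 2 ^ n * (1 - 1 / 2 ^ k)"
      by (intro add_mono step'[OF t] Suc)
    also have "\<dots> = A / 2 ^ n * (1 - 1 / 2 ^ Suc k)" by (simp add: power_add field_simps)
    finally show ?case .
  qed simp
  have tail': "norm (Y m t - Y n t) \<le> A / 2 ^ n" if t: "t \<in> {a..b}" and "n \<le> m" for n m t
  proof -
    have "A / 2 ^ n * (1 - 1 / 2 ^ (m - n)) \<le> A / 2 ^ n * 1" using A by (intro mult_left_mono) auto
    then show ?thesis using tail[OF t, of n "m - n"] that(2) by simp
  qed
  have lim0: "(\<lambda>n. A / 2 ^ n) \<longlonglongrightarrow> 0"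
    using tendsto_mult[OF tendsto_const LIMSEQ_inverse_realpow_zero[of 2], of A] by (simp add: divide_inverse)
  have "uniformly_Cauchy_on {a..b} Y"
    unfolding uniformly_Cauchy_on_def
  proof (intro allI impI)
    fix e :: real assume "e > 0"
    then have "\<forall>\<^sub>F n in sequentially. A / 2 ^ n < e / 2" by (intro order_tendstoD[OF lim0]) simp
    then obtain N where N: "A / 2 ^ N < e / 2" by (auto simp: eventually_sequentially)
    have "dist (Y m t) (Y n t) < e" if "t \<in> {a..b}" "m \<ge> N" "n \<ge> N" for t m n
    proof (rule dist_triangle_half_l)
      show "dist (Y m t) (Y N t) < e / 2" "dist (Y n t) (Y N t) < e / 2"
        using tail'[OF that(1,2)] tail'[OF that(1,3)] N by (simp_all only: dist_norm)
    qed
    then show "\<exists>N. \<forall>t\<in>{a..b}. \<forall>m\<ge>N. \<forall>n\<ge>N. dist (Y m t) (Y n t) < e" by blast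
  qed
  then obtain y where y: "uniform_limit {a..b} Y y sequentially"
    using Cauchy_uniformly_convergent uniformly_convergent_on_def by blast
  have yc: "continuous_on {a..b} y"
    by (rule uniform_limit_theorem[OF _ y]) (use Yc in auto)
  have ylim: "(\<lambda>n. Y n t) \<longlonglongrightarrow> y t" if "t \<in> {a..b}" for t
    using tendsto_uniform_limitI[OF y that] .
  have yY: "norm (Y n t - y t) \<le> A / 2 ^ n" if t: "t \<in> {a..b}" for n t
  proof -
    have "(\<lambda>m. norm (Y n t - Y m t)) \<longlonglongrightarrow> norm (Y n t - y t)" by (intro tendsto_intros ylim t)
    then show ?thesis
      by (rule LIMSEQ_le_const2) (metis tail'[OF t] norm_minus_commute)
  qed
  have fix_y: "\<Phi> y t = y t" if t: "t \<in> {a..b}" for t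
  proof -
    have "norm (Y (Suc n) t - \<Phi> y t) \<le> A / 2 ^ n / 2 * exp (2 * L * (t - a))" for n
      unfolding Y_Suc
    proof (rule contraction[OF Yc yc t])
      fix s assume s: "s \<in> {a..b}"
      have "1 \<le> exp (2 * L * (s - a))" using s L by simp
      then have "A / 2 ^ n * 1 \<le> A / 2 ^ n * exp (2 * L * (s - a))"
        using A by (intro mult_left_mono) auto
      then show "norm (Y n s - y s) \<le> A / 2 ^ n * exp (2 * L * (s - a))" using yY[OF s, of n] by simp
    qed (use A in simp)
    then have ev: "\<forall>\<^sub>F n in sequentially. norm (Y (Suc n) t - \<Phi> y t) \<le>
        A / 2 ^ n / 2 * exp (2 * L * (t - a))" by (intro always_eventually allI)
    have "(\<lambda>n. A / 2 ^ n / 2 * exp (2 * L * (t - a))) \<longlonglongrightarrow> 0 / 2 * exp (2 * L * (t - a))"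
      by (intro tendsto_intros lim0) simp
    then have "(\<lambda>n. A / 2 ^ n / 2 * exp (2 * L * (t - a))) \<longlonglongrightarrow> 0" by simp
    with ev have "(\<lambda>n. Y (Suc n) t - \<Phi> y t) \<longlonglongrightarrow> 0" by (rule Lim_null_comparison)
    then have "(\<lambda>n. Y (Suc n) t) \<longlonglongrightarrow> \<Phi> y t" by (rule LIM_zero_cancel)
    then show ?thesis using LIMSEQ_Suc[OF ylim[OF t]] LIMSEQ_unique by blast
  qed
  have "(y has_vector_derivative F t (y t)) (at t within {a..b})" if t: "t \<in> {a..b}" for t
    using has_vector_derivative_transform[OF t fix_y[symmetric] \<Phi>[OF yc t]] by blast
  moreover have "y a = y0" using fix_y[of a] \<Phi>0[OF yc] ab by simp
  ultimately show ?thesis by blast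
qed

section \<open>Differential inequalities\<close>

text \<open>
  A violating \<open>f\<close>, tilted slightly, crosses every intermediate level for the last time at a point
  where its upper right derivative is nonnegative; distinct levels give uncountably many such points.
\<close>

lemma Dini_nonincreasing:
  fixes f :: "real \<Rightarrow> real"
  assumes ab: "a \<le> b" and cont: "continuous_on {a..b} f" and E: "countable E"
    and D: "\<And>t \<epsilon>. t \<in> {a..<b} - E \<Longrightarrow> \<epsilon> > 0 \<Longrightarrow> \<forall>\<^sub>F s in at_right t. f s \<le> f t + \<epsilon> * (s - t)"
  shows "f b \<le> f a"
proof (rule ccontr)
  assume "\<not> ?thesis"
  then have gt: "f a < f b" and ab': "a < b" using ab by (auto simp: less_le)
  \<comment> \<open>Half the mean slope of f: after tilting by it, the value at b still exceeds the
    value at a.\<close>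
  define \<epsilon> where "\<epsilon> = (f b - f a) / (2 * (b - a))"
  have \<epsilon>: "\<epsilon> > 0" using gt ab' by (simp add: \<epsilon>_def)
  define g where "g t = f t - \<epsilon> * (t - a)" for t
  have gc: "continuous_on {a..b} g" unfolding g_def by (intro continuous_intros cont)
  have "\<epsilon> * (b - a) = (f b - f a) / 2" using ab' unfolding \<epsilon>_def by (simp add: field_split_simps)
  then have gab: "g a < g b" using gt by (simp add: g_def)
  have "\<exists>t\<in>E. g t = c" if c: "c \<in> {g a<..<g b}" for c
  proof -
    define X where "X = {t\<in>{a..b}. g t \<le> c}"
    have aX: "a \<in> X" using c ab by (simp add: X_def)
    have "closed X" unfolding X_def
      by (rule continuous_on_closed_Collect_le[OF gc continuous_on_const]) simp
    moreover have Xb: "bdd_above X" unfolding X_def by (intro bdd_aboveI[of _ b]) auto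
    ultimately have SX: "Sup X \<in> X" using aX by (intro closed_contains_Sup) auto
    define \<tau> where "\<tau> = Sup X"
    have \<tau>: "a \<le> \<tau>" "\<tau> \<le> b" "g \<tau> \<le> c" using SX by (auto simp: X_def \<tau>_def)
    have after: "g t > c" if "\<tau> < t" "t \<le> b" for t
    proof (rule ccontr)
      assume "\<not> g t > c"
      then have "t \<in> X" using that \<tau> by (simp add: X_def)
      then show False using cSup_upper[OF _ Xb, of t] that by (simp add: \<tau>_def)
    qed
    have \<tau>b: "\<tau> < b" using \<tau> c by (cases "\<tau> = b") auto
    have "\<exists>t\<ge>\<tau>. t \<le> b \<and> g t = c"
      using \<tau> c \<tau>b by (intro IVT' continuous_on_subset[OF gc]) auto
    then have g\<tau>: "g \<tau> = c" using after by (metis less_irrefl order_le_less)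
    have "\<tau> \<in> E"
    proof (rule ccontr)
      assume "\<tau> \<notin> E"
      then have "\<forall>\<^sub>F s in at_right \<tau>. f s \<le> f \<tau> + \<epsilon> * (s - \<tau>)"
        using \<tau> \<tau>b \<epsilon> by (intro D) auto
      moreover have "\<forall>\<^sub>F s in at_right \<tau>. s \<in> {\<tau><..<b}" using \<tau>b by (rule eventually_at_right_real)
      ultimately have "\<forall>\<^sub>F s in at_right \<tau>. False"
      proof eventually_elim
        case (elim s)
        then have "g s \<le> g \<tau>" by (simp add: g_def algebra_simps)
        then show ?case using after[of s] elim g\<tau> by simp
      qed
      then show False by simp
    qed
    then show ?thesis using g\<tau> by blast
  qed
  then have "{g a<..<g b} \<subseteq> g ` E" by blast
  then have "countable {g a<..<g b}" using E by (meson countable_image countable_subset)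
  then show False using uncountable_open_interval gab by blast
qed

text \<open>Adding K / C absorbs the constant term, and the factor exp (- C t) turns the inequality
  into a nonpositive upper right derivative.\<close>

lemma Dini_Gronwall:
  fixes f :: "real \<Rightarrow> real"
  assumes ab: "a \<le> b" and cont: "continuous_on {a..b} f" and E: "countable E" and C: "C > 0"
    and D: "\<And>t \<epsilon>. t \<in> {a..<b} - E \<Longrightarrow> \<epsilon> > 0 \<Longrightarrow>
      \<forall>\<^sub>F s in at_right t. f s \<le> f t + (s - t) * (C * f t + K + \<epsilon>)"
  shows "f b + K / C \<le> (f a + K / C) * exp (C * (b - a))"
proof -
  define h where "h t = exp (- C * t) * (f t + K / C)" for t
  have "h b \<le> h a"
  proof (rule Dini_nonincreasing[OF ab _ E])
    show "continuous_on {a..b} h" unfolding h_def by (intro continuous_intros cont)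
    fix t \<epsilon> :: real assume t: "t \<in> {a..<b} - E" and \<epsilon>: "\<epsilon> > 0"
    \<comment> \<open>Chosen so that the weight exp (- C t) turns it into \<epsilon> / 2, strictly
      below the permitted slope \<epsilon>.\<close>
    define \<epsilon>' where "\<epsilon>' = \<epsilon> * exp (C * t) / 2"
    define F where "F = f t + K / C"
    have \<epsilon>': "\<epsilon>' > 0" "exp (- C * t) * \<epsilon>' = \<epsilon> / 2" using \<epsilon> by (auto simp: \<epsilon>'_def exp_minus)
    \<comment> \<open>The majorant of \<open>h\<close> that the hypothesis provides, equal to
      \<open>h\<close> at t. In its slope at t the two terms C F cancel and \<epsilon> / 2
      remains.\<close>
    define k where "k s = exp (- C * s) * (F + (s - t) * (C * F + \<epsilon>'))" for s
    have "(k has_real_derivative exp (- C * t) * \<epsilon>') (at t)"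
      unfolding k_def by (auto intro!: derivative_eq_intros simp: algebra_simps)
    then have "(k has_real_derivative \<epsilon> / 2) (at_right t)"
      unfolding \<epsilon>'(2) by (rule has_field_derivative_at_within)
    then have "((\<lambda>s. (k s - k t) / (s - t)) \<longlongrightarrow> \<epsilon> / 2) (at_right t)"
      by (simp add: has_field_derivative_iff)
    then have "\<forall>\<^sub>F s in at_right t. (k s - k t) / (s - t) < \<epsilon>"
      by (rule order_tendstoD) (use \<epsilon> in simp)
    with D[OF t \<epsilon>'(1)] eventually_at_right_less[of t]
    show "\<forall>\<^sub>F s in at_right t. h s \<le> h t + \<epsilon> * (s - t)"
    proof eventually_elim
      case (elim s)
      have CF: "C * F = C * f t + K" using C by (simp add: F_def field_simps)
      have "f s + K / C \<le> F + (s - t) * (C * F + \<epsilon>')" using elim(1) unfolding CF by (simp add: F_def)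
      then have "h s \<le> k s" unfolding h_def k_def by (intro mult_left_mono) auto
      moreover have "k s - k t \<le> \<epsilon> * (s - t)" using elim by (simp add: divide_less_eq)
      moreover have "k t = h t" by (simp add: k_def h_def F_def)
      ultimately show ?case by linarith
    qed
  qed
  then have "exp (C * b) * h b \<le> exp (C * b) * h a" by simp
  moreover have "exp (C * b) * h b = f b + K / C"
    by (simp add: h_def exp_minus field_simps)
  moreover have "exp (C * b) * h a = (f a + K / C) * exp (C * (b - a))"
    by (simp add: h_def exp_minus exp_diff right_diff_distrib field_simps)
  ultimately show ?thesis by simp
qed

section \<open>One-sided weak derivatives and quadratic forms\<close>

text \<open>The second clause, a one-sided Lipschitz bound, makes the quadratic remainder of a
  quadratic form negligible; weak differentiability alone would not. Approximate solutions satisfy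
  both clauses by strong differentiability, limit solutions by their Lipschitz continuity.\<close>

definition right_weak_derivative :: "(real \<Rightarrow> 'a::real_inner) \<Rightarrow> 'a \<Rightarrow> real \<Rightarrow> bool"
  where "right_weak_derivative y v t \<longleftrightarrow>
    (\<forall>w \<epsilon>. \<epsilon> > 0 \<longrightarrow> (\<forall>\<^sub>F s in at_right t. \<bar>(y s - y t) \<bullet> w - (s - t) * (v \<bullet> w)\<bar> \<le> \<epsilon> * (s - t))) \<and>
    (\<exists>B. \<forall>\<^sub>F s in at_right t. norm (y s - y t) \<le> B * (s - t))"

lemma right_weak_derivative_diff:
  fixes y y' :: "real \<Rightarrow> 'a::real_inner"
  assumes "right_weak_derivative y v t" "right_weak_derivative y' v' t"
  shows "right_weak_derivative (\<lambda>s. y s - y' s) (v - v') t"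
  unfolding right_weak_derivative_def
proof (intro conjI allI impI)
  fix w :: 'a and \<epsilon> :: real assume "\<epsilon> > 0"
  then have "\<epsilon> / 2 > 0" by simp
  then have "\<forall>\<^sub>F s in at_right t. \<bar>(y s - y t) \<bullet> w - (s - t) * (v \<bullet> w)\<bar> \<le> \<epsilon> / 2 * (s - t)"
    "\<forall>\<^sub>F s in at_right t. \<bar>(y' s - y' t) \<bullet> w - (s - t) * (v' \<bullet> w)\<bar> \<le> \<epsilon> / 2 * (s - t)"
    using assms unfolding right_weak_derivative_def by blast+
  then show "\<forall>\<^sub>F s in at_right t. \<bar>(y s - y' s - (y t - y' t)) \<bullet> w - (s - t) * ((v - v') \<bullet> w)\<bar> \<le> \<epsilon> * (s - t)"
  proof eventually_elim
    case (elim s)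
    have "(y s - y' s - (y t - y' t)) \<bullet> w - (s - t) * ((v - v') \<bullet> w) =
      ((y s - y t) \<bullet> w - (s - t) * (v \<bullet> w)) - ((y' s - y' t) \<bullet> w - (s - t) * (v' \<bullet> w))"
      by (simp add: inner_diff_left algebra_simps)
    moreover have "\<epsilon> * (s - t) = \<epsilon> / 2 * (s - t) + \<epsilon> / 2 * (s - t)" by simp
    ultimately show ?case using elim by linarith
  qed
next
  obtain B B' where "\<forall>\<^sub>F s in at_right t. norm (y s - y t) \<le> B * (s - t)"
    "\<forall>\<^sub>F s in at_right t. norm (y' s - y' t) \<le> B' * (s - t)"
    using assms unfolding right_weak_derivative_def by blast
  then have "\<forall>\<^sub>F s in at_right t. norm (y s - y' s - (y t - y' t)) \<le> (B + B') * (s - t)"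
  proof eventually_elim
    case (elim s)
    have "norm (y s - y' s - (y t - y' t)) \<le> norm (y s - y t) + norm (y' s - y' t)"
      using norm_triangle_ineq4[of "y s - y t" "y' s - y' t"] by (simp add: algebra_simps)
    then show ?case using elim by (simp add: distrib_right)
  qed
  then show "\<exists>B. \<forall>\<^sub>F s in at_right t. norm (y s - y' s - (y t - y' t)) \<le> B * (s - t)" by blast
qed

lemma has_vector_derivative_right_bound:
  assumes der: "(y has_vector_derivative v) (at t within S)" and S: "{t..<b} \<subseteq> S" "t < b" and e: "e > 0"
  shows "\<forall>\<^sub>F s in at_right t. norm (y s - y t - (s - t) *\<^sub>R v) \<le> e * (s - t)"
proof -
  obtain d where d: "d > 0" "\<And>s. s \<in> S \<Longrightarrow> norm (s - t) < d \<Longrightarrow>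
      norm (y s - y t - (s - t) *\<^sub>R v) \<le> e * norm (s - t)"
    using der e unfolding has_vector_derivative_def has_derivative_within_alt by blast
  have "\<forall>\<^sub>F s in at_right t. s \<in> {t<..<min b (t + d)}"
    using d(1) S(2) by (intro eventually_at_right_real) simp
  then show ?thesis
  proof eventually_elim
    case (elim s)
    then show ?case using d(2)[of s] S(1) by (auto simp: subset_iff)
  qed
qed

lemma norm_le_of_right_bound:
  fixes y :: "real \<Rightarrow> 'a::real_normed_vector"
  assumes "norm (y s - y t - (s - t) *\<^sub>R v) \<le> e * (s - t)" "t \<le> s"
  shows "norm (y s - y t) \<le> (norm v + e) * (s - t)"
proof -
  have "norm (y s - y t) \<le> norm (y s - y t - (s - t) *\<^sub>R v) + norm ((s - t) *\<^sub>R v)"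
    using norm_triangle_ineq[of "y s - y t - (s - t) *\<^sub>R v" "(s - t) *\<^sub>R v"] by simp
  also have "\<dots> \<le> e * (s - t) + (s - t) * norm v" using assms by (intro add_mono) auto
  finally show ?thesis by (simp add: algebra_simps)
qed

lemma has_vector_derivative_right_weak:
  fixes y :: "real \<Rightarrow> 'a::real_inner"
  assumes der: "(y has_vector_derivative v) (at t within S)" and S: "{t..<b} \<subseteq> S" "t < b"
  shows "right_weak_derivative y v t"
  unfolding right_weak_derivative_def
proof (intro conjI allI impI)
  fix w :: 'a and \<epsilon> :: real assume \<epsilon>: "\<epsilon> > 0"
  define e where "e = \<epsilon> / (norm w + 1)"
  have nw: "norm w + 1 > 0" by (simp add: add_nonneg_pos)
  have "e > 0" using \<epsilon> nw by (simp add: e_def)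
  from has_vector_derivative_right_bound[OF der S this] eventually_at_right_less[of t]
  show "\<forall>\<^sub>F s in at_right t. \<bar>(y s - y t) \<bullet> w - (s - t) * (v \<bullet> w)\<bar> \<le> \<epsilon> * (s - t)"
  proof eventually_elim
    case (elim s)
    have "\<bar>(y s - y t) \<bullet> w - (s - t) * (v \<bullet> w)\<bar> = \<bar>(y s - y t - (s - t) *\<^sub>R v) \<bullet> w\<bar>"
      by (simp add: inner_diff_left)
    also have "\<dots> \<le> norm (y s - y t - (s - t) *\<^sub>R v) * norm w" by (rule Cauchy_Schwarz_ineq2)
    also have "\<dots> \<le> (e * (s - t)) * (norm w + 1)"
      using elim \<open>e > 0\<close> by (intro mult_mono) auto
    also have "\<dots> = \<epsilon> * (s - t)" using nw by (simp add: e_def)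
    finally show ?case .
  qed
next
  from has_vector_derivative_right_bound[OF der S zero_less_one] eventually_at_right_less[of t]
  have "\<forall>\<^sub>F s in at_right t. norm (y s - y t) \<le> (norm v + 1) * (s - t)"
    by eventually_elim (simp add: norm_le_of_right_bound[of y _ t v])
  then show "\<exists>B. \<forall>\<^sub>F s in at_right t. norm (y s - y t) \<le> B * (s - t)" by blast
qed

text \<open>
  Neither \<open>P\<close> nor \<open>z\<close> need be differentiable, whence the one-sided bounds instead of derivatives.
\<close>

lemma quadratic_form_Dini:
  fixes P :: "real \<Rightarrow> 'a::real_inner \<Rightarrow>\<^sub>L 'a"
  assumes sym: "\<And>x y. P t x \<bullet> y = x \<bullet> P t y"
    and lip: "\<forall>\<^sub>F s in at_right t. norm (P s - P t) \<le> \<Lambda> * (s - t)"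
    and zb: "\<forall>\<^sub>F s in at_right t. norm (z s - z t) \<le> B * (s - t)"
    and up: "\<And>\<epsilon>. \<epsilon> > 0 \<Longrightarrow> \<forall>\<^sub>F s in at_right t. (z s - z t) \<bullet> P t (z t) \<le> (s - t) * (\<kappa> + \<epsilon>)"
    and \<epsilon>: "\<epsilon> > 0"
  shows "\<forall>\<^sub>F s in at_right t. P s (z s) \<bullet> z s \<le>
    P t (z t) \<bullet> z t + (s - t) * (\<Lambda> * (norm (z t))\<^sup>2 + 2 * \<kappa> + \<epsilon>)"
proof -
  have "((\<lambda>s. B * (s - t)) \<longlongrightarrow> B * (t - t)) (at_right t)" by (intro tendsto_intros)
  then have "((\<lambda>s. B * (s - t)) \<longlongrightarrow> 0) (at_right t)" by simp
  with zb have "((\<lambda>s. z s - z t) \<longlongrightarrow> 0) (at_right t)" by (rule Lim_null_comparison)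
  then have zt: "(z \<longlongrightarrow> z t) (at_right t)" by (rule LIM_zero_cancel)
  have "((\<lambda>s. \<Lambda> * (norm (z s))\<^sup>2 + norm (P t) * B\<^sup>2 * (s - t)) \<longlongrightarrow>
      \<Lambda> * (norm (z t))\<^sup>2 + norm (P t) * B\<^sup>2 * (t - t)) (at_right t)"
    by (intro tendsto_intros zt)
  then have ev: "\<forall>\<^sub>F s in at_right t. \<Lambda> * (norm (z s))\<^sup>2 + norm (P t) * B\<^sup>2 * (s - t) <
      \<Lambda> * (norm (z t))\<^sup>2 + \<epsilon> / 2"
    by (rule order_tendstoD) (use \<epsilon> in simp)
  have "\<epsilon> / 4 > 0" using \<epsilon> by simp
  from up[OF this] lip zb ev eventually_at_right_less[of t] show ?thesis
  proof eventually_elim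
    case (elim s)
    define h where "h = s - t"
    have h: "h > 0" using elim by (simp add: h_def)
    \<comment> \<open>Symmetry splits the increment into the change of the operator, the first order
      term and a quadratic remainder. The last is of order (s - t)^2 by the Lipschitz bound on
      z.\<close>
    have "P s (z s) \<bullet> z s = P t (z t) \<bullet> z t + (P s - P t) (z s) \<bullet> z s + 2 * ((z s - z t) \<bullet> P t (z t))
        + P t (z s - z t) \<bullet> (z s - z t)"
      using sym[of "z s" "z t"]
      by (simp add: blinfun.diff_left blinfun.diff_right inner_diff_left inner_diff_right inner_commute)
    moreover have "(P s - P t) (z s) \<bullet> z s \<le> h * (\<Lambda> * (norm (z s))\<^sup>2)"
    proof -
      have "(P s - P t) (z s) \<bullet> z s \<le> norm ((P s - P t) (z s)) * norm (z s)" by (rule norm_cauchy_schwarz)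
      also have "\<dots> \<le> (norm (P s - P t) * norm (z s)) * norm (z s)"
        by (intro mult_right_mono norm_blinfun) auto
      also have "\<dots> \<le> (\<Lambda> * h * norm (z s)) * norm (z s)"
        using elim(2) by (intro mult_right_mono) (auto simp: h_def)
      finally show ?thesis by (simp add: power2_eq_square mult_ac)
    qed
    moreover have "P t (z s - z t) \<bullet> (z s - z t) \<le> h * (norm (P t) * B\<^sup>2 * h)"
    proof -
      have "P t (z s - z t) \<bullet> (z s - z t) \<le> norm (P t (z s - z t)) * norm (z s - z t)"
        by (rule norm_cauchy_schwarz)
      also have "\<dots> \<le> norm (P t) * (norm (z s - z t) * norm (z s - z t))"
        using norm_blinfun[of "P t" "z s - z t"] by (simp add: mult_right_mono flip: mult.assoc)
      also have "\<dots> \<le> norm (P t) * ((B * h) * (B * h))"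
        using elim(3) order_trans[OF norm_ge_zero elim(3)]
        by (intro mult_left_mono mult_mono) (auto simp: h_def)
      finally show ?thesis by (simp add: power2_eq_square mult_ac)
    qed
    moreover have "2 * ((z s - z t) \<bullet> P t (z t)) \<le> h * (2 * \<kappa> + \<epsilon> / 2)"
      using elim(1) by (simp add: h_def algebra_simps)
    moreover have "h * (\<Lambda> * (norm (z s))\<^sup>2) + h * (norm (P t) * B\<^sup>2 * h) \<le>
        h * (\<Lambda> * (norm (z t))\<^sup>2 + \<epsilon> / 2)"
      using elim(4) h unfolding h_def[symmetric] distrib_left[symmetric]
      by (intro mult_left_mono) auto
    moreover have "h * (\<Lambda> * (norm (z t))\<^sup>2 + 2 * \<kappa> + \<epsilon>) =
        h * (\<Lambda> * (norm (z t))\<^sup>2 + \<epsilon> / 2) + h * (2 * \<kappa> + \<epsilon> / 2)" by (simp add: algebra_simps)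
    ultimately show ?case unfolding h_def[symmetric] by linarith
  qed
qed

lemma quadratic_form_Dini_weak:
  fixes P :: "real \<Rightarrow> 'a::real_inner \<Rightarrow>\<^sub>L 'a"
  assumes sym: "\<And>x y. P t x \<bullet> y = x \<bullet> P t y"
    and lip: "\<forall>\<^sub>F s in at_right t. norm (P s - P t) \<le> \<Lambda> * (s - t)"
    and z: "right_weak_derivative z v t" and \<epsilon>: "\<epsilon> > 0"
  shows "\<forall>\<^sub>F s in at_right t. P s (z s) \<bullet> z s \<le>
    P t (z t) \<bullet> z t + (s - t) * (\<Lambda> * (norm (z t))\<^sup>2 + 2 * (P t v \<bullet> z t) + \<epsilon>)"
proof -
  obtain B where B: "\<forall>\<^sub>F s in at_right t. norm (z s - z t) \<le> B * (s - t)"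
    using z unfolding right_weak_derivative_def by blast
  show ?thesis
  proof (rule quadratic_form_Dini[OF sym lip B _ \<epsilon>])
    fix e :: real assume e: "e > 0"
    have "\<forall>\<^sub>F s in at_right t. \<bar>(z s - z t) \<bullet> P t (z t) - (s - t) * (v \<bullet> P t (z t))\<bar> \<le> e * (s - t)"
      using z e unfolding right_weak_derivative_def by blast
    then show "\<forall>\<^sub>F s in at_right t. (z s - z t) \<bullet> P t (z t) \<le> (s - t) * (P t v \<bullet> z t + e)"
      by eventually_elim (simp add: sym algebra_simps abs_le_iff)
  qed
qed

section \<open>Evolution equations with a time dependent inner product\<close>

text \<open>The left end is arbitrary so that the equation can be restarted, and a single \<Lambda>
  serves all bounds and Lipschitz constants. Both P and its inverse S are carried: P measures
  distances between solutions, S measures the velocity through Q y - M y.\<close>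

locale evolution =
  fixes M :: "('a::{real_inner,complete_space} \<times> 'a) set"
    and P S Q :: "real \<Rightarrow> 'a \<Rightarrow>\<^sub>L 'a" and a b c \<Lambda> :: real
  assumes M: "maximal_monotone M" and sv: "single_valued M"
    and ab: "a < b" and c: "c > 0" and \<Lambda>: "\<Lambda> > 0"
    and P_bound: "\<And>t. t \<in> {a..b} \<Longrightarrow> norm (P t) \<le> \<Lambda>"
    and S_bound: "\<And>t. t \<in> {a..b} \<Longrightarrow> norm (S t) \<le> \<Lambda>"
    and Q_bound: "\<And>t. t \<in> {a..b} \<Longrightarrow> norm (Q t) \<le> \<Lambda>"
    and P_lip: "\<And>s t. s \<in> {a..b} \<Longrightarrow> t \<in> {a..b} \<Longrightarrow> norm (P s - P t) \<le> \<Lambda> * \<bar>s - t\<bar>"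
    and S_lip: "\<And>s t. s \<in> {a..b} \<Longrightarrow> t \<in> {a..b} \<Longrightarrow> norm (S s - S t) \<le> \<Lambda> * \<bar>s - t\<bar>"
    and Q_lip: "\<And>s t. s \<in> {a..b} \<Longrightarrow> t \<in> {a..b} \<Longrightarrow> norm (Q s - Q t) \<le> \<Lambda> * \<bar>s - t\<bar>"
    and P_sym: "\<And>t x y. t \<in> {a..b} \<Longrightarrow> P t x \<bullet> y = x \<bullet> P t y"
    and PS: "\<And>t x. t \<in> {a..b} \<Longrightarrow> P t (S t x) = x"
    and SP: "\<And>t x. t \<in> {a..b} \<Longrightarrow> S t (P t x) = x"
    and P_coercive: "\<And>t x. t \<in> {a..b} \<Longrightarrow> P t x \<bullet> x \<ge> c * (norm x)\<^sup>2"
begin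

lemma subinterval: "a \<le> s \<Longrightarrow> s < b \<Longrightarrow> evolution M P S Q s b c \<Lambda>"
  using M sv c \<Lambda> P_bound S_bound Q_bound P_lip S_lip Q_lip P_sym PS SP P_coercive
  by unfold_locales auto

lemma S_sym:
  assumes "t \<in> {a..b}"
  shows "S t x \<bullet> y = x \<bullet> S t y"
proof -
  have "S t x \<bullet> y = S t x \<bullet> P t (S t y)" by (simp add: PS[OF assms])
  also have "\<dots> = x \<bullet> S t y" using P_sym[OF assms, of "S t x" "S t y"] by (simp add: PS[OF assms])
  finally show ?thesis .
qed

lemma lipschitz_at_right:
  assumes "\<And>s t. s \<in> {a..b} \<Longrightarrow> t \<in> {a..b} \<Longrightarrow> norm (T s - T t) \<le> \<Lambda> * \<bar>s - t\<bar>" "t \<in> {a..<b}"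
  shows "\<forall>\<^sub>F s in at_right t. norm (T s - T t) \<le> \<Lambda> * (s - t)"
proof -
  have "\<forall>\<^sub>F s in at_right t. s \<in> {t<..<b}" using assms by (intro eventually_at_right_real) auto
  then show ?thesis
  proof eventually_elim
    case (elim s)
    then show ?case using assms(1)[of s t] assms(2) by auto
  qed
qed

lemma lipschitz_continuous_on:
  fixes T :: "real \<Rightarrow> 'b::real_normed_vector"
  assumes "\<And>s t. s \<in> {a..b} \<Longrightarrow> t \<in> {a..b} \<Longrightarrow> norm (T s - T t) \<le> \<Lambda> * \<bar>s - t\<bar>"
  shows "continuous_on {a..b} T"
proof -
  have "\<Lambda>-lipschitz_on {a..b} T"
    using assms \<Lambda> by (intro lipschitz_onI) (auto simp: dist_norm dist_real_def)
  then show ?thesis by (rule lipschitz_on_continuous_on)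
qed

lemma P_lip_right: "t \<in> {a..<b} \<Longrightarrow> \<forall>\<^sub>F s in at_right t. norm (P s - P t) \<le> \<Lambda> * (s - t)"
  using P_lip by (rule lipschitz_at_right)

lemma S_lip_right: "t \<in> {a..<b} \<Longrightarrow> \<forall>\<^sub>F s in at_right t. norm (S s - S t) \<le> \<Lambda> * (s - t)"
  using S_lip by (rule lipschitz_at_right)

lemma P_cont: "continuous_on {a..b} P" by (rule lipschitz_continuous_on) (rule P_lip)
lemma S_cont: "continuous_on {a..b} S" by (rule lipschitz_continuous_on) (rule S_lip)
lemma Q_cont: "continuous_on {a..b} Q" by (rule lipschitz_continuous_on) (rule Q_lip)

lemma norm_P_le: "t \<in> {a..b} \<Longrightarrow> norm (P t x) \<le> \<Lambda> * norm x"
  using norm_blinfun[of "P t" x] P_bound[of t] by (meson mult_right_mono norm_ge_zero order_trans)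

lemma norm_S_le: "t \<in> {a..b} \<Longrightarrow> norm (S t x) \<le> \<Lambda> * norm x"
  using norm_blinfun[of "S t" x] S_bound[of t] by (meson mult_right_mono norm_ge_zero order_trans)

lemma norm_Q_le: "t \<in> {a..b} \<Longrightarrow> norm (Q t x) \<le> \<Lambda> * norm x"
  using norm_blinfun[of "Q t" x] Q_bound[of t] by (meson mult_right_mono norm_ge_zero order_trans)

lemma S_nonneg: "t \<in> {a..b} \<Longrightarrow> S t x \<bullet> x \<ge> 0"
  using P_coercive[of t "S t x"] c
  by (smt (verit) PS inner_commute mult_nonneg_nonneg zero_le_power2)

text \<open>Coercivity of P at S x bounds the form below by c |S x|^2, and |x| \<le> \<Lambda> |S x|
  because P S = 1; hence the constant.\<close>

lemma S_coercive:
  assumes t: "t \<in> {a..b}"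
  shows "S t x \<bullet> x \<ge> c / \<Lambda>\<^sup>2 * (norm x)\<^sup>2"
proof -
  have "norm x \<le> \<Lambda> * norm (S t x)" using norm_P_le[OF t, of "S t x"] by (simp add: PS[OF t])
  then have "(norm x)\<^sup>2 \<le> \<Lambda>\<^sup>2 * (norm (S t x))\<^sup>2"
    by (metis norm_ge_zero power_mono power_mult_distrib)
  then have "c / \<Lambda>\<^sup>2 * (norm x)\<^sup>2 \<le> c * (norm (S t x))\<^sup>2"
    using c \<Lambda> by (simp add: field_simps mult_left_mono)
  also have "\<dots> \<le> S t x \<bullet> x" using P_coercive[OF t, of "S t x"] by (simp add: PS[OF t] inner_commute)
  finally show ?thesis .
qed

lemma Q_monotone_bound: "t \<in> {a..b} \<Longrightarrow> Q t x \<bullet> x \<le> \<Lambda> * (norm x)\<^sup>2"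
  using norm_cauchy_schwarz[of "Q t x" x] norm_Q_le[of t x]
  by (smt (verit) mult.assoc mult_right_mono norm_ge_zero power2_eq_square)

text \<open>P cancels S in the velocities, which leaves Q z and the difference of the graph values,
  each paired with z. The defect \<open>K\<close> is zero for genuine elements of M and small for
  Yosida values, which sit over resolvents. In 3 \<Lambda> / c one \<Lambda> comes from the
  variation of P and two from Q; c converts |z|^2 into the form.\<close>

lemma energy_Dini_difference:
  assumes t: "t \<in> {a..<b}" and y: "right_weak_derivative y (S t (Q t (y t) - m)) t"
    and y': "right_weak_derivative y' (S t (Q t (y' t) - m')) t"
    and mono: "(m - m') \<bullet> (y t - y' t) \<ge> - K" and \<epsilon>: "\<epsilon> > 0"
  defines "\<phi> \<equiv> \<lambda>s. P s (y s - y' s) \<bullet> (y s - y' s)"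
  shows "\<forall>\<^sub>F s in at_right t. \<phi> s \<le> \<phi> t + (s - t) * (3 * \<Lambda> / c * \<phi> t + 2 * K + \<epsilon>)"
proof -
  define z where "z s = y s - y' s" for s
  have t': "t \<in> {a..b}" using t by simp
  have z: "right_weak_derivative z (S t (Q t (y t) - m) - S t (Q t (y' t) - m')) t"
    unfolding z_def by (rule right_weak_derivative_diff[OF y y'])
  have "P t (S t (Q t (y t) - m) - S t (Q t (y' t) - m')) \<bullet> z t =
      Q t (z t) \<bullet> z t - (m - m') \<bullet> z t"
    by (simp add: z_def blinfun.diff_right PS[OF t'] inner_diff_left)
  also have "\<dots> \<le> \<Lambda> * (norm (z t))\<^sup>2 + K"
    using Q_monotone_bound[OF t', of "z t"] mono by (simp add: z_def)
  finally have k: "P t (S t (Q t (y t) - m) - S t (Q t (y' t) - m')) \<bullet> z t \<le> \<Lambda> * (norm (z t))\<^sup>2 + K" .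
  have "\<Lambda> * (c * (norm (z t))\<^sup>2) \<le> \<Lambda> * \<phi> t"
    using P_coercive[OF t', of "z t"] \<Lambda> by (simp add: \<phi>_def z_def)
  then have "3 * \<Lambda> * (norm (z t))\<^sup>2 \<le> 3 * \<Lambda> / c * \<phi> t" using c by (simp add: field_simps)
  then have bd: "\<Lambda> * (norm (z t))\<^sup>2 + 2 * (P t (S t (Q t (y t) - m) - S t (Q t (y' t) - m')) \<bullet> z t) + \<epsilon> \<le>
      3 * \<Lambda> / c * \<phi> t + 2 * K + \<epsilon>" using k by linarith
  from quadratic_form_Dini_weak[OF P_sym[OF t'] P_lip_right[OF t] z \<epsilon>]
    eventually_at_right_less[of t]
  show ?thesis
  proof eventually_elim
    case (elim s)
    have "\<phi> s \<le> \<phi> t + (s - t) * (\<Lambda> * (norm (z t))\<^sup>2 +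
        2 * (P t (S t (Q t (y t) - m) - S t (Q t (y' t) - m')) \<bullet> z t) + \<epsilon>)"
      using elim(1) by (simp add: \<phi>_def z_def)
    also have "\<dots> \<le> \<phi> t + (s - t) * (3 * \<Lambda> / c * \<phi> t + 2 * K + \<epsilon>)"
      using bd elim(2) by (intro add_left_mono mult_left_mono) auto
    finally show ?case .
  qed
qed

text \<open>The equation P y' + M y = Q y solved for y'.\<close>

definition velocity :: "real \<Rightarrow> 'a \<Rightarrow> 'a"
  where "velocity t x = S t (Q t x - op_apply M x)"

lemma op_apply_graph: "(x, p) \<in> M \<Longrightarrow> op_apply M x = p"
  unfolding op_apply_def using sv by (auto dest: single_valuedD)

lemma op_apply_in_graph: "x \<in> Domain M \<Longrightarrow> (x, op_apply M x) \<in> M"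
  by (auto simp: op_apply_graph)

text \<open>Gronwall's inequality for the gap in the moving inner product, with zero defect and zero
  initial value. The hypotheses ask only for one-sided weak derivatives off a countable set, so weak
  and strong solutions are both covered.\<close>

lemma uniqueness:
  assumes yc: "continuous_on {a..b} y" and yc': "continuous_on {a..b} y'"
    and dom: "\<And>t. t \<in> {a..b} \<Longrightarrow> y t \<in> Domain M" "\<And>t. t \<in> {a..b} \<Longrightarrow> y' t \<in> Domain M"
    and E: "countable E"
    and der: "\<And>t. t \<in> {a..<b} - E \<Longrightarrow> right_weak_derivative y (velocity t (y t)) t"
      "\<And>t. t \<in> {a..<b} - E \<Longrightarrow> right_weak_derivative y' (velocity t (y' t)) t"
    and init: "y a = y' a" and t: "t \<in> {a..b}"
  shows "y t = y' t"
proof -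
  define \<phi> where "\<phi> s = P s (y s - y' s) \<bullet> (y s - y' s)" for s
  have "\<phi> t + 0 / (3 * \<Lambda> / c) \<le> (\<phi> a + 0 / (3 * \<Lambda> / c)) * exp (3 * \<Lambda> / c * (t - a))"
  proof (rule Dini_Gronwall[OF _ _ E])
    show "a \<le> t" using t by simp
    have "continuous_on {a..b} \<phi>"
      unfolding \<phi>_def by (intro continuous_intros P_cont yc yc')
    then show "continuous_on {a..t} \<phi>" using t by (auto elim: continuous_on_subset)
    show "3 * \<Lambda> / c > 0" using c \<Lambda> by simp
    fix s \<epsilon> :: real assume s: "s \<in> {a..<t} - E" and \<epsilon>: "\<epsilon> > 0"
    then have s': "s \<in> {a..<b}" "s \<in> {a..<b} - E" using t by auto
    have mono: "(op_apply M (y s) - op_apply M (y' s)) \<bullet> (y s - y' s) \<ge> - 0"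
      using monotoneD[OF M op_apply_in_graph op_apply_in_graph] dom s' by simp
    from energy_Dini_difference[OF s'(1) der(1)[OF s'(2), unfolded velocity_def]
        der(2)[OF s'(2), unfolded velocity_def] mono \<epsilon>]
    show "\<forall>\<^sub>F r in at_right s. \<phi> r \<le> \<phi> s + (r - s) * (3 * \<Lambda> / c * \<phi> s + 0 + \<epsilon>)"
      by (simp add: \<phi>_def)
  qed
  then have "\<phi> t \<le> 0" using init by (simp add: \<phi>_def)
  then have "c * (norm (y t - y' t))\<^sup>2 \<le> 0"
    using P_coercive[OF t, of "y t - y' t"] by (simp add: \<phi>_def)
  then show ?thesis using c by (simp add: mult_le_0_iff)
qed


section \<open>The energy and uniform bounds for approximate solutions\<close>

text \<open>Since P S = 1, the first term is (P y', y') for y' = S (Q x - m). Expressed through x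
  and m, it is meaningful for any pair and can be tested weakly in m.\<close>

definition energy :: "real \<Rightarrow> 'a \<Rightarrow> 'a \<Rightarrow> real"
  where "energy t x m = S t (Q t x - m) \<bullet> (Q t x - m) + P t x \<bullet> x"

text \<open>In the energy estimate |y'|^2 collects the coefficient \<Lambda>^3 + 4 \<Lambda>: the
  cube from the variation of S, where |Q y - m| \<le> \<Lambda> |y'|, the rest from P, Q and the
  mixed terms. The smaller coefficient of |y|^2 is raised to the same value, and c converts both
  squares into the energy.\<close>

definition growth :: real
  where "growth = (\<Lambda> ^ 3 + 4 * \<Lambda>) / c"

lemma growth_pos: "growth > 0"
  using c \<Lambda> by (simp add: growth_def add_pos_pos)

lemma energy_ge:
  assumes t: "t \<in> {a..b}"
  shows "c * (norm (S t (Q t x - m)))\<^sup>2 + c * (norm x)\<^sup>2 \<le> energy t x m"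
  using P_coercive[OF t, of x] P_coercive[OF t, of "S t (Q t x - m)"]
  by (simp add: energy_def PS[OF t] inner_commute)

lemma energy_nonneg: "t \<in> {a..b} \<Longrightarrow> energy t x m \<ge> 0"
  using S_nonneg P_coercive[of t x] c unfolding energy_def
  by (meson add_nonneg_nonneg less_imp_le mult_nonneg_nonneg order_trans zero_le_power2)

lemma energy_le:
  assumes t: "t \<in> {a..b}" and m: "norm m \<le> r"
  shows "energy t x m \<le> \<Lambda> * (\<Lambda> * norm x + r)\<^sup>2 + \<Lambda> * (norm x)\<^sup>2"
proof -
  define q where "q = Q t x - m"
  have "norm q \<le> \<Lambda> * norm x + r"
    using norm_triangle_ineq4[of "Q t x" m] norm_Q_le[OF t, of x] m by (simp add: q_def)
  then have "(norm q)\<^sup>2 \<le> (\<Lambda> * norm x + r)\<^sup>2" by (intro power_mono) auto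
  then have "\<Lambda> * (norm q)\<^sup>2 \<le> \<Lambda> * (\<Lambda> * norm x + r)\<^sup>2" using \<Lambda> by simp
  moreover have "S t q \<bullet> q \<le> \<Lambda> * (norm q)\<^sup>2"
    using order_trans[OF norm_cauchy_schwarz mult_right_mono[OF norm_S_le[OF t] norm_ge_zero], of q q]
    by (simp add: power2_eq_square mult.assoc)
  moreover have "P t x \<bullet> x \<le> \<Lambda> * (norm x)\<^sup>2"
    using order_trans[OF norm_cauchy_schwarz mult_right_mono[OF norm_P_le[OF t] norm_ge_zero], of x x]
    by (simp add: power2_eq_square mult.assoc)
  ultimately show ?thesis unfolding energy_def q_def[symmetric] by linarith
qed

definition approximate_solution :: "real \<Rightarrow> (real \<Rightarrow> 'a) \<Rightarrow> bool"
  where "approximate_solution e y \<longleftrightarrow> (\<forall>t\<in>{a..b}.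
    (y has_vector_derivative S t (Q t (y t) - yosida M e (y t))) (at t within {a..b}))"

lemma approximate_solutionD: "approximate_solution e y \<Longrightarrow> t \<in> {a..b} \<Longrightarrow>
    (y has_vector_derivative S t (Q t (y t) - yosida M e (y t))) (at t within {a..b})"
  by (simp add: approximate_solution_def)

lemma approximate_solution_continuous: "approximate_solution e y \<Longrightarrow> continuous_on {a..b} y"
  by (rule has_vector_derivative_Icc_continuous_on[OF approximate_solutionD])

lemma approximate_solution_right_weak:
  "approximate_solution e y \<Longrightarrow> t \<in> {a..<b} \<Longrightarrow>
    right_weak_derivative y (S t (Q t (y t) - yosida M e (y t))) t"
  by (rule has_vector_derivative_right_weak[OF approximate_solutionD, where b = b]) auto

text \<open>For fixed e the right-hand side is globally Lipschitz. The constant blows up as e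
  \<rightarrow> 0, so it serves existence only; uniform estimates come from monotonicity.\<close>

lemma approximate_solution_exists:
  assumes e: "e > 0"
  shows "\<exists>y. y a = x0 \<and> approximate_solution e y"
  unfolding approximate_solution_def
proof (rule global_Picard_Lindelof)
  show "a \<le> b" using ab by simp
  show "\<Lambda> * (\<Lambda> + 1 / e) > 0" using \<Lambda> e by (simp add: add_pos_pos)
  fix y :: "real \<Rightarrow> 'a" assume y: "continuous_on {a..b} y"
  have "(1 / e)-lipschitz_on UNIV (yosida M e)"
    using yosida_lipschitz[OF M e] e by (intro lipschitz_onI) (auto simp: dist_norm)
  then have "continuous_on UNIV (yosida M e)" by (rule lipschitz_on_continuous_on)
  then have "continuous_on {a..b} (\<lambda>t. yosida M e (y t))"
    using y by (rule continuous_on_compose2) auto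
  then show "continuous_on {a..b} (\<lambda>t. S t (Q t (y t) - yosida M e (y t)))"
    by (intro continuous_intros S_cont Q_cont y)
next
  fix t x y assume t: "t \<in> {a..b}"
  have "norm (S t (Q t x - yosida M e x) - S t (Q t y - yosida M e y)) =
      norm (S t (Q t (x - y) - (yosida M e x - yosida M e y)))"
    by (simp add: blinfun.diff_right blinfun.add_right algebra_simps)
  also have "\<dots> \<le> \<Lambda> * norm (Q t (x - y) - (yosida M e x - yosida M e y))" by (rule norm_S_le[OF t])
  also have "\<dots> \<le> \<Lambda> * (norm (Q t (x - y)) + norm (yosida M e x - yosida M e y))"
    using \<Lambda> by (intro mult_left_mono norm_triangle_ineq4) simp
  also have "\<dots> \<le> \<Lambda> * (\<Lambda> * norm (x - y) + 1 / e * norm (x - y))"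
    using \<Lambda> by (intro mult_left_mono add_mono norm_Q_le[OF t] yosida_lipschitz[OF M e]) simp
  finally show "norm (S t (Q t x - yosida M e x) - S t (Q t y - yosida M e y)) \<le>
      \<Lambda> * (\<Lambda> + 1 / e) * norm (x - y)" by (simp add: algebra_simps)
qed

text \<open>
  By monotonicity the increment of the Yosida term has nonnegative product with the increment of \<open>y\<close>,
  which to first order is the velocity; so that term drops out.
\<close>

lemma approximate_velocity_up:
  assumes y: "approximate_solution e y" and e: "e > 0" and t: "t \<in> {a..<b}" and \<epsilon>: "\<epsilon> > 0"
  defines "w \<equiv> \<lambda>s. Q s (y s) - yosida M e (y s)"
  defines "v \<equiv> S t (w t)"
  defines "\<kappa> \<equiv> \<Lambda> * (norm v + norm (y t)) * norm v"
  shows "\<forall>\<^sub>F s in at_right t. (w s - w t) \<bullet> S t (w t) \<le> (s - t) * (\<kappa> + \<epsilon>)"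
    and "\<exists>B. \<forall>\<^sub>F s in at_right t. norm (w s - w t) \<le> B * (s - t)"
proof -
  have t': "t \<in> {a..b}" using t by simp
  have der: "(y has_vector_derivative v) (at t within {a..b})"
    using approximate_solutionD[OF y t'] by (simp add: v_def w_def)
  define B where "B = \<Lambda> * (norm v + 1 + norm (y t)) + (1 / e) * (norm v + 1)"
  \<comment> \<open>The slack \<eta> is kept variable: \<eta> = 1 gives the crude Lipschitz bound
    \<open>B\<close>, small \<eta> the sharp first order estimate.\<close>
  have incr: "norm (y s - y t) \<le> (norm v + \<eta>) * (s - t) \<and>
      norm (Q s (y s) - Q t (y t)) \<le> \<Lambda> * (norm v + \<eta> + norm (y t)) * (s - t) \<and>
      norm (w s - w t) \<le> B * (s - t)"
    if s: "norm (y s - y t - (s - t) *\<^sub>R v) \<le> \<eta> * (s - t)" "s \<in> {t<..<b}" and \<eta>: "0 < \<eta>" "\<eta> \<le> 1" for s \<eta>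
  proof -
    have s': "s \<in> {a..b}" "s - t > 0" using s(2) t by auto
    have dy: "norm (y s - y t) \<le> (norm v + \<eta>) * (s - t)"
      using norm_le_of_right_bound[OF s(1)] s' by simp
    have "norm (Q s (y s) - Q t (y t)) = norm (Q s (y s - y t) + (Q s - Q t) (y t))"
      by (simp add: blinfun.diff_left blinfun.diff_right)
    also have "\<dots> \<le> norm (Q s (y s - y t)) + norm ((Q s - Q t) (y t))" by (rule norm_triangle_ineq)
    also have "\<dots> \<le> \<Lambda> * ((norm v + \<eta>) * (s - t)) + (\<Lambda> * (s - t)) * norm (y t)"
    proof (rule add_mono)
      show "norm (Q s (y s - y t)) \<le> \<Lambda> * ((norm v + \<eta>) * (s - t))"
        using order_trans[OF norm_Q_le[OF s'(1)] mult_left_mono[OF dy]] \<Lambda> by simp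
      have "norm (Q s - Q t) \<le> \<Lambda> * (s - t)" using Q_lip[OF s'(1) t'] s' by simp
      then show "norm ((Q s - Q t) (y t)) \<le> (\<Lambda> * (s - t)) * norm (y t)"
        by (intro order_trans[OF norm_blinfun mult_right_mono]) auto
    qed
    finally have dq: "norm (Q s (y s) - Q t (y t)) \<le> \<Lambda> * (norm v + \<eta> + norm (y t)) * (s - t)"
      by (simp add: algebra_simps)
    have "norm (w s - w t) = norm ((Q s (y s) - Q t (y t)) - (yosida M e (y s) - yosida M e (y t)))"
      by (simp add: w_def algebra_simps)
    also have "\<dots> \<le> norm (Q s (y s) - Q t (y t)) + norm (yosida M e (y s) - yosida M e (y t))"
      by (rule norm_triangle_ineq4)
    also have "\<dots> \<le> \<Lambda> * (norm v + \<eta> + norm (y t)) * (s - t) + (1 / e) * ((norm v + \<eta>) * (s - t))"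
      using e by (intro add_mono dq order_trans[OF yosida_lipschitz[OF M e] mult_left_mono[OF dy]]) auto
    also have "\<dots> \<le> \<Lambda> * (norm v + 1 + norm (y t)) * (s - t) + (1 / e) * ((norm v + 1) * (s - t))"
      using \<Lambda> e \<eta> s' by (intro add_mono mult_right_mono mult_left_mono) auto
    also have "\<dots> = B * (s - t)" by (simp only: B_def distrib_right mult.assoc)
    finally have "norm (w s - w t) \<le> B * (s - t)" .
    with dy dq show ?thesis by blast
  qed
  have right: "\<forall>\<^sub>F s in at_right t. norm (y s - y t - (s - t) *\<^sub>R v) \<le> \<eta> * (s - t)" if "\<eta> > 0" for \<eta>
    using t that by (intro has_vector_derivative_right_bound[OF der, of b]) auto
  have near: "\<forall>\<^sub>F s in at_right t. s \<in> {t<..<b}" using t by (intro eventually_at_right_real) auto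
  from right[OF zero_less_one] near have "\<forall>\<^sub>F s in at_right t. norm (w s - w t) \<le> B * (s - t)"
    by eventually_elim (use incr[of _ 1] in simp)
  then show "\<exists>B. \<forall>\<^sub>F s in at_right t. norm (w s - w t) \<le> B * (s - t)" by blast
  \<comment> \<open>\<open>B\<close> depends on 1 / e but enters only multiplied by \<eta>, so the
    limit \<kappa> is independent of e.\<close>
  define k where "k \<eta> = \<Lambda> * (norm v + \<eta> + norm (y t)) * (norm v + \<eta>) + B * \<eta>" for \<eta>
  have "(k \<longlongrightarrow> \<Lambda> * (norm v + 0 + norm (y t)) * (norm v + 0) + B * 0) (at_right 0)"
    unfolding k_def by (intro tendsto_intros)
  then have "(k \<longlongrightarrow> \<kappa>) (at_right 0)" by (simp add: \<kappa>_def)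
  then have "\<forall>\<^sub>F \<eta> in at_right 0. k \<eta> < \<kappa> + \<epsilon>" by (rule order_tendstoD) (use \<epsilon> in simp)
  moreover have "\<forall>\<^sub>F \<eta> in at_right (0::real). \<eta> \<in> {0<..<1}" by (intro eventually_at_right_real) simp
  ultimately have "\<forall>\<^sub>F \<eta> in at_right 0. k \<eta> < \<kappa> + \<epsilon> \<and> \<eta> \<in> {0<..<1}" by (rule eventually_conj)
  then obtain \<eta> where \<eta>: "k \<eta> < \<kappa> + \<epsilon>" "0 < \<eta>" "\<eta> \<le> 1"
    using eventually_happens'[OF trivial_limit_at_right_real[of 0]] by fastforce
  from right[OF \<eta>(2)] near
  show "\<forall>\<^sub>F s in at_right t. (w s - w t) \<bullet> S t (w t) \<le> (s - t) * (\<kappa> + \<epsilon>)"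
  proof eventually_elim
    case (elim s)
    define h where "h = s - t"
    have h: "h > 0" using elim by (simp add: h_def)
    note i = incr[OF elim \<eta>(2,3), folded h_def]
    let ?dy = "y s - y t" and ?dw = "w s - w t" and ?dq = "Q s (y s) - Q t (y t)"
    have "?dw \<bullet> ?dy = ?dq \<bullet> ?dy - (yosida M e (y s) - yosida M e (y t)) \<bullet> ?dy"
      by (simp add: w_def inner_diff_left)
    then have "?dw \<bullet> ?dy \<le> ?dq \<bullet> ?dy" using yosida_monotone[OF M e, of "y s" "y t"] by linarith
    also have "\<dots> \<le> norm ?dq * norm ?dy" by (rule norm_cauchy_schwarz)
    also have "\<dots> \<le> (\<Lambda> * (norm v + \<eta> + norm (y t)) * h) * ((norm v + \<eta>) * h)"
      using i \<eta> \<Lambda> h by (intro mult_mono) auto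
    finally have 1: "?dw \<bullet> ?dy \<le> (\<Lambda> * (norm v + \<eta> + norm (y t)) * h) * ((norm v + \<eta>) * h)" .
    \<comment> \<open>Passing from the increment of y to its linear part h v costs a product of two
      first order quantities, the second of them with the small factor \<eta>. Division by h then
      leaves the required first order bound.\<close>
    have "- (?dw \<bullet> (?dy - h *\<^sub>R v)) \<le> norm ?dw * norm (?dy - h *\<^sub>R v)"
      using Cauchy_Schwarz_ineq2[of ?dw "?dy - h *\<^sub>R v"] by linarith
    also have "\<dots> \<le> (B * h) * (\<eta> * h)"
      using i elim(1) h order_trans[OF norm_ge_zero, of ?dw "B * h"] unfolding h_def[symmetric]
      by (intro mult_mono) auto
    finally have 2: "- (?dw \<bullet> (?dy - h *\<^sub>R v)) \<le> (B * h) * (\<eta> * h)" .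
    have "h * (?dw \<bullet> v) = ?dw \<bullet> ?dy - ?dw \<bullet> (?dy - h *\<^sub>R v)" by (simp add: inner_diff_right)
    also have "\<dots> \<le> h * (h * k \<eta>)" using 1 2 by (simp add: k_def algebra_simps)
    also have "\<dots> \<le> h * (h * (\<kappa> + \<epsilon>))" using h \<eta>(1) by (intro mult_left_mono) auto
    finally have "?dw \<bullet> v \<le> h * (\<kappa> + \<epsilon>)" using h by (simp add: mult_le_cancel_left)
    then show ?case by (simp add: h_def v_def)
  qed
qed

text \<open>The two parts of the energy are treated as quadratic forms of w = Q y - m and of y. For
  w only a one-sided bound on its increments along the velocity is available, and it suffices. The
  rate \<open>growth\<close> does not depend on e.\<close>

lemma approximate_solution_energy:
  assumes y: "approximate_solution e y" and e: "e > 0" and t: "t \<in> {a..b}"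
  shows "energy t (y t) (yosida M e (y t)) \<le> exp (growth * (t - a)) * energy a (y a) (yosida M e (y a))"
proof -
  define w where "w s = Q s (y s) - yosida M e (y s)" for s
  define \<Psi> where "\<Psi> s = energy s (y s) (yosida M e (y s))" for s
  have \<Psi>: "\<Psi> s = S s (w s) \<bullet> w s + P s (y s) \<bullet> y s" for s
    by (simp add: \<Psi>_def energy_def w_def)
  have yc: "continuous_on {a..b} y" by (rule approximate_solution_continuous[OF y])
  have "(1 / e)-lipschitz_on UNIV (yosida M e)"
    using yosida_lipschitz[OF M e] e by (intro lipschitz_onI) (auto simp: dist_norm)
  then have "continuous_on UNIV (yosida M e)" by (rule lipschitz_on_continuous_on)
  then have "continuous_on {a..b} (\<lambda>t. yosida M e (y t))"
    using yc by (rule continuous_on_compose2) auto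
  then have \<Psi>c: "continuous_on {a..b} \<Psi>"
    unfolding \<Psi> w_def by (intro continuous_intros S_cont Q_cont P_cont yc)
  have "\<Psi> t + 0 / growth \<le> (\<Psi> a + 0 / growth) * exp (growth * (t - a))"
  proof (rule Dini_Gronwall[OF _ _ countable_empty growth_pos])
    show "a \<le> t" using t by simp
    show "continuous_on {a..t} \<Psi>" using \<Psi>c t by (auto elim: continuous_on_subset)
    fix s \<epsilon> :: real assume s0: "s \<in> {a..<t} - {}" and \<epsilon>: "\<epsilon> > 0"
    then have s: "s \<in> {a..<b}" "s \<in> {a..b}" using t by auto
    define v where "v = S s (w s)"
    define \<kappa> where "\<kappa> = \<Lambda> * (norm v + norm (y s)) * norm v"
    obtain B where B: "\<forall>\<^sub>F r in at_right s. norm (w r - w s) \<le> B * (r - s)"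
      using approximate_velocity_up(2)[OF y e s(1) \<epsilon>] unfolding w_def by blast
    have up: "\<And>\<epsilon>. \<epsilon> > 0 \<Longrightarrow> \<forall>\<^sub>F r in at_right s. (w r - w s) \<bullet> S s (w s) \<le> (r - s) * (\<kappa> + \<epsilon>)"
      using approximate_velocity_up(1)[OF y e s(1)] unfolding \<kappa>_def v_def w_def by blast
    have yw: "right_weak_derivative y v s"
      using approximate_solution_right_weak[OF y s(1)] by (simp add: v_def w_def)
    have \<epsilon>2: "\<epsilon> / 2 > 0" using \<epsilon> by simp
    have bd: "\<Lambda> * (norm (w s))\<^sup>2 + 2 * \<kappa> + (\<Lambda> * (norm (y s))\<^sup>2 + 2 * (P s v \<bullet> y s)) \<le> growth * \<Psi> s"
    proof -
      have "norm (w s) \<le> \<Lambda> * norm v" using norm_P_le[OF s(2), of v] by (simp add: v_def PS[OF s(2)])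
      then have "\<Lambda> * (norm (w s))\<^sup>2 \<le> \<Lambda> * (\<Lambda> * norm v)\<^sup>2" using \<Lambda> by (simp add: power_mono)
      also have "\<dots> = \<Lambda> ^ 3 * (norm v)\<^sup>2" by (simp add: power2_eq_square power3_eq_cube)
      finally have 1: "\<Lambda> * (norm (w s))\<^sup>2 \<le> \<Lambda> ^ 3 * (norm v)\<^sup>2" .
      have "P s v \<bullet> y s \<le> (\<Lambda> * norm v) * norm (y s)"
        by (rule order_trans[OF norm_cauchy_schwarz mult_right_mono[OF norm_P_le[OF s(2)] norm_ge_zero]])
      then have 2: "P s v \<bullet> y s \<le> \<Lambda> * (norm v * norm (y s))" by simp
      have 3: "\<kappa> = \<Lambda> * (norm v)\<^sup>2 + \<Lambda> * (norm v * norm (y s))"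
        by (simp add: \<kappa>_def power2_eq_square algebra_simps)
      have "\<Lambda> * (2 * (norm v * norm (y s))) \<le> \<Lambda> * ((norm v)\<^sup>2 + (norm (y s))\<^sup>2)"
        using sum_squares_bound[of "norm v" "norm (y s)"] \<Lambda> by (intro mult_left_mono) auto
      then have 4: "2 * (\<Lambda> * (norm v * norm (y s))) \<le> \<Lambda> * (norm v)\<^sup>2 + \<Lambda> * (norm (y s))\<^sup>2"
        by (simp add: algebra_simps)
      have "0 \<le> \<Lambda> * (norm (y s))\<^sup>2" "0 \<le> \<Lambda> ^ 3 * (norm (y s))\<^sup>2" using \<Lambda> by auto
      with 1 2 3 4 have "\<Lambda> * (norm (w s))\<^sup>2 + 2 * \<kappa> + (\<Lambda> * (norm (y s))\<^sup>2 + 2 * (P s v \<bullet> y s)) \<le>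
          (\<Lambda> ^ 3 * (norm v)\<^sup>2 + 4 * (\<Lambda> * (norm v)\<^sup>2)) + (\<Lambda> ^ 3 * (norm (y s))\<^sup>2 + 4 * (\<Lambda> * (norm (y s))\<^sup>2))"
        by linarith
      also have "\<dots> = growth * (c * (norm v)\<^sup>2 + c * (norm (y s))\<^sup>2)"
        using c by (simp add: growth_def field_simps)
      also have "\<dots> \<le> growth * \<Psi> s"
        using energy_ge[OF s(2), of "y s" "yosida M e (y s)"] growth_pos
        by (intro mult_left_mono) (auto simp: \<Psi>_def v_def w_def)
      finally show ?thesis .
    qed
    have "\<forall>\<^sub>F r in at_right s. S r (w r) \<bullet> w r \<le>
        S s (w s) \<bullet> w s + (r - s) * (\<Lambda> * (norm (w s))\<^sup>2 + 2 * \<kappa> + \<epsilon> / 2)"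
      by (rule quadratic_form_Dini[OF S_sym[OF s(2)] S_lip_right[OF s(1)] B _ \<epsilon>2]) (rule up)
    from this
      quadratic_form_Dini_weak[OF P_sym[OF s(2)] P_lip_right[OF s(1)] yw \<epsilon>2]
      eventually_at_right_less[of s]
    show "\<forall>\<^sub>F r in at_right s. \<Psi> r \<le> \<Psi> s + (r - s) * (growth * \<Psi> s + 0 + \<epsilon>)"
    proof eventually_elim
      case (elim r)
      have split: "h * (x + x' + \<epsilon>) = h * (x + \<epsilon> / 2) + h * (x' + \<epsilon> / 2)" for h x x' :: real
        by (simp add: field_simps)
      have "\<Psi> r \<le> \<Psi> s + (r - s) * ((\<Lambda> * (norm (w s))\<^sup>2 + 2 * \<kappa> +
          (\<Lambda> * (norm (y s))\<^sup>2 + 2 * (P s v \<bullet> y s))) + \<epsilon>)"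
        using elim(1,2) unfolding \<Psi> split by linarith
      also have "\<dots> \<le> \<Psi> s + (r - s) * (growth * \<Psi> s + \<epsilon>)"
        using elim(3) bd by (intro add_left_mono mult_left_mono add_right_mono) auto
      finally show ?case by simp
    qed
  qed
  then show ?thesis by (simp add: \<Psi>_def mult.commute)
qed

text \<open>The Yosida values are elements of M over y - e m and y' - e' m'. Against y - y'
  monotonicity therefore fails by at most (2 R) (e R + e' R), which is the defect K; Gronwall then
  starts from zero.\<close>

lemma approximate_solutions_close:
  assumes y: "approximate_solution e y" "e > 0" and y': "approximate_solution e' y'" "e' > 0"
    and init: "y a = y' a" and t: "t \<in> {a..b}"
    and R: "\<And>s. s \<in> {a..b} \<Longrightarrow> norm (yosida M e (y s)) \<le> R"
      "\<And>s. s \<in> {a..b} \<Longrightarrow> norm (yosida M e' (y' s)) \<le> R"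
  shows "(norm (y t - y' t))\<^sup>2 \<le> 4 * R\<^sup>2 / (3 * \<Lambda>) * exp (3 * \<Lambda> / c * (b - a)) * (e + e')"
proof -
  define \<phi> where "\<phi> s = P s (y s - y' s) \<bullet> (y s - y' s)" for s
  define C where "C = 3 * \<Lambda> / c"
  define K where "K = 2 * R\<^sup>2 * (e + e')"
  have C: "C > 0" using c \<Lambda> by (simp add: C_def)
  have K: "K \<ge> 0" using y y' by (simp add: K_def)
  have "\<phi> t + 2 * K / C \<le> (\<phi> a + 2 * K / C) * exp (C * (t - a))"
  proof (rule Dini_Gronwall[OF _ _ countable_empty C])
    show "a \<le> t" using t by simp
    have "continuous_on {a..b} \<phi>" unfolding \<phi>_def
      by (intro continuous_intros P_cont approximate_solution_continuous[OF y(1)]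
          approximate_solution_continuous[OF y'(1)])
    then show "continuous_on {a..t} \<phi>" using t by (auto elim: continuous_on_subset)
    fix s \<epsilon> :: real assume s0: "s \<in> {a..<t} - {}" and \<epsilon>: "\<epsilon> > 0"
    then have s: "s \<in> {a..<b}" "s \<in> {a..b}" using t by auto
    let ?m = "yosida M e (y s)" and ?m' = "yosida M e' (y' s)"
    have "- ((?m - ?m') \<bullet> (e *\<^sub>R ?m - e' *\<^sub>R ?m')) \<le> norm (?m - ?m') * norm (e *\<^sub>R ?m - e' *\<^sub>R ?m')"
      using Cauchy_Schwarz_ineq2[of "?m - ?m'" "e *\<^sub>R ?m - e' *\<^sub>R ?m'"] by linarith
    also have "\<dots> \<le> (R + R) * (e * R + e' * R)"
    proof (intro mult_mono)
      show "norm (?m - ?m') \<le> R + R"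
        using norm_triangle_ineq4[of ?m ?m'] R[OF s(2)] by linarith
      have "norm (e *\<^sub>R ?m) \<le> e * R" "norm (e' *\<^sub>R ?m') \<le> e' * R"
        using R[OF s(2)] y(2) y'(2) by auto
      then show "norm (e *\<^sub>R ?m - e' *\<^sub>R ?m') \<le> e * R + e' * R"
        using norm_triangle_ineq4[of "e *\<^sub>R ?m" "e' *\<^sub>R ?m'"] by linarith
      show "0 \<le> R + R" using order_trans[OF norm_ge_zero R(1)[OF s(2)]] by simp
    qed simp
    also have "\<dots> = K" by (simp add: K_def power2_eq_square algebra_simps)
    finally have mono: "(?m - ?m') \<bullet> (y s - y' s) \<ge> - K"
      using yosida_inner_ge[OF M y(2) y'(2), of "y s" "y' s"] by linarith
    from energy_Dini_difference[OF s(1) approximate_solution_right_weak[OF y(1) s(1)]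
        approximate_solution_right_weak[OF y'(1) s(1)] mono \<epsilon>]
    show "\<forall>\<^sub>F r in at_right s. \<phi> r \<le> \<phi> s + (r - s) * (C * \<phi> s + 2 * K + \<epsilon>)"
      by (simp add: \<phi>_def C_def)
  qed
  then have "\<phi> t + 2 * K / C \<le> 2 * K / C * exp (C * (t - a))" by (simp add: \<phi>_def init)
  also have "\<dots> \<le> 2 * K / C * exp (C * (b - a))" using t C K by (intro mult_left_mono) auto
  finally have "\<phi> t + 2 * K / C \<le> 2 * K / C * exp (C * (b - a))" .
  moreover have "2 * K / C \<ge> 0" using K C by simp
  ultimately have "\<phi> t \<le> 2 * K / C * exp (C * (b - a))" by linarith
  then have "c * (norm (y t - y' t))\<^sup>2 \<le> 2 * K / C * exp (C * (b - a))"
    using P_coercive[OF t, of "y t - y' t"] by (simp add: \<phi>_def)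
  then have "(norm (y t - y' t))\<^sup>2 \<le> (2 * K / C * exp (C * (b - a))) / c"
    using c by (metis mult.commute pos_le_divide_eq)
  also have "\<dots> = 4 * R\<^sup>2 / (3 * \<Lambda>) * exp (C * (b - a)) * (e + e')"
    using c \<Lambda> by (simp add: K_def C_def field_simps)
  finally show ?thesis by (simp add: C_def)
qed


section \<open>Passage to the limit\<close>

text \<open>Time, state and base point on the graph vary independently: Z will be an approximate
  solution and u its resolvent. Symmetry moves S to the test vector, where strong convergence meets
  the weak convergence of m.\<close>

lemma velocity_weak_tendsto:
  assumes p: "(z, p) \<in> M" and t: "t \<in> {a..b}" and \<sigma>: "(\<sigma> \<longlongrightarrow> t) F" "\<forall>\<^sub>F i in F. \<sigma> i \<in> {a..b}"
    and Z: "(Z \<longlongrightarrow> z) F" and u: "(u \<longlongrightarrow> z) F"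
    and um: "\<forall>\<^sub>F i in F. (u i, m i) \<in> M \<and> norm (m i) \<le> C"
  shows "((\<lambda>i. (Q (\<sigma> i) (Z i) - m i) \<bullet> x) \<longlongrightarrow> (Q t z - p) \<bullet> x) F"
    and "((\<lambda>i. S (\<sigma> i) (Q (\<sigma> i) (Z i) - m i) \<bullet> x) \<longlongrightarrow> S t (Q t z - p) \<bullet> x) F"
proof -
  have Q: "((\<lambda>i. Q (\<sigma> i)) \<longlongrightarrow> Q t) F"
    by (rule continuous_on_tendsto_compose[OF Q_cont \<sigma>(1) t \<sigma>(2)])
  have S: "((\<lambda>i. S (\<sigma> i)) \<longlongrightarrow> S t) F"
    by (rule continuous_on_tendsto_compose[OF S_cont \<sigma>(1) t \<sigma>(2)])
  have mC: "\<forall>\<^sub>F i in F. norm (m i) \<le> C" using um by (rule eventually_mono) simp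
  have m: "((\<lambda>i. m i \<bullet> x) \<longlongrightarrow> p \<bullet> x) F" for x
    by (rule maximal_monotone_weak_tendsto[OF M sv p um u])
  show "((\<lambda>i. (Q (\<sigma> i) (Z i) - m i) \<bullet> x) \<longlongrightarrow> (Q t z - p) \<bullet> x) F"
    unfolding inner_diff_left by (intro tendsto_intros Q Z m)
  have Sx: "((\<lambda>i. S (\<sigma> i) x) \<longlongrightarrow> S t x) F" by (intro tendsto_intros S)
  have "((\<lambda>i. Q (\<sigma> i) (Z i) \<bullet> S (\<sigma> i) x - m i \<bullet> S (\<sigma> i) x) \<longlongrightarrow> Q t z \<bullet> S t x - p \<bullet> S t x) F"
    by (intro tendsto_intros Q Z S weak_strong_inner_tendsto[OF m mC Sx])
  moreover have "S t (Q t z - p) \<bullet> x = Q t z \<bullet> S t x - p \<bullet> S t x"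
    by (simp add: S_sym[OF t] inner_diff_left)
  moreover have "\<forall>\<^sub>F i in F. Q (\<sigma> i) (Z i) \<bullet> S (\<sigma> i) x - m i \<bullet> S (\<sigma> i) x = S (\<sigma> i) (Q (\<sigma> i) (Z i) - m i) \<bullet> x"
    using \<sigma>(2) by eventually_elim (simp only: S_sym inner_diff_left)
  ultimately show "((\<lambda>i. S (\<sigma> i) (Q (\<sigma> i) (Z i) - m i) \<bullet> x) \<longlongrightarrow> S t (Q t z - p) \<bullet> x) F"
    by (auto elim: Lim_transform_eventually)
qed

text \<open>The form at q' lies above its tangent at q. The tangent is linear in q', so it passes to
  weak limits; this takes the place of weak lower semicontinuity.\<close>

lemma energy_weak_lower_bound:
  assumes t: "t \<in> {a..b}"
  shows "2 * (S t q \<bullet> q') - S t q \<bullet> q \<le> S t q' \<bullet> q'"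
proof -
  have "0 \<le> S t (q' - q) \<bullet> (q' - q)" by (rule S_nonneg[OF t])
  also have "\<dots> = S t q' \<bullet> q' - 2 * (S t q \<bullet> q') + S t q \<bullet> q"
    using S_sym[OF t, of q' q]
    by (simp add: blinfun.diff_right inner_diff_left inner_diff_right inner_commute)
  finally show ?thesis by linarith
qed

text \<open>The bound on M y is what makes M y weakly continuous by demicontinuity, so the weak
  derivative can be demanded at every time, without exceptional set.\<close>

definition weak_solution :: "(real \<Rightarrow> 'a) \<Rightarrow> bool"
  where "weak_solution y \<longleftrightarrow> (\<forall>t\<in>{a..b}. y t \<in> Domain M) \<and>
    (\<exists>R. \<forall>t\<in>{a..b}. norm (op_apply M (y t)) \<le> R \<and> (\<forall>s\<in>{a..b}. norm (y s - y t) \<le> R * \<bar>s - t\<bar>)) \<and>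
    (\<forall>t\<in>{a..b}. \<forall>x. ((\<lambda>s. y s \<bullet> x) has_real_derivative velocity t (y t) \<bullet> x) (at t within {a..b}))"

text \<open>The energy bound is sharp at t = a: it contains the energy of the initial pair itself
  and a factor equal to 1 there. This sharpness is what the restart argument consumes.\<close>

theorem weak_solution_exists:
  assumes p0: "(x0, p0) \<in> M"
  shows "\<exists>y. y a = x0 \<and> weak_solution y \<and>
    (\<forall>t\<in>{a..b}. energy t (y t) (op_apply M (y t)) \<le> exp (growth * (t - a)) * energy a x0 p0)"
proof -
  define e where "e n = 1 / real (Suc n)" for n
  have e: "e n > 0" for n by (simp add: e_def)
  have e0: "e \<longlonglongrightarrow> 0" unfolding e_def by (rule LIMSEQ_Suc[OF lim_1_over_n])
  have "\<exists>y. y a = x0 \<and> approximate_solution (e n) y" for n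
    by (rule approximate_solution_exists[OF e])
  then obtain Y where Y0: "\<And>n. Y n a = x0" and Y: "\<And>n. approximate_solution (e n) (Y n)" by metis
  define m where "m n t = yosida M (e n) (Y n t)" for n t
  define u where "u n t = resolvent M (e n) (Y n t)" for n t
  define v where "v n t = S t (Q t (Y n t) - m n t)" for n t
  have um: "(u n t, m n t) \<in> M" for n t unfolding u_def m_def by (rule yosida_in_graph[OF M e])
  have Yder: "(Y n has_vector_derivative v n t) (at t within {a..b})" if "t \<in> {a..b}" for n t
    using approximate_solutionD[OF Y that] by (simp add: v_def m_def)
  have aI: "a \<in> {a..b}" using ab by simp
  define E0 where "E0 = \<Lambda> * (\<Lambda> * norm x0 + norm p0)\<^sup>2 + \<Lambda> * (norm x0)\<^sup>2"
  define G where "G = exp (growth * (b - a)) * E0"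
  have init_energy: "energy a x0 (m n a) \<le> E0" for n
    unfolding E0_def m_def Y0 by (intro energy_le aI norm_yosida_le[OF M e p0])
  have E0: "E0 \<ge> 0" using energy_nonneg[OF aI] init_energy by (meson order_trans)
  have energy_n: "energy t (Y n t) (m n t) \<le> exp (growth * (t - a)) * energy a x0 (m n a)"
    if t: "t \<in> {a..b}" for n t
    using approximate_solution_energy[OF Y e t] by (simp add: m_def Y0)
  have energy_G: "energy t (Y n t) (m n t) \<le> G" if t: "t \<in> {a..b}" for n t
  proof -
    have "exp (growth * (t - a)) * energy a x0 (m n a) \<le> exp (growth * (b - a)) * E0"
      using t growth_pos E0 init_energy by (intro mult_mono energy_nonneg[OF aI]) auto
    then show ?thesis using energy_n[OF t, of n] unfolding G_def by linarith
  qed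
  define R0 where "R0 = sqrt (G / c)"
  \<comment> \<open>\<open>R0\<close> bounds velocities and states; the second entry bounds m = Q y
    - P v. One \<open>R\<close> then serves as Lipschitz constant and as bound on the graph
    values.\<close>
  define R where "R = max R0 (\<Lambda> * R0 + \<Lambda> * R0)"
  have bound: "norm (v n t) \<le> R0 \<and> norm (Y n t) \<le> R0" if t: "t \<in> {a..b}" for n t
  proof -
    have "c * (norm (v n t))\<^sup>2 + c * (norm (Y n t))\<^sup>2 \<le> G"
      using energy_ge[OF t, of "Y n t" "m n t"] energy_G[OF t, of n] by (simp add: v_def)
    moreover have "c * (norm (v n t))\<^sup>2 \<ge> 0" "c * (norm (Y n t))\<^sup>2 \<ge> 0" using c by auto
    ultimately have "c * (norm (v n t))\<^sup>2 \<le> G" "c * (norm (Y n t))\<^sup>2 \<le> G" by linarith+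
    then have "(norm (v n t))\<^sup>2 \<le> G / c" "(norm (Y n t))\<^sup>2 \<le> G / c"
      using c by (metis mult.commute pos_le_divide_eq)+
    then show ?thesis by (simp add: R0_def real_le_rsqrt)
  qed
  have m_bound: "norm (m n t) \<le> R" if t: "t \<in> {a..b}" for n t
  proof -
    have "m n t = Q t (Y n t) - P t (v n t)" by (simp add: v_def PS[OF t])
    then have "norm (m n t) \<le> norm (Q t (Y n t)) + norm (P t (v n t))" by (simp add: norm_triangle_ineq4)
    also have "\<dots> \<le> \<Lambda> * R0 + \<Lambda> * R0"
      using bound[OF t, of n] \<Lambda>
      by (intro add_mono order_trans[OF norm_Q_le[OF t]] order_trans[OF norm_P_le[OF t]] mult_left_mono) auto
    finally show ?thesis by (simp add: R_def)
  qed
  have Y_lip: "norm (Y n s - Y n t) \<le> R * \<bar>s - t\<bar>" if st: "s \<in> {a..b}" "t \<in> {a..b}" for n s t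
  proof -
    have "norm (Y n s - Y n t) \<le> R0 * norm (s - t)"
    proof (rule differentiable_bound[where S = "{a..b}" and f' = "\<lambda>r h. h *\<^sub>R v n r"])
      fix r assume r: "r \<in> {a..b}"
      show "(Y n has_derivative (\<lambda>h. h *\<^sub>R v n r)) (at r within {a..b})"
        using Yder[OF r] by (simp add: has_vector_derivative_def)
      show "onorm (\<lambda>h. h *\<^sub>R v n r) \<le> R0"
        using bound[OF r, of n] by (intro onorm_le) (simp add: mult.commute[of R0] mult_left_mono)
    qed (use st in auto)
    also have "\<dots> \<le> R * \<bar>s - t\<bar>"
      unfolding real_norm_def by (rule mult_right_mono) (auto simp: R_def)
    finally show ?thesis .
  qed
  define A where "A = 4 * R\<^sup>2 / (3 * \<Lambda>) * exp (3 * \<Lambda> / c * (b - a))"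
  have A: "A \<ge> 0" using \<Lambda> by (simp add: A_def)
  have close: "(norm (Y n t - Y k t))\<^sup>2 \<le> A * (e n + e k)" if "t \<in> {a..b}" for n k t
    unfolding A_def
    by (rule approximate_solutions_close[OF Y e Y e]) (use Y0 that m_bound in \<open>auto simp: m_def\<close>)
  have "uniformly_Cauchy_on {a..b} Y"
    unfolding uniformly_Cauchy_on_def
  proof (intro allI impI)
    fix \<epsilon> :: real assume \<epsilon>: "\<epsilon> > 0"
    have "(\<lambda>n. A * (2 * e n)) \<longlonglongrightarrow> A * (2 * 0)" by (intro tendsto_intros e0)
    then have "\<forall>\<^sub>F n in sequentially. A * (2 * e n) < \<epsilon>\<^sup>2" by (rule order_tendstoD) (use \<epsilon> in simp)
    then obtain K where K: "A * (2 * e K) < \<epsilon>\<^sup>2" by (auto simp: eventually_sequentially)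
    have "dist (Y n t) (Y k t) < \<epsilon>" if t: "t \<in> {a..b}" "n \<ge> K" "k \<ge> K" for t n k
    proof -
      have "e n \<le> e K" "e k \<le> e K" using that by (auto simp: e_def frac_le)
      then have "A * (e n + e k) \<le> A * (2 * e K)" using A by (intro mult_left_mono) auto
      then have "(norm (Y n t - Y k t))\<^sup>2 < \<epsilon>\<^sup>2" using close[OF t(1), of n k] K by linarith
      then show ?thesis using \<epsilon> by (simp add: dist_norm power2_less_imp_less)
    qed
    then show "\<exists>K. \<forall>t\<in>{a..b}. \<forall>n\<ge>K. \<forall>k\<ge>K. dist (Y n t) (Y k t) < \<epsilon>" by blast
  qed
  then obtain y where y: "uniform_limit {a..b} Y y sequentially"
    using Cauchy_uniformly_convergent uniformly_convergent_on_def by blast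
  have ylim: "(\<lambda>n. Y n t) \<longlonglongrightarrow> y t" if "t \<in> {a..b}" for t
    using tendsto_uniform_limitI[OF y that] .
  have yc: "continuous_on {a..b} y"
    by (rule uniform_limit_theorem[OF _ y]) (use approximate_solution_continuous[OF Y] in auto)
  have y_lip: "norm (y s - y t) \<le> R * \<bar>s - t\<bar>" if st: "s \<in> {a..b}" "t \<in> {a..b}" for s t
  proof -
    have "(\<lambda>n. norm (Y n s - Y n t)) \<longlonglongrightarrow> norm (y s - y t)" by (intro tendsto_intros ylim st)
    then show ?thesis by (rule LIMSEQ_le_const2) (use Y_lip[OF st] in blast)
  qed
  have uY: "norm (u n t - Y n t) \<le> e n * R" if "t \<in> {a..b}" for n t
    using norm_resolvent_diff[OF M e, of n "Y n t"] m_bound[OF that, of n] e[of n] by (simp add: u_def m_def)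
  have ulim: "((\<lambda>i. u (N i) (\<sigma> i)) \<longlongrightarrow> z) F"
    if N: "filterlim N sequentially F" and \<sigma>: "\<forall>\<^sub>F i in F. \<sigma> i \<in> {a..b}"
      and YN: "((\<lambda>i. Y (N i) (\<sigma> i)) \<longlongrightarrow> z) F" for N :: "'i \<Rightarrow> nat" and \<sigma> z F
  proof (rule Lim_transform[OF YN])
    have "((\<lambda>i. e (N i) * R) \<longlongrightarrow> 0 * R) F"
      by (intro tendsto_intros filterlim_compose[OF e0 N])
    then have "((\<lambda>i. e (N i) * R) \<longlongrightarrow> 0) F" by simp
    moreover have "\<forall>\<^sub>F i in F. norm (u (N i) (\<sigma> i) - Y (N i) (\<sigma> i)) \<le> e (N i) * R"
      using \<sigma> by eventually_elim (rule uY)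
    ultimately show "((\<lambda>i. u (N i) (\<sigma> i) - Y (N i) (\<sigma> i)) \<longlongrightarrow> 0) F" by (rule Lim_null_comparison[rotated])
  qed
  have graph: "(y t, op_apply M (y t)) \<in> M \<and> norm (op_apply M (y t)) \<le> R" if t: "t \<in> {a..b}" for t
  proof -
    have "(\<lambda>n. u n t) \<longlonglongrightarrow> y t"
      using ulim[of "\<lambda>n. n" sequentially "\<lambda>_. t"] ylim[OF t] t by (simp add: filterlim_ident)
    then obtain p where "(y t, p) \<in> M" "norm p \<le> R"
      using maximal_monotone_closed_bounded[of M "\<lambda>n. u n t" "\<lambda>n. m n t", OF M um _ m_bound[OF t]] by blast
    then show ?thesis by (simp add: op_apply_graph)
  qed
  have deriv: "((\<lambda>s. y s \<bullet> x) has_real_derivative velocity t (y t) \<bullet> x) (at t within {a..b})"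
    if t: "t \<in> {a..b}" for t x
  proof -
    \<comment> \<open>The filter does not exclude t, since the mean value argument below runs over
      the closed segment from t to s. The product with \<open>sequentially\<close> yields one
      neighbourhood of t that works for all large n at once.\<close>
    define H where "H = inf (nhds t) (principal {a..b})"
    define F where "F = (sequentially :: nat filter) \<times>\<^sub>F H"
    have N: "filterlim fst sequentially F" unfolding F_def by (rule filterlim_fst)
    have sH: "filterlim snd H F" unfolding F_def by (rule filterlim_snd)
    then have \<sigma>: "(snd \<longlongrightarrow> t) F" "\<forall>\<^sub>F i in F. snd i \<in> {a..b}"
      by (auto simp: H_def filterlim_inf filterlim_principal)
    have "((\<lambda>i. Y (fst i) (snd i)) \<longlongrightarrow> y t) F"
    proof (rule Lim_transform)
      show "((\<lambda>i. y (snd i)) \<longlongrightarrow> y t) F"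
        by (rule continuous_on_tendsto_compose[OF yc \<sigma>(1) t \<sigma>(2)])
      show "((\<lambda>i. Y (fst i) (snd i) - y (snd i)) \<longlongrightarrow> 0) F"
      proof (rule tendstoI)
        fix \<epsilon> :: real assume "\<epsilon> > 0"
        then have "\<forall>\<^sub>F n in sequentially. \<forall>s\<in>{a..b}. dist (Y n s) (y s) < \<epsilon>"
          using y by (simp add: uniform_limit_iff)
        then have "\<forall>\<^sub>F i in F. \<forall>s\<in>{a..b}. dist (Y (fst i) s) (y s) < \<epsilon>"
          by (rule eventually_compose_filterlim[OF _ N])
        with \<sigma>(2) show "\<forall>\<^sub>F i in F. dist (Y (fst i) (snd i) - y (snd i)) 0 < \<epsilon>"
          by eventually_elim (auto simp: dist_norm)
      qed
    qed
    note YF = this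
    have mF: "\<forall>\<^sub>F i in F. (u (fst i) (snd i), m (fst i) (snd i)) \<in> M \<and> norm (m (fst i) (snd i)) \<le> R"
      using \<sigma>(2) by eventually_elim (use um m_bound in blast)
    have vF: "((\<lambda>i. v (fst i) (snd i) \<bullet> x) \<longlongrightarrow> velocity t (y t) \<bullet> x) F"
      unfolding v_def velocity_def
      by (rule velocity_weak_tendsto(2)[OF conjunct1[OF graph[OF t]] t \<sigma> YF ulim[OF N \<sigma>(2) YF] mF])
    show ?thesis
      unfolding has_field_derivative_def has_derivative_within_alt
    proof (intro conjI allI impI bounded_linear_mult_right)
      fix \<epsilon> :: real assume "\<epsilon> > 0"
      then have "\<forall>\<^sub>F i in F. dist (v (fst i) (snd i) \<bullet> x) (velocity t (y t) \<bullet> x) < \<epsilon>"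
        by (rule tendstoD[OF vF])
      then obtain P1 P2 where P: "eventually P1 sequentially" "eventually P2 H"
        "\<And>n s. P1 n \<Longrightarrow> P2 s \<Longrightarrow> dist (v n s \<bullet> x) (velocity t (y t) \<bullet> x) < \<epsilon>"
        unfolding F_def eventually_prod_filter by auto
      obtain K where K: "\<And>n. n \<ge> K \<Longrightarrow> P1 n" using P(1) by (auto simp: eventually_sequentially)
      obtain d where d: "d > 0" "\<And>s. dist s t < d \<Longrightarrow> s \<in> {a..b} \<Longrightarrow> P2 s"
        using P(2) unfolding H_def eventually_inf_principal eventually_nhds_metric by blast
      have "norm (y s \<bullet> x - y t \<bullet> x - velocity t (y t) \<bullet> x * (s - t)) \<le> \<epsilon> * norm (s - t)"
        if s: "s \<in> {a..b}" "norm (s - t) < d" for s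
      proof -
        have sub: "r \<in> {a..b} \<and> dist r t < d" if "r \<in> closed_segment t s" for r
          using that s t by (auto simp: closed_segment_eq_real_ivl dist_real_def split: if_splits)
        have "norm (Y n s \<bullet> x - Y n t \<bullet> x - velocity t (y t) \<bullet> x * (s - t)) \<le> \<epsilon> * norm (s - t)"
          if n: "n \<ge> K" for n
        proof -
          have "norm ((Y n s \<bullet> x - velocity t (y t) \<bullet> x * s) - (Y n t \<bullet> x - velocity t (y t) \<bullet> x * t))
              \<le> \<epsilon> * norm (s - t)"
          proof (rule field_differentiable_bound)
            show "convex (closed_segment t s)" by simp
            fix r assume r: "r \<in> closed_segment t s"
            have "(Y n has_vector_derivative v n r) (at r within closed_segment t s)"
              using sub r by (intro has_vector_derivative_within_subset[OF Yder]) auto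
            then have "((\<lambda>s. Y n s \<bullet> x) has_real_derivative v n r \<bullet> x) (at r within closed_segment t s)"
              by (auto simp: has_vector_derivative_def has_field_derivative_def mult_commute_abs
                  intro!: derivative_eq_intros)
            then show "((\<lambda>s. Y n s \<bullet> x - velocity t (y t) \<bullet> x * s) has_real_derivative
                v n r \<bullet> x - velocity t (y t) \<bullet> x) (at r within closed_segment t s)"
              by (auto intro!: derivative_eq_intros)
            show "norm (v n r \<bullet> x - velocity t (y t) \<bullet> x) \<le> \<epsilon>"
              using P(3)[OF K[OF n] d(2)] sub[OF r] by (auto simp: dist_real_def intro: less_imp_le)
          qed auto
          then show ?thesis by (simp add: algebra_simps)
        qed
        moreover have "(\<lambda>n. norm (Y n s \<bullet> x - Y n t \<bullet> x - velocity t (y t) \<bullet> x * (s - t))) \<longlonglongrightarrow>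
            norm (y s \<bullet> x - y t \<bullet> x - velocity t (y t) \<bullet> x * (s - t))"
          by (intro tendsto_intros ylim s(1) t)
        ultimately show ?thesis by (intro LIMSEQ_le_const2) blast+
      qed
      then show "\<exists>d>0. \<forall>s\<in>{a..b}. norm (s - t) < d \<longrightarrow>
          norm (y s \<bullet> x - y t \<bullet> x - velocity t (y t) \<bullet> x * (s - t)) \<le> \<epsilon> * norm (s - t)"
        using d(1) by blast
    qed
  qed
  have y_energy: "energy t (y t) (op_apply M (y t)) \<le> exp (growth * (t - a)) * energy a x0 p0"
    if t: "t \<in> {a..b}" for t
  proof -
    define q where "q = Q t (y t) - op_apply M (y t)"
    have "(\<lambda>n. u n t) \<longlonglongrightarrow> y t"
      using ulim[of "\<lambda>n. n" sequentially "\<lambda>_. t"] ylim[OF t] t by (simp add: filterlim_ident)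
    \<comment> \<open>The test vector is \<open>S t q\<close> for the limit q itself, so the tangent
      bound at q becomes an equality in the limit.\<close>
    then have w: "(\<lambda>n. (Q t (Y n t) - m n t) \<bullet> S t q) \<longlonglongrightarrow> q \<bullet> S t q"
      unfolding q_def using um m_bound[OF t] t
      by (intro velocity_weak_tendsto(1)[OF conjunct1[OF graph[OF t]] t, of "\<lambda>_. t" _ _ "\<lambda>n. u n t" _ R])
        (auto intro: ylim)
    have "(\<lambda>n. P t (Y n t) \<bullet> Y n t) \<longlonglongrightarrow> P t (y t) \<bullet> y t" by (intro tendsto_intros ylim t)
    with w have "(\<lambda>n. 2 * ((Q t (Y n t) - m n t) \<bullet> S t q) - S t q \<bullet> q + P t (Y n t) \<bullet> Y n t) \<longlonglongrightarrow>
        2 * (q \<bullet> S t q) - S t q \<bullet> q + P t (y t) \<bullet> y t"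
      by (intro tendsto_add tendsto_diff tendsto_mult_left tendsto_const)
    moreover have "2 * (q \<bullet> S t q) - S t q \<bullet> q + P t (y t) \<bullet> y t = energy t (y t) (op_apply M (y t))"
      by (simp add: energy_def q_def inner_commute)
    moreover have "(\<lambda>n. exp (growth * (t - a)) * energy a x0 (m n a)) \<longlonglongrightarrow>
        exp (growth * (t - a)) * energy a x0 p0"
    proof -
      have "filterlim e (at_right 0) sequentially"
        unfolding filterlim_at using e e0 by (auto simp: less_imp_neq[OF e, symmetric])
      then have "(\<lambda>n. m n a) \<longlonglongrightarrow> p0"
        unfolding m_def Y0 by (rule filterlim_compose[OF yosida_tendsto[OF M sv p0]])
      then show ?thesis unfolding energy_def by (intro tendsto_intros)
    qed
    moreover have "2 * ((Q t (Y n t) - m n t) \<bullet> S t q) - S t q \<bullet> q + P t (Y n t) \<bullet> Y n t \<le>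
        exp (growth * (t - a)) * energy a x0 (m n a)" for n
      using energy_weak_lower_bound[OF t, of q "Q t (Y n t) - m n t"] energy_n[OF t, of n]
      by (simp add: energy_def inner_commute)
    ultimately show ?thesis by (metis (no_types, lifting) LIMSEQ_le)
  qed
  have "weak_solution y" unfolding weak_solution_def
    using graph y_lip deriv by blast
  moreover have "y a = x0" using ylim[OF aI] by (simp add: Y0 LIMSEQ_const_iff)
  ultimately show ?thesis using y_energy by blast
qed


section \<open>Restarting and regularity of weak solutions\<close>

lemma weak_solutionD:
  assumes "weak_solution y" "t \<in> {a..b}"
  shows "y t \<in> Domain M" "(y t, op_apply M (y t)) \<in> M"
    "((\<lambda>s. y s \<bullet> x) has_real_derivative velocity t (y t) \<bullet> x) (at t within {a..b})"
  using assms op_apply_in_graph unfolding weak_solution_def by blast+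

lemma weak_solution_bound:
  assumes "weak_solution y"
  obtains R where "\<And>t. t \<in> {a..b} \<Longrightarrow> norm (op_apply M (y t)) \<le> R"
    "\<And>s t. s \<in> {a..b} \<Longrightarrow> t \<in> {a..b} \<Longrightarrow> norm (y s - y t) \<le> R * \<bar>s - t\<bar>"
  using assms unfolding weak_solution_def by blast

lemma weak_solution_continuous:
  assumes "weak_solution y"
  shows "continuous_on {a..b} y"
proof -
  obtain R where R: "\<And>t. t \<in> {a..b} \<Longrightarrow> norm (op_apply M (y t)) \<le> R"
    "\<And>s t. s \<in> {a..b} \<Longrightarrow> t \<in> {a..b} \<Longrightarrow> norm (y s - y t) \<le> R * \<bar>s - t\<bar>"
    using weak_solution_bound[OF assms] by blast
  have "R \<ge> 0" using order_trans[OF norm_ge_zero R(1)[of a]] ab by simp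
  then have "R-lipschitz_on {a..b} y"
    using R(2) by (intro lipschitz_onI) (auto simp: dist_norm)
  then show ?thesis by (rule lipschitz_on_continuous_on)
qed

lemma weak_solution_right_weak:
  assumes y: "weak_solution y" and t: "t \<in> {a..<b}"
  shows "right_weak_derivative y (velocity t (y t)) t"
  unfolding right_weak_derivative_def
proof (intro conjI allI impI)
  have t': "t \<in> {a..b}" using t by simp
  fix x and \<epsilon> :: real assume \<epsilon>: "\<epsilon> > 0"
  have "((\<lambda>s. y s \<bullet> x) has_vector_derivative velocity t (y t) \<bullet> x) (at t within {a..b})"
    using weak_solutionD(3)[OF y t'] by (simp add: has_real_derivative_iff_has_vector_derivative)
  then have "\<forall>\<^sub>F s in at_right t. norm (y s \<bullet> x - y t \<bullet> x - (s - t) *\<^sub>R (velocity t (y t) \<bullet> x)) \<le> \<epsilon> * (s - t)"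
    using t \<epsilon> by (intro has_vector_derivative_right_bound[of _ _ _ _ b]) auto
  then show "\<forall>\<^sub>F s in at_right t. \<bar>(y s - y t) \<bullet> x - (s - t) * (velocity t (y t) \<bullet> x)\<bar> \<le> \<epsilon> * (s - t)"
    by (simp add: inner_diff_left)
next
  obtain R where R0: "\<And>t. t \<in> {a..b} \<Longrightarrow> norm (op_apply M (y t)) \<le> R"
    and R: "\<And>s t. s \<in> {a..b} \<Longrightarrow> t \<in> {a..b} \<Longrightarrow> norm (y s - y t) \<le> R * \<bar>s - t\<bar>"
    using weak_solution_bound[OF y] by blast
  have "\<forall>\<^sub>F s in at_right t. s \<in> {t<..<b}" using t by (intro eventually_at_right_real) auto
  then have "\<forall>\<^sub>F s in at_right t. norm (y s - y t) \<le> R * (s - t)"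
  proof eventually_elim
    case (elim s)
    then show ?case using R[of s t] t by auto
  qed
  then show "\<exists>B. \<forall>\<^sub>F s in at_right t. norm (y s - y t) \<le> B * (s - t)" by blast
qed

text \<open>Restarting at \<open>s\<close> and uniqueness turn the energy bound into quasi-monotonicity in time.\<close>

lemma weak_solution_energy:
  assumes y: "weak_solution y" and st: "a \<le> s" "s \<le> t" "t \<le> b"
  shows "energy t (y t) (op_apply M (y t)) \<le> exp (growth * (t - s)) * energy s (y s) (op_apply M (y s))"
proof (cases "s < b")
  case True
  interpret sub: evolution M P S Q s b c \<Lambda> by (rule subinterval[OF st(1) True])
  have sI: "s \<in> {a..b}" using st by simp
  obtain z where z: "z s = y s" "sub.weak_solution z"
    "\<forall>t\<in>{s..b}. energy t (z t) (op_apply M (z t)) \<le> exp (growth * (t - s)) * energy s (y s) (op_apply M (y s))"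
    using sub.weak_solution_exists[OF weak_solutionD(2)[OF y sI]] by blast
  have "z t = y t"
  proof (rule sub.uniqueness[where E = "{}"])
    show "continuous_on {s..b} z" by (rule sub.weak_solution_continuous[OF z(2)])
    show "continuous_on {s..b} y"
      by (rule continuous_on_subset[OF weak_solution_continuous[OF y]]) (use st in auto)
    show "z r \<in> Domain M" if "r \<in> {s..b}" for r by (rule sub.weak_solutionD(1)[OF z(2) that])
    show "y r \<in> Domain M" if "r \<in> {s..b}" for r
      using that st by (intro weak_solutionD(1)[OF y]) auto
    show "right_weak_derivative z (velocity r (z r)) r" if "r \<in> {s..<b} - {}" for r
      using that by (intro sub.weak_solution_right_weak[OF z(2)]) auto
    show "right_weak_derivative y (velocity r (y r)) r" if "r \<in> {s..<b} - {}" for r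
      using that st by (intro weak_solution_right_weak[OF y]) auto
  qed (use z st in auto)
  moreover have "t \<in> {s..b}" using st by simp
  ultimately show ?thesis using bspec[OF z(3), of t] by simp
next
  \<comment> \<open>Restarting needs a nondegenerate interval; here s = t = b and the inequality is
    trivial.\<close>
  case False
  then have "t = s" using st by simp
  then show ?thesis by simp
qed

theorem weak_solution_differentiable:
  assumes y: "weak_solution y"
  shows "\<exists>E. countable E \<and> (\<forall>t\<in>{a..b} - E.
    (y has_vector_derivative velocity t (y t)) (at t within {a..b}) \<and>
    continuous (at t within {a..b}) (\<lambda>s. op_apply M (y s)))"
proof -
  define \<Psi> where "\<Psi> t = energy t (y t) (op_apply M (y t))" for t
  \<comment> \<open>The sign makes the rescaled energy nondecreasing, so that its discontinuities
    are countable.\<close>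
  define g where "g t = - (exp (- growth * t) * \<Psi> t)" for t
  define E where "E = {t\<in>{a..b}. \<not> continuous (at t within {a..b}) g}"
  obtain R where R: "\<And>t. t \<in> {a..b} \<Longrightarrow> norm (op_apply M (y t)) \<le> R"
    and "\<And>s t. s \<in> {a..b} \<Longrightarrow> t \<in> {a..b} \<Longrightarrow> norm (y s - y t) \<le> R * \<bar>s - t\<bar>"
    using weak_solution_bound[OF y] by blast
  have yc: "continuous_on {a..b} y" by (rule weak_solution_continuous[OF y])
  have "bounded (y ` {a..b})"
    by (intro compact_imp_bounded compact_continuous_image yc) simp
  then obtain R' where R': "\<And>t. t \<in> {a..b} \<Longrightarrow> norm (y t) \<le> R'" by (fastforce simp: bounded_iff)
  have "mono_on {a..b} g"
  proof (rule mono_onI)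
    fix s t assume st: "s \<in> {a..b}" "t \<in> {a..b}" "s \<le> t"
    have "\<Psi> t \<le> exp (growth * (t - s)) * \<Psi> s"
      unfolding \<Psi>_def using st by (intro weak_solution_energy[OF y]) auto
    then have "exp (- growth * t) * \<Psi> t \<le> exp (- growth * t) * (exp (growth * (t - s)) * \<Psi> s)"
      by (intro mult_left_mono) auto
    also have "\<dots> = exp (- growth * s) * \<Psi> s"
      by (simp add: mult.assoc[symmetric] mult_exp_exp algebra_simps)
    finally show "g s \<le> g t" by (simp add: g_def)
  qed
  then have E: "countable E" unfolding E_def by (rule mono_on_ctble_discont)
  have "(y has_vector_derivative velocity t (y t)) (at t within {a..b}) \<and>
      continuous (at t within {a..b}) (\<lambda>s. op_apply M (y s))" if tE: "t \<in> {a..b} - E" for t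
  proof -
    have t: "t \<in> {a..b}" and gc: "continuous (at t within {a..b}) g" using tE by (auto simp: E_def)
    let ?F = "at t within {a..b}"
    define w where "w s = Q s (y s) - op_apply M (y s)" for s
    have ev: "\<forall>\<^sub>F s in ?F. s \<in> {a..b}" by (simp add: eventually_at_filter)
    have lim: "(y \<longlongrightarrow> y t) ?F" "(P \<longlongrightarrow> P t) ?F" "(S \<longlongrightarrow> S t) ?F" "(Q \<longlongrightarrow> Q t) ?F"
      using yc P_cont S_cont Q_cont t by (auto simp: continuous_on_def)
    have \<Psi>: "\<Psi> s = S s (w s) \<bullet> w s + P s (y s) \<bullet> y s" for s by (simp add: \<Psi>_def energy_def w_def)
    have "((\<lambda>s. - (exp (growth * s) * g s) - P s (y s) \<bullet> y s) \<longlongrightarrow>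
        - (exp (growth * t) * g t) - P t (y t) \<bullet> y t) ?F"
      using gc by (intro tendsto_intros lim) (simp add: continuous_within)
    moreover have "- (exp (growth * s) * g s) - P s (y s) \<bullet> y s = S s (w s) \<bullet> w s" for s
    proof -
      have "- (exp (growth * s) * g s) = \<Psi> s"
        by (simp add: g_def mult.assoc[symmetric] mult_exp_exp)
      then show ?thesis by (simp add: \<Psi>)
    qed
    ultimately have Sww: "((\<lambda>s. S s (w s) \<bullet> w s) \<longlongrightarrow> S t (w t) \<bullet> w t) ?F" by simp
    have weak: "((\<lambda>s. w s \<bullet> x) \<longlongrightarrow> w t \<bullet> x) ?F" for x
      unfolding w_def
    proof (rule velocity_weak_tendsto(1)[OF weak_solutionD(2)[OF y t] t _ ev lim(1) lim(1)])
      show "((\<lambda>s. s) \<longlongrightarrow> t) ?F" by (rule tendsto_ident_at)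
      show "\<forall>\<^sub>F s in ?F. (y s, op_apply M (y s)) \<in> M \<and> norm (op_apply M (y s)) \<le> R"
        using ev by eventually_elim (use weak_solutionD(2)[OF y] R in blast)
    qed
    have wb: "\<forall>\<^sub>F s in ?F. norm (w s) \<le> \<Lambda> * R' + R"
      using ev
    proof eventually_elim
      case (elim s)
      have "norm (Q s (y s)) \<le> \<Lambda> * R'"
        using order_trans[OF norm_Q_le[OF elim] mult_left_mono[OF R'[OF elim]]] \<Lambda> by simp
      then show ?case
        using norm_triangle_ineq4[of "Q s (y s)" "op_apply M (y s)"] R[OF elim] by (simp add: w_def)
    qed
    have "((\<lambda>s. S s (w t)) \<longlongrightarrow> S t (w t)) ?F" by (intro tendsto_intros lim)
    then have cross: "((\<lambda>s. w s \<bullet> S s (w t)) \<longlongrightarrow> w t \<bullet> S t (w t)) ?F"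
      by (rule weak_strong_inner_tendsto[OF weak wb])
    \<comment> \<open>This is the form of \<open>w s - w t\<close> in the moving inner product. The
      first term converges by continuity of the energy, the cross term by weak convergence against
      the strongly convergent \<open>S s (w t)\<close>; in the limit everything cancels.\<close>
    define k where "k s = S s (w s) \<bullet> w s - 2 * (w s \<bullet> S s (w t)) + S s (w t) \<bullet> w t" for s
    have "(k \<longlongrightarrow> S t (w t) \<bullet> w t - 2 * (w t \<bullet> S t (w t)) + S t (w t) \<bullet> w t) ?F"
      unfolding k_def by (intro tendsto_intros Sww cross lim)
    then have k: "(k \<longlongrightarrow> 0) ?F" by (simp add: inner_commute)
    have "((\<lambda>s. sqrt (\<Lambda>\<^sup>2 / c * k s)) \<longlongrightarrow> sqrt (\<Lambda>\<^sup>2 / c * 0)) ?F" by (intro tendsto_intros k)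
    then have "((\<lambda>s. sqrt (\<Lambda>\<^sup>2 / c * k s)) \<longlongrightarrow> 0) ?F" by simp
    moreover have "\<forall>\<^sub>F s in ?F. norm (w s - w t) \<le> sqrt (\<Lambda>\<^sup>2 / c * k s)"
      using ev
    proof eventually_elim
      case (elim s)
      have "c / \<Lambda>\<^sup>2 * (norm (w s - w t))\<^sup>2 \<le> S s (w s - w t) \<bullet> (w s - w t)" by (rule S_coercive[OF elim])
      also have "\<dots> = k s"
        using S_sym[OF elim, of "w s" "w t"]
        by (simp add: k_def blinfun.diff_right inner_diff_left inner_diff_right inner_commute)
      finally have "(norm (w s - w t))\<^sup>2 \<le> \<Lambda>\<^sup>2 / c * k s" using c \<Lambda> by (simp add: field_simps)
      then show ?case by (rule real_le_rsqrt)
    qed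
    ultimately have "((\<lambda>s. w s - w t) \<longlongrightarrow> 0) ?F" by (rule Lim_null_comparison[rotated])
    then have wt: "(w \<longlongrightarrow> w t) ?F" by (rule LIM_zero_cancel)
    have "((\<lambda>s. S s (w s)) \<longlongrightarrow> S t (w t)) ?F" by (intro tendsto_intros lim wt)
    then have "continuous ?F (\<lambda>s. velocity s (y s))"
      by (simp add: continuous_within velocity_def w_def)
    then have "(y has_vector_derivative velocity t (y t)) ?F"
      by (intro weak_derivative_imp_has_vector_derivative[of a b y "\<lambda>s. velocity s (y s)"]
          weak_solutionD(3)[OF y] t)
    moreover have "((\<lambda>s. Q s (y s) - w s) \<longlongrightarrow> Q t (y t) - w t) ?F" by (intro tendsto_intros lim wt)
    then have "continuous ?F (\<lambda>s. op_apply M (y s))" by (simp add: continuous_within w_def)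
    ultimately show ?thesis by blast
  qed
  then show ?thesis using E by blast
qed

end

section \<open>From compact intervals to the half-line\<close>

text \<open>Continuity of the velocity is left out, so that uniqueness covers a larger class than
  existence provides. The velocity is written out because the set of times may be a half-line,
  outside the scope of \<open>evolution\<close>.\<close>

definition strong_solution ::
    "('a::real_inner \<times> 'a) set \<Rightarrow> (real \<Rightarrow> 'a \<Rightarrow>\<^sub>L 'a) \<Rightarrow> (real \<Rightarrow> 'a \<Rightarrow>\<^sub>L 'a) \<Rightarrow> real set \<Rightarrow> (real \<Rightarrow> 'a) \<Rightarrow> bool"
  where "strong_solution M S Q X y \<longleftrightarrow> continuous_on X y \<and> (\<forall>t\<in>X. y t \<in> Domain M) \<and>
    (\<exists>E. countable E \<and> (\<forall>t\<in>X - E.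
      (y has_vector_derivative S t (Q t (y t) - op_apply M (y t))) (at t within X)))"

lemma strong_solution_subset:
  assumes "strong_solution M S Q X y" "Y \<subseteq> X"
  shows "strong_solution M S Q Y y"
proof -
  obtain E where "countable E" "\<And>t. t \<in> X - E \<Longrightarrow>
      (y has_vector_derivative S t (Q t (y t) - op_apply M (y t))) (at t within X)"
    using assms(1) unfolding strong_solution_def by blast
  moreover have "continuous_on Y y" "\<forall>t\<in>Y. y t \<in> Domain M"
    using assms continuous_on_subset unfolding strong_solution_def by blast+
  ultimately show ?thesis
    unfolding strong_solution_def using assms(2)
    by (meson DiffE DiffI has_vector_derivative_within_subset subset_iff)
qed

lemma (in evolution) strong_solution_unique:
  assumes y: "strong_solution M S Q {a..b} y" and z: "strong_solution M S Q {a..b} z"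
    and init: "y a = z a" and t: "t \<in> {a..b}"
  shows "y t = z t"
proof -
  obtain E where E: "countable E" "\<And>t. t \<in> {a..b} - E \<Longrightarrow>
      (y has_vector_derivative velocity t (y t)) (at t within {a..b})"
    using y unfolding strong_solution_def velocity_def by blast
  obtain E' where E': "countable E'" "\<And>t. t \<in> {a..b} - E' \<Longrightarrow>
      (z has_vector_derivative velocity t (z t)) (at t within {a..b})"
    using z unfolding strong_solution_def velocity_def by blast
  show ?thesis
  proof (rule uniqueness[where E = "E \<union> E'"])
    show "right_weak_derivative y (velocity s (y s)) s" if "s \<in> {a..<b} - (E \<union> E')" for s
      using that by (intro has_vector_derivative_right_weak[OF E(2), of _ b]) auto
    show "right_weak_derivative z (velocity s (z s)) s" if "s \<in> {a..<b} - (E \<union> E')" for s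
      using that by (intro has_vector_derivative_right_weak[OF E'(2), of _ b]) auto
  qed (use y z E(1) E'(1) init t in \<open>auto simp: strong_solution_def\<close>)
qed

lemma at_within_Icc_eq_halfline:
  fixes t T :: real
  assumes "0 \<le> t" "t < T"
  shows "at t within {0..T} = at t within {0..}"
  by (rule at_within_nhd[where S = "{..<T}"]) (use assms in auto)

lemma strong_solution_halfline_unique:
  fixes M :: "('a::{real_inner,complete_space} \<times> 'a) set"
  assumes ev: "\<And>T. T > 0 \<Longrightarrow> \<exists>c \<Lambda>. evolution M P S Q 0 T c \<Lambda>"
    and y: "strong_solution M S Q {0..} y" and z: "strong_solution M S Q {0..} z"
    and init: "y 0 = z 0" and t: "t \<ge> 0"
  shows "y t = z t"
proof -
  obtain c \<Lambda> where "evolution M P S Q 0 (t + 1) c \<Lambda>" using ev[of "t + 1"] t by auto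
  then interpret evolution M P S Q 0 "t + 1" c \<Lambda> .
  show ?thesis
    by (rule strong_solution_unique) (use y z init t in \<open>auto intro: strong_solution_subset\<close>)
qed

text \<open>The constants may degenerate as T grows, so solutions are built on each [0, T] and
  glued; uniqueness makes them agree on overlaps.\<close>

theorem strong_solution_halfline_exists:
  fixes M :: "('a::{real_inner,complete_space} \<times> 'a) set"
  assumes ev: "\<And>T. T > 0 \<Longrightarrow> \<exists>c \<Lambda>. evolution M P S Q 0 T c \<Lambda>" and x0: "x0 \<in> Domain M"
  shows "\<exists>y E. y 0 = x0 \<and> strong_solution M S Q {0..} y \<and> countable E \<and> (\<forall>t\<in>{0..} - E.
      (y has_vector_derivative S t (Q t (y t) - op_apply M (y t))) (at t within {0..}) \<and>
      continuous (at t within {0..}) (\<lambda>s. op_apply M (y s)))"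
proof -
  obtain p0 where p0: "(x0, p0) \<in> M" using x0 by blast
  define sol where "sol T y E \<longleftrightarrow>
      y 0 = x0 \<and> continuous_on {0..T} y \<and> (\<forall>t\<in>{0..T}. y t \<in> Domain M) \<and> countable E \<and>
      (\<forall>t\<in>{0..T} - E. (y has_vector_derivative S t (Q t (y t) - op_apply M (y t))) (at t within {0..T}) \<and>
      continuous (at t within {0..T}) (\<lambda>s. op_apply M (y s)))" for T y E
  have "\<exists>y E. sol T y E" if T: "T > 0" for T
  proof -
    obtain c \<Lambda> where "evolution M P S Q 0 T c \<Lambda>" using ev[OF T] by blast
    then interpret evolution M P S Q 0 T c \<Lambda> .
    obtain y where y: "y 0 = x0" "weak_solution y" using weak_solution_exists[OF p0] by blast
    obtain E where E: "countable E" "\<forall>t\<in>{0..T} - E. (y has_vector_derivative velocity t (y t)) (at t within {0..T}) \<and>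
        continuous (at t within {0..T}) (\<lambda>s. op_apply M (y s))"
      using weak_solution_differentiable[OF y(2)] by blast
    have "sol T y E" unfolding sol_def
      by (intro conjI y(1) weak_solution_continuous[OF y(2)] E(1) E(2)[unfolded velocity_def]
          ballI[of "{0..T}" "\<lambda>t. y t \<in> Domain M"] weak_solutionD(1)[OF y(2)])
    then show ?thesis by blast
  qed
  then obtain Y E where YE: "\<And>T. T > 0 \<Longrightarrow> sol T (Y T) (E T)" by metis
  have Y0: "\<And>T. T > 0 \<Longrightarrow> Y T 0 = x0"
    and Yc: "\<And>T. T > 0 \<Longrightarrow> continuous_on {0..T} (Y T)"
    and Yd: "\<And>T t. T > 0 \<Longrightarrow> t \<in> {0..T} \<Longrightarrow> Y T t \<in> Domain M"
    and E: "\<And>T. T > 0 \<Longrightarrow> countable (E T)"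
    and Yder: "\<And>T t. T > 0 \<Longrightarrow> t \<in> {0..T} - E T \<Longrightarrow>
      (Y T has_vector_derivative S t (Q t (Y T t) - op_apply M (Y T t))) (at t within {0..T}) \<and>
      continuous (at t within {0..T}) (\<lambda>s. op_apply M (Y T s))"
    using YE unfolding sol_def by blast+
  have Ys: "strong_solution M S Q {0..T} (Y T)" if "T > 0" for T
    unfolding strong_solution_def using Yc[OF that] Yd[OF that] E[OF that] Yder[OF that] by blast
  have agree: "Y T t = Y T' t" if T: "T > 0" "T' > 0" "t \<in> {0..T}" "t \<in> {0..T'}" for T T' t
  proof -
    have pos: "min T T' > 0" using T by simp
    obtain c \<Lambda> where "evolution M P S Q 0 (min T T') c \<Lambda>" using ev[OF pos] by blast
    then interpret evolution M P S Q 0 "min T T'" c \<Lambda> .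
    show ?thesis
    proof (rule strong_solution_unique)
      show "strong_solution M S Q {0..min T T'} (Y T)" "strong_solution M S Q {0..min T T'} (Y T')"
        using Ys[OF T(1)] Ys[OF T(2)] by (auto intro: strong_solution_subset)
    qed (use Y0 T in auto)
  qed
  \<comment> \<open>The extra unit keeps t away from the right end, where derivatives within [0, T]
    and within the half-line would differ.\<close>
  define y where "y t = Y (t + 1) t" for t
  have yY: "y t = Y T t" if "T > 0" "t \<in> {0..T}" for T t
    unfolding y_def using that by (intro agree) auto
  have yc: "continuous_on {0..} y"
    unfolding continuous_on_eq_continuous_within
  proof
    fix t :: real assume t: "t \<in> {0..}"
    have "continuous_on {0..t + 1} y \<longleftrightarrow> continuous_on {0..t + 1} (Y (t + 1))"
      using t by (intro continuous_on_cong yY) auto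
    then have "continuous_on {0..t + 1} y" using Yc[of "t + 1"] t by simp
    then have "continuous (at t within {0..t + 1}) y"
      using t by (auto simp: continuous_on_eq_continuous_within)
    then show "continuous (at t within {0..}) y" using t by (simp add: at_within_Icc_eq_halfline)
  qed
  \<comment> \<open>Only integer lengths contribute exceptional sets, so their union is countable;
    each t lies strictly inside one of these intervals or at 0.\<close>
  define F where "F = (\<Union>n::nat. E (real n + 1))"
  have F: "countable F" unfolding F_def by (intro countable_UN E) auto
  have der: "(y has_vector_derivative S t (Q t (y t) - op_apply M (y t))) (at t within {0..}) \<and>
      continuous (at t within {0..}) (\<lambda>s. op_apply M (y s))" if t: "t \<in> {0..} - F" for t
  proof -
    define T where "T = real (nat \<lceil>t\<rceil>) + 1"
    have "t < T" unfolding T_def using real_nat_ceiling_ge[of t] by linarith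
    moreover have "t \<notin> E T" using t unfolding T_def F_def by blast
    ultimately have T: "T > 0" "t < T" "t \<in> {0..T}" "t \<notin> E T" using t by auto
    have tI: "t \<in> {0..T} - E T" using T by simp
    note d = Yder[OF T(1) tI]
    have "(y has_vector_derivative S t (Q t (Y T t) - op_apply M (Y T t))) (at t within {0..T})"
      using conjunct1[OF d] by (rule has_vector_derivative_transform[OF T(3) yY[OF T(1)], rotated])
    moreover have "continuous (at t within {0..T}) (\<lambda>s. op_apply M (y s))"
      using conjunct2[OF d] T(3)
      by (rule continuous_transform_within[OF _ zero_less_one]) (simp add: yY[OF T(1)])
    ultimately show ?thesis
      using T t by (simp add: at_within_Icc_eq_halfline yY[OF T(1,3)])
  qed
  have dom: "y t \<in> Domain M" if "t \<ge> 0" for t unfolding y_def using that by (intro Yd) auto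
  have "strong_solution M S Q {0..} y"
    unfolding strong_solution_def using yc dom F der by (meson atLeast_iff)
  moreover have "y 0 = x0" by (simp add: y_def Y0)
  ultimately show ?thesis using F der by blast
qed

section \<open>Lipschitz families of operators\<close>

definition bounded_lipschitz_on :: "real set \<Rightarrow> (real \<Rightarrow> 'b::real_normed_vector) \<Rightarrow> bool"
  where "bounded_lipschitz_on X f \<longleftrightarrow>
    (\<exists>K. \<forall>t\<in>X. norm (f t) \<le> K \<and> (\<forall>s\<in>X. norm (f s - f t) \<le> K * \<bar>s - t\<bar>))"

lemma bounded_lipschitz_onI:
  assumes "\<And>t. t \<in> X \<Longrightarrow> norm (f t) \<le> K" "\<And>s t. s \<in> X \<Longrightarrow> t \<in> X \<Longrightarrow> norm (f s - f t) \<le> L * \<bar>s - t\<bar>"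
  shows "bounded_lipschitz_on X f"
proof -
  have "norm (f t) \<le> max K L \<and> (\<forall>s\<in>X. norm (f s - f t) \<le> max K L * \<bar>s - t\<bar>)" if t: "t \<in> X" for t
  proof (intro conjI ballI)
    show "norm (f t) \<le> max K L" using assms(1)[OF t] by linarith
    show "norm (f s - f t) \<le> max K L * \<bar>s - t\<bar>" if s: "s \<in> X" for s
      by (rule order_trans[OF assms(2)[OF s t]]) (simp add: mult_right_mono)
  qed
  then show ?thesis unfolding bounded_lipschitz_on_def by blast
qed

lemma bounded_lipschitz_onE:
  assumes "bounded_lipschitz_on X f"
  obtains K where "K > 0" "\<And>t. t \<in> X \<Longrightarrow> norm (f t) \<le> K"
    "\<And>s t. s \<in> X \<Longrightarrow> t \<in> X \<Longrightarrow> norm (f s - f t) \<le> K * \<bar>s - t\<bar>"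
proof -
  obtain K where K: "\<And>t. t \<in> X \<Longrightarrow> norm (f t) \<le> K"
    "\<And>s t. s \<in> X \<Longrightarrow> t \<in> X \<Longrightarrow> norm (f s - f t) \<le> K * \<bar>s - t\<bar>"
    using assms unfolding bounded_lipschitz_on_def by blast
  show thesis
  proof (rule that[of "\<bar>K\<bar> + 1"])
    show "norm (f t) \<le> \<bar>K\<bar> + 1" if "t \<in> X" for t using K(1)[OF that] by linarith
    show "norm (f s - f t) \<le> (\<bar>K\<bar> + 1) * \<bar>s - t\<bar>" if "s \<in> X" "t \<in> X" for s t
      by (rule order_trans[OF K(2)[OF that]]) (intro mult_right_mono, auto)
  qed simp
qed

lemma bounded_lipschitz_on_const: "bounded_lipschitz_on X (\<lambda>_. k)"
  by (rule bounded_lipschitz_onI[of _ _ "norm k" 0]) auto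

lemma bounded_lipschitz_on_add:
  assumes "bounded_lipschitz_on X f" "bounded_lipschitz_on X h"
  shows "bounded_lipschitz_on X (\<lambda>t. f t + h t)"
proof -
  obtain K where K: "K > 0" "\<And>t. t \<in> X \<Longrightarrow> norm (f t) \<le> K"
    "\<And>s t. s \<in> X \<Longrightarrow> t \<in> X \<Longrightarrow> norm (f s - f t) \<le> K * \<bar>s - t\<bar>"
    using bounded_lipschitz_onE[OF assms(1)] by blast
  obtain L where L: "L > 0" "\<And>t. t \<in> X \<Longrightarrow> norm (h t) \<le> L"
    "\<And>s t. s \<in> X \<Longrightarrow> t \<in> X \<Longrightarrow> norm (h s - h t) \<le> L * \<bar>s - t\<bar>"
    using bounded_lipschitz_onE[OF assms(2)] by blast
  show ?thesis
  proof (rule bounded_lipschitz_onI)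
    show "norm (f t + h t) \<le> K + L" if "t \<in> X" for t
      using norm_triangle_ineq[of "f t" "h t"] K(2)[OF that] L(2)[OF that] by linarith
    show "norm (f s + h s - (f t + h t)) \<le> (K + L) * \<bar>s - t\<bar>" if "s \<in> X" "t \<in> X" for s t
    proof -
      have "norm (f s + h s - (f t + h t)) = norm ((f s - f t) + (h s - h t))" by (simp add: algebra_simps)
      then show ?thesis
        using norm_triangle_ineq[of "f s - f t" "h s - h t"] K(3)[OF that] L(3)[OF that]
        by (simp add: distrib_right)
    qed
  qed
qed

lemma bounded_lipschitz_on_compose:
  assumes "bounded_lipschitz_on X f" "bounded_lipschitz_on X h"
  shows "bounded_lipschitz_on X (\<lambda>t. f t o\<^sub>L h t)"
proof -
  obtain K where K: "K > 0" "\<And>t. t \<in> X \<Longrightarrow> norm (f t) \<le> K"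
    "\<And>s t. s \<in> X \<Longrightarrow> t \<in> X \<Longrightarrow> norm (f s - f t) \<le> K * \<bar>s - t\<bar>"
    using bounded_lipschitz_onE[OF assms(1)] by blast
  obtain L where L: "L > 0" "\<And>t. t \<in> X \<Longrightarrow> norm (h t) \<le> L"
    "\<And>s t. s \<in> X \<Longrightarrow> t \<in> X \<Longrightarrow> norm (h s - h t) \<le> L * \<bar>s - t\<bar>"
    using bounded_lipschitz_onE[OF assms(2)] by blast
  show ?thesis
  proof (rule bounded_lipschitz_onI)
    show "norm (f t o\<^sub>L h t) \<le> K * L" if t: "t \<in> X" for t
      by (rule order_trans[OF norm_blinfun_compose mult_mono[OF K(2)[OF t] L(2)[OF t]]])
        (use K(1) in auto)
    show "norm ((f s o\<^sub>L h s) - (f t o\<^sub>L h t)) \<le> (2 * K * L) * \<bar>s - t\<bar>" if st: "s \<in> X" "t \<in> X" for s t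
    proof -
      have "(f s o\<^sub>L h s) - (f t o\<^sub>L h t) = (f s o\<^sub>L (h s - h t)) + ((f s - f t) o\<^sub>L h t)"
        by (rule blinfun_eqI) (simp add: blinfun.diff_left blinfun.diff_right blinfun.add_left)
      then have "norm ((f s o\<^sub>L h s) - (f t o\<^sub>L h t)) \<le> norm (f s o\<^sub>L (h s - h t)) + norm ((f s - f t) o\<^sub>L h t)"
        by (simp add: norm_triangle_ineq)
      also have "\<dots> \<le> K * (L * \<bar>s - t\<bar>) + (K * \<bar>s - t\<bar>) * L"
        using K(1) L(1)
        by (intro add_mono order_trans[OF norm_blinfun_compose] mult_mono K(2,3) L(2,3) st) auto
      finally show ?thesis by (simp add: algebra_simps)
    qed
  qed
qed

text \<open>The resolvent identity R' - R = R' (D - D') R, with a right inverse of D and a left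
  inverse of D'.\<close>

lemma blinfun_inverse_bound:
  assumes "D o\<^sub>L R = id_blinfun" "R' o\<^sub>L D' = id_blinfun"
  shows "norm (R' - R) \<le> norm R' * (norm (D - D') * norm R)"
proof -
  have "R' - R = R' o\<^sub>L ((D - D') o\<^sub>L R)"
  proof (rule blinfun_eqI)
    fix x
    have "D (R x) = x" "R' (D' (R x)) = R x"
      using assms by (metis blinfun_apply_blinfun_compose blinfun_apply_id_blinfun id_apply)+
    then show "(R' - R) x = (R' o\<^sub>L ((D - D') o\<^sub>L R)) x"
      by (simp add: blinfun.diff_left blinfun.diff_right)
  qed
  then show ?thesis
    using order_trans[OF norm_blinfun_compose mult_left_mono[OF norm_blinfun_compose norm_ge_zero]]
    by simp
qed

text \<open>No bound on the inverses near t is given in advance. Once |D t - D s| |R t| < 1/2, the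
  resolvent identity bounds |R s - R t| by half of |R s|, so |R s| \<le> 2 |R t|.\<close>

lemma continuous_on_blinfun_inverse:
  assumes D: "continuous_on X D"
    and R: "\<And>t. t \<in> X \<Longrightarrow> D t o\<^sub>L R t = id_blinfun" "\<And>t. t \<in> X \<Longrightarrow> R t o\<^sub>L D t = id_blinfun"
  shows "continuous_on X R"
  unfolding continuous_on_def
proof
  fix t assume t: "t \<in> X"
  let ?F = "at t within X"
  have Dt: "(D \<longlongrightarrow> D t) ?F" using D t by (simp add: continuous_on_def)
  have "((\<lambda>s. norm (D t - D s) * norm (R t)) \<longlongrightarrow> norm (D t - D t) * norm (R t)) ?F"
    by (intro tendsto_intros Dt)
  then have z: "((\<lambda>s. norm (D t - D s) * norm (R t)) \<longlongrightarrow> 0) ?F" by simp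
  then have "\<forall>\<^sub>F s in ?F. norm (D t - D s) * norm (R t) < 1 / 2" by (rule order_tendstoD) simp
  moreover have "\<forall>\<^sub>F s in ?F. s \<in> X" by (simp add: eventually_at_filter)
  ultimately have "\<forall>\<^sub>F s in ?F. norm (R s - R t) \<le> 2 * norm (R t) * (norm (D t - D s) * norm (R t))"
  proof eventually_elim
    case (elim s)
    have b: "norm (R s - R t) \<le> norm (R s) * (norm (D t - D s) * norm (R t))"
      by (rule blinfun_inverse_bound[OF R(1)[OF t] R(2)[OF elim(2)]])
    also have "\<dots> \<le> norm (R s) * (1 / 2)" using elim by (intro mult_left_mono) auto
    finally have "norm (R s) \<le> 2 * norm (R t)"
      using norm_triangle_ineq2[of "R s" "R t"] by linarith
    then show ?case by (rule order_trans[OF b mult_right_mono]) simp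
  qed
  moreover have "((\<lambda>s. 2 * norm (R t) * (norm (D t - D s) * norm (R t))) \<longlongrightarrow> 2 * norm (R t) * 0) ?F"
    by (intro tendsto_intros z)
  then have "((\<lambda>s. 2 * norm (R t) * (norm (D t - D s) * norm (R t))) \<longlongrightarrow> 0) ?F" by simp
  ultimately have "((\<lambda>s. R s - R t) \<longlongrightarrow> 0) ?F" by (rule Lim_null_comparison)
  then show "(R \<longlongrightarrow> R t) ?F" by (rule LIM_zero_cancel)
qed

text \<open>Continuity on a compact set bounds the inverses; the resolvent identity then transfers
  the Lipschitz estimate.\<close>

lemma bounded_lipschitz_on_inverse:
  assumes D: "bounded_lipschitz_on X D" and X: "compact X"
    and R: "\<And>t. t \<in> X \<Longrightarrow> D t o\<^sub>L R t = id_blinfun" "\<And>t. t \<in> X \<Longrightarrow> R t o\<^sub>L D t = id_blinfun"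
  shows "bounded_lipschitz_on X R"
proof -
  obtain K where K: "K > 0" "\<And>t. t \<in> X \<Longrightarrow> norm (D t) \<le> K"
    "\<And>s t. s \<in> X \<Longrightarrow> t \<in> X \<Longrightarrow> norm (D s - D t) \<le> K * \<bar>s - t\<bar>"
    using bounded_lipschitz_onE[OF D] by blast
  have "K-lipschitz_on X D" using K(1,3) by (intro lipschitz_onI) (auto simp: dist_norm)
  then have "continuous_on X R"
    by (intro continuous_on_blinfun_inverse[OF lipschitz_on_continuous_on R])
  then have "bounded (R ` X)" using X by (intro compact_imp_bounded compact_continuous_image)
  then obtain L where L: "\<And>t. t \<in> X \<Longrightarrow> norm (R t) \<le> L" by (fastforce simp: bounded_iff)
  show ?thesis
  proof (rule bounded_lipschitz_onI[OF L])
    fix s t assume st: "s \<in> X" "t \<in> X"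
    have L0: "L \<ge> 0" using order_trans[OF norm_ge_zero L[OF st(1)]] .
    have "norm (R s - R t) \<le> norm (R s) * (norm (D t - D s) * norm (R t))"
      by (rule blinfun_inverse_bound[OF R(1)[OF st(2)] R(2)[OF st(1)]])
    also have "\<dots> \<le> L * ((K * \<bar>t - s\<bar>) * L)"
      using K(1) L0 by (intro mult_mono L K(3) st) auto
    finally show "norm (R s - R t) \<le> (L * K * L) * \<bar>s - t\<bar>" by (simp add: abs_minus_commute mult_ac)
  qed
qed

lemma bounded_lipschitz_on_lipschitz:
  assumes "L-lipschitz_on {a..b::real} f"
  shows "bounded_lipschitz_on {a..b} f"
proof -
  have "bounded (f ` {a..b})"
    by (intro compact_imp_bounded compact_continuous_image lipschitz_on_continuous_on[OF assms]) simp
  then obtain K where K: "\<And>t. t \<in> {a..b} \<Longrightarrow> norm (f t) \<le> K" by (fastforce simp: bounded_iff)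
  show ?thesis
    by (rule bounded_lipschitz_onI[OF K]) (use lipschitz_onD[OF assms] in \<open>auto simp: dist_norm\<close>)
qed

lemma bounded_lipschitz_on_C1:
  assumes "\<And>t. t \<in> {a..b::real} \<Longrightarrow> (f has_vector_derivative f' t) (at t within {a..b})"
    and c: "continuous_on {a..b} f'"
  shows "bounded_lipschitz_on {a..b} f"
proof -
  have "bounded (f' ` {a..b})" by (intro compact_imp_bounded compact_continuous_image c) simp
  then obtain K where K: "\<And>t. t \<in> {a..b} \<Longrightarrow> norm (f' t) \<le> K" by (fastforce simp: bounded_iff)
  have "bounded (f ` {a..b})"
    by (intro compact_imp_bounded compact_continuous_image has_vector_derivative_Icc_continuous_on[OF assms(1)]) simp_all
  then obtain L where L: "\<And>t. t \<in> {a..b} \<Longrightarrow> norm (f t) \<le> L" by (fastforce simp: bounded_iff)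
  show ?thesis
  proof (rule bounded_lipschitz_onI[OF L])
    fix s t assume st: "s \<in> {a..b}" "t \<in> {a..b}"
    have "norm (f s - f t) \<le> K * norm (s - t)"
    proof (rule differentiable_bound[where S = "{a..b}" and f' = "\<lambda>r h. h *\<^sub>R f' r"])
      fix r assume r: "r \<in> {a..b}"
      show "(f has_derivative (\<lambda>h. h *\<^sub>R f' r)) (at r within {a..b})"
        using assms(1)[OF r] by (simp add: has_vector_derivative_def)
      show "onorm (\<lambda>h. h *\<^sub>R f' r) \<le> K"
        using K[OF r] by (intro onorm_le) (simp add: mult.commute[of K] mult_left_mono)
    qed (use st in auto)
    then show "norm (f s - f t) \<le> K * \<bar>s - t\<bar>" by simp
  qed
qed

section \<open>Differentiation through a family of inverses\<close>

text \<open>Where f vanishes, increments of R meet a factor of first order, so continuity of R at t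
  suffices for the product rule.\<close>

lemma has_vector_derivative_blinfun_apply_zero:
  assumes f: "(f has_vector_derivative f') (at t within X)" and f0: "f t = 0"
    and R: "(R \<longlongrightarrow> R t) (at t within X)"
  shows "((\<lambda>s. blinfun_apply (R s) (f s)) has_vector_derivative R t f') (at t within X)"
  unfolding has_vector_derivative_def has_derivative_within
proof (intro conjI bounded_linear_scaleR_left)
  define q where "q s = (1 / norm (s - t)) *\<^sub>R (f s - (f t + (s - t) *\<^sub>R f'))" for s
  have q: "(q \<longlongrightarrow> 0) (at t within X)"
    using f unfolding has_vector_derivative_def has_derivative_within q_def by blast
  have ev: "\<forall>\<^sub>F s in at t within X. norm ((1 / norm (s - t)) *\<^sub>R (R s (f s) - (R t (f t) + (s - t) *\<^sub>R R t f'))) \<le>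
      norm (R s) * norm (q s) + norm (R s - R t) * norm f'"
    unfolding eventually_at_filter
  proof (rule always_eventually, intro allI impI)
    fix s assume "s \<noteq> t"
    have "(1 / norm (s - t)) *\<^sub>R (R s (f s) - (R t (f t) + (s - t) *\<^sub>R R t f')) =
        R s (q s) + ((1 / norm (s - t)) * (s - t)) *\<^sub>R (R s - R t) f'"
      by (simp add: q_def f0 blinfun.diff_left blinfun.diff_right blinfun.scaleR_right
          blinfun.zero_right scaleR_diff_right)
    also have "norm \<dots> \<le> norm (R s (q s)) + norm (((1 / norm (s - t)) * (s - t)) *\<^sub>R (R s - R t) f')"
      by (rule norm_triangle_ineq)
    also have "norm (((1 / norm (s - t)) * (s - t)) *\<^sub>R (R s - R t) f') = norm ((R s - R t) f')"
      using \<open>s \<noteq> t\<close> by simp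
    finally show "norm ((1 / norm (s - t)) *\<^sub>R (R s (f s) - (R t (f t) + (s - t) *\<^sub>R R t f'))) \<le>
        norm (R s) * norm (q s) + norm (R s - R t) * norm f'"
      using norm_blinfun[of "R s" "q s"] norm_blinfun[of "R s - R t" f'] by linarith
  qed
  have "((\<lambda>s. norm (R s) * norm (q s) + norm (R s - R t) * norm f') \<longlongrightarrow>
      norm (R t) * norm (0::'a) + norm (R t - R t) * norm f') (at t within X)"
    by (intro tendsto_intros R q)
  then have "((\<lambda>s. norm (R s) * norm (q s) + norm (R s - R t) * norm f') \<longlongrightarrow> 0) (at t within X)" by simp
  with ev show "((\<lambda>s. (1 / norm (s - t)) *\<^sub>R (R s (f s) - (R t (f t) + (s - t) *\<^sub>R R t f'))) \<longlongrightarrow> 0) (at t within X)"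
    by (rule Lim_null_comparison)
qed

text \<open>Subtracting \<open>D s (R t (y t))\<close> from \<open>y s\<close> produces a function
  vanishing at t whose image under \<open>R s\<close> is \<open>R s (y s) - R t (y t)\<close>. The
  rule follows without differentiating R.\<close>

lemma has_vector_derivative_blinfun_inverse_apply:
  fixes D R :: "real \<Rightarrow> 'a::real_normed_vector \<Rightarrow>\<^sub>L 'a"
  assumes D: "(D has_vector_derivative D') (at t within X)" and y: "(y has_vector_derivative y') (at t within X)"
    and R: "(R \<longlongrightarrow> R t) (at t within X)" and t: "t \<in> X"
    and inv: "\<And>s. s \<in> X \<Longrightarrow> D s o\<^sub>L R s = id_blinfun" "\<And>s. s \<in> X \<Longrightarrow> R s o\<^sub>L D s = id_blinfun"
  shows "((\<lambda>s. blinfun_apply (R s) (y s)) has_vector_derivative R t (y' - D' (R t (y t)))) (at t within X)"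
proof -
  have inv': "D s (R s x) = x" "R s (D s x) = x" if "s \<in> X" for s x
    using inv[OF that] by (metis blinfun_apply_blinfun_compose blinfun_apply_id_blinfun id_apply)+
  have "((\<lambda>s. D s (R t (y t))) has_vector_derivative D' (R t (y t))) (at t within X)"
    using blinfun.has_vector_derivative[OF D has_vector_derivative_const, of "R t (y t)"]
    by (simp add: blinfun.zero_right)
  then have "((\<lambda>s. y s - D s (R t (y t))) has_vector_derivative y' - D' (R t (y t))) (at t within X)"
    by (intro derivative_intros y)
  from has_vector_derivative_blinfun_apply_zero[OF this _ R]
  have "((\<lambda>s. R s (y s - D s (R t (y t)))) has_vector_derivative R t (y' - D' (R t (y t)))) (at t within X)"
    by (simp add: inv'[OF t])
  then have "((\<lambda>s. R t (y t) + R s (y s - D s (R t (y t)))) has_vector_derivative R t (y' - D' (R t (y t)))) (at t within X)"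
    using has_vector_derivative_add[OF has_vector_derivative_const[of "R t (y t)"]] by fastforce
  then show ?thesis
    by (rule has_vector_derivative_transform[OF t, rotated]) (simp add: blinfun.diff_right inv')
qed

lemma evolution_exists:
  fixes P S Q :: "real \<Rightarrow> 'a::{real_inner,complete_space} \<Rightarrow>\<^sub>L 'a"
  assumes M: "maximal_monotone M" "single_valued M" and T: "T > 0" and c: "c > 0"
    and lip: "bounded_lipschitz_on {0..T} P" "bounded_lipschitz_on {0..T} S" "bounded_lipschitz_on {0..T} Q"
    and P: "\<And>t x y. t \<in> {0..T} \<Longrightarrow> P t x \<bullet> y = x \<bullet> P t y"
      "\<And>t x. t \<in> {0..T} \<Longrightarrow> P t (S t x) = x" "\<And>t x. t \<in> {0..T} \<Longrightarrow> S t (P t x) = x"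
      "\<And>t x. t \<in> {0..T} \<Longrightarrow> P t x \<bullet> x \<ge> c * (norm x)\<^sup>2"
  shows "\<exists>c \<Lambda>. evolution M P S Q 0 T c \<Lambda>"
proof -
  obtain K1 where K1: "K1 > 0" "\<And>t. t \<in> {0..T} \<Longrightarrow> norm (P t) \<le> K1"
    "\<And>s t. s \<in> {0..T} \<Longrightarrow> t \<in> {0..T} \<Longrightarrow> norm (P s - P t) \<le> K1 * \<bar>s - t\<bar>"
    using bounded_lipschitz_onE[OF lip(1)] by blast
  obtain K2 where K2: "K2 > 0" "\<And>t. t \<in> {0..T} \<Longrightarrow> norm (S t) \<le> K2"
    "\<And>s t. s \<in> {0..T} \<Longrightarrow> t \<in> {0..T} \<Longrightarrow> norm (S s - S t) \<le> K2 * \<bar>s - t\<bar>"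
    using bounded_lipschitz_onE[OF lip(2)] by blast
  obtain K3 where K3: "K3 > 0" "\<And>t. t \<in> {0..T} \<Longrightarrow> norm (Q t) \<le> K3"
    "\<And>s t. s \<in> {0..T} \<Longrightarrow> t \<in> {0..T} \<Longrightarrow> norm (Q s - Q t) \<le> K3 * \<bar>s - t\<bar>"
    using bounded_lipschitz_onE[OF lip(3)] by blast
  define \<Lambda> where "\<Lambda> = K1 + K2 + K3"
  have le: "K1 \<le> \<Lambda>" "K2 \<le> \<Lambda>" "K3 \<le> \<Lambda>" using K1(1) K2(1) K3(1) by (auto simp: \<Lambda>_def)
  have le': "K * \<bar>s - t\<bar> \<le> \<Lambda> * \<bar>s - t\<bar>" if "K \<le> \<Lambda>" for K s t :: real
    using that by (intro mult_right_mono) auto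
  have "evolution M P S Q 0 T c \<Lambda>"
  proof
    show "\<Lambda> > 0" using K1(1) le(1) by linarith
  qed (fact M T c P | rule order_trans[OF K1(2) le(1)] order_trans[OF K2(2) le(2)]
      order_trans[OF K3(2) le(3)] order_trans[OF K1(3) le'[OF le(1)]]
      order_trans[OF K2(3) le'[OF le(2)]] order_trans[OF K3(3) le'[OF le(3)]]; assumption)+
  then show ?thesis by blast
qed

section \<open>The change of variables between the two problems\<close>

theorem theorem3p3:
  fixes \<iota> :: "'v :: {real_inner, complete_space} \<Rightarrow>\<^sub>L 'h :: {real_inner, complete_space}"
    and J :: nat
    and N :: "nat \<Rightarrow> nat"
    and \<mu> :: "nat \<Rightarrow> 'x measure"
    and d :: "nat \<Rightarrow> 'x \<Rightarrow> 'x \<Rightarrow> real"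
    and U :: "nat \<Rightarrow> ('x \<Rightarrow> nat \<Rightarrow> real) set"
    and I\<^sub>U :: "'v \<Rightarrow> nat \<Rightarrow> 'x \<Rightarrow> nat \<Rightarrow> real"
    and g :: "nat \<Rightarrow> (nat \<Rightarrow> real) \<Rightarrow> (nat \<Rightarrow> real)"
    and \<alpha> \<alpha>' :: "real \<Rightarrow> real"
    and A\<^sub>1 :: "'v \<Rightarrow>\<^sub>L ('v \<Rightarrow>\<^sub>L real)"
    and B\<^sub>1 :: "'v \<Rightarrow> ('v \<Rightarrow>\<^sub>L real)"
    and A\<^sub>1B\<^sub>1 :: "('h \<times> 'h) set"
    and A\<^sub>B :: "real \<Rightarrow> ('h \<times> 'h) set"
    and D D' D\<^sub>t :: "real \<Rightarrow> 'h \<Rightarrow>\<^sub>L 'h"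
  assumes setting: "control_setting \<iota> J N \<mu> d U I\<^sub>U g"
    and \<alpha>_pos: "\<And>t. t \<ge> 0 \<Longrightarrow> \<alpha> t > 0"
    and \<alpha>_C1: "C1_halfline \<alpha> \<alpha>'"
    and \<alpha>'_lip: "locally_Lipschitz_halfline \<alpha>'"
    and A\<^sub>1_skew: "\<And>u. blinfun_apply (blinfun_apply A\<^sub>1 u) u = 0"
    and B\<^sub>1_eq: "B\<^sub>1 = B\<^sub>1_op J N \<mu> I\<^sub>U g"
    and A\<^sub>1B\<^sub>1_eq: "A\<^sub>1B\<^sub>1 = part_in_H \<iota> (\<lambda>v. blinfun_apply A\<^sub>1 v + B\<^sub>1 v)"
    and A\<^sub>B_eq: "\<And>t. A\<^sub>B t = part_in_H \<iota> (\<lambda>v. blinfun_apply A\<^sub>1 v + \<alpha> t *\<^sub>R B\<^sub>1 v)"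
    and maximal: "maximal_quasi_monotone A\<^sub>1B\<^sub>1"
    and dense: "closure (Domain A\<^sub>1B\<^sub>1) = UNIV"
    and D_C1: "C1_halfline D D'"
    and D\<^sub>t_cont: "continuous_on {0..} D\<^sub>t"
    and D'_lip: "locally_Lipschitz_halfline D'"
    and D\<^sub>t_lip: "locally_Lipschitz_halfline D\<^sub>t"
    and D_inv: "\<And>t. t \<ge> 0 \<Longrightarrow> blinfun_invertible (D t)"
    and D\<^sub>t_inv: "\<And>t. t \<ge> 0 \<Longrightarrow> blinfun_invertible (D\<^sub>t t)"
    and symmetric: "\<And>t x y. t \<ge> 0 \<Longrightarrow>
      blinfun_apply (D t o\<^sub>L D\<^sub>t t) x \<bullet> y = x \<bullet> blinfun_apply (D t o\<^sub>L D\<^sub>t t) y"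
    and pos_def: "\<And>t x. t \<ge> 0 \<Longrightarrow> x \<noteq> 0 \<Longrightarrow> blinfun_apply (D t o\<^sub>L D\<^sub>t t) x \<bullet> x > 0"
    and coercive: "\<And>T. T > 0 \<Longrightarrow> \<exists>c>0. \<forall>x. \<forall>t\<in>{0..T}.
      blinfun_apply (blinfun_inv (D\<^sub>t t) o\<^sub>L blinfun_inv (D t)) x \<bullet> x \<ge> c * (norm x)\<^sup>2"
    and domains: "\<And>t x. t \<ge> 0 \<Longrightarrow>
      blinfun_apply (blinfun_inv (D t)) x \<in> Domain (A\<^sub>B t) \<longleftrightarrow> x \<in> Domain A\<^sub>1B\<^sub>1"
    and intertwining: "\<And>t x. t \<ge> 0 \<Longrightarrow> x \<in> Domain A\<^sub>1B\<^sub>1 \<Longrightarrow>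
      op_apply (A\<^sub>B t) (blinfun_apply (blinfun_inv (D t)) x) =
      blinfun_apply (D\<^sub>t t) (op_apply A\<^sub>1B\<^sub>1 x)"
  shows "\<forall>x\<^sub>0 \<in> Domain (A\<^sub>B 0). \<exists>x. is_solution A\<^sub>B x\<^sub>0 x \<and>
    (\<forall>y. is_solution A\<^sub>B x\<^sub>0 y \<longrightarrow> (\<forall>t\<ge>0. y t = x t))"
proof
  interpret control_setting \<iota> J N \<mu> d U I\<^sub>U g by (rule setting)
  fix x\<^sub>0 assume x\<^sub>0: "x\<^sub>0 \<in> Domain (A\<^sub>B 0)"
  define A where "A = A\<^sub>1B\<^sub>1"
  have svA: "y = y'" if "(x, y) \<in> A" "(x, y') \<in> A" for x y y'
    using that part_in_H_unique unfolding A_def A\<^sub>1B\<^sub>1_eq by blast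
  have apA: "op_apply A x = y" if "(x, y) \<in> A" for x y
    using that op_apply_part_in_H unfolding A_def A\<^sub>1B\<^sub>1_eq by blast
  obtain \<omega> where \<omega>: "maximal_monotone {(x, y + \<omega> *\<^sub>R x) | x y. (x, y) \<in> A}"
    using maximal unfolding maximal_quasi_monotone_def A_def by blast
  define M where "M = {(x, y + \<omega> *\<^sub>R x) | x y. (x, y) \<in> A}"
  have M: "maximal_monotone M" using \<omega> by (simp add: M_def)
  have svM: "single_valued M" by (rule single_valuedI) (use svA in \<open>auto simp: M_def\<close>)
  have domM: "Domain M = Domain A" by (auto simp: M_def)
  have apM: "op_apply M x = op_apply A x + \<omega> *\<^sub>R x" if x: "x \<in> Domain A" for x
  proof -
    obtain y where y: "(x, y) \<in> A" using x by blast
    then have "(x, y + \<omega> *\<^sub>R x) \<in> M" by (auto simp: M_def)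
    then have "op_apply M x = y + \<omega> *\<^sub>R x"
      unfolding op_apply_def using svM by (auto dest: single_valuedD)
    then show ?thesis using apA[OF y] by simp
  qed

  define R where "R t = blinfun_inv (D t)" for t
  define R\<^sub>t where "R\<^sub>t t = blinfun_inv (D\<^sub>t t)" for t
  have inv_ex: "X o\<^sub>L blinfun_inv X = id_blinfun \<and> blinfun_inv X o\<^sub>L X = id_blinfun"
    if "blinfun_invertible X" for X :: "'h \<Rightarrow>\<^sub>L 'h"
    using that blinfun_inv_unique unfolding blinfun_invertible_def by metis
  have DR: "D t o\<^sub>L R t = id_blinfun" "R t o\<^sub>L D t = id_blinfun" if "t \<ge> 0" for t
    using inv_ex[OF D_inv[OF that]] by (auto simp: R_def)
  have DR\<^sub>t: "D\<^sub>t t o\<^sub>L R\<^sub>t t = id_blinfun" "R\<^sub>t t o\<^sub>L D\<^sub>t t = id_blinfun" if "t \<ge> 0" for t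
    using inv_ex[OF D\<^sub>t_inv[OF that]] by (auto simp: R\<^sub>t_def)
  have app: "X (Y x) = x" if "X o\<^sub>L Y = id_blinfun" for X Y :: "'h \<Rightarrow>\<^sub>L 'h" and x
    using that by (metis blinfun_apply_blinfun_compose blinfun_apply_id_blinfun id_apply)
  have DR': "D t (R t x) = x" "R t (D t x) = x" "D\<^sub>t t (R\<^sub>t t x) = x" "R\<^sub>t t (D\<^sub>t t x) = x"
    if "t \<ge> 0" for t x
    using app DR[OF that] DR\<^sub>t[OF that] by blast+

  define S where "S t = D t o\<^sub>L D\<^sub>t t" for t
  define P where "P t = R\<^sub>t t o\<^sub>L R t" for t
  \<comment> \<open>The first summand undoes the shift by \<omega> in \<open>M\<close>; the second
    is P applied to the term D' D^-1 y that arises from differentiating y = D x.\<close>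
  define Q where "Q t = \<omega> *\<^sub>R id_blinfun + (P t o\<^sub>L (D' t o\<^sub>L R t))" for t
  have PS: "P t (S t x) = x" "S t (P t x) = x" if "t \<ge> 0" for t x
    by (simp_all add: P_def S_def DR'[OF that])
  have D_der: "(D has_vector_derivative D' t) (at t within {0..})" if "t \<ge> 0" for t
    using D_C1 that by (simp add: C1_halfline_def)
  have ev: "\<exists>c \<Lambda>. evolution M P S Q 0 T c \<Lambda>" if T: "T > 0" for T
  proof -
    obtain L where "L-lipschitz_on {0..T} D'" using D'_lip T unfolding locally_Lipschitz_halfline_def by blast
    then have D': "bounded_lipschitz_on {0..T} D'" by (rule bounded_lipschitz_on_lipschitz)
    obtain L' where "L'-lipschitz_on {0..T} D\<^sub>t" using D\<^sub>t_lip T unfolding locally_Lipschitz_halfline_def by blast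
    then have D\<^sub>t: "bounded_lipschitz_on {0..T} D\<^sub>t" by (rule bounded_lipschitz_on_lipschitz)
    have D: "bounded_lipschitz_on {0..T} D"
    proof (rule bounded_lipschitz_on_C1)
      show "(D has_vector_derivative D' t) (at t within {0..T})" if "t \<in> {0..T}" for t
        using that by (intro has_vector_derivative_within_subset[OF D_der]) auto
      show "continuous_on {0..T} D'"
        using D_C1 by (auto simp: C1_halfline_def elim: continuous_on_subset)
    qed
    have R: "bounded_lipschitz_on {0..T} R"
      by (rule bounded_lipschitz_on_inverse[OF D]) (use DR in auto)
    have R\<^sub>t: "bounded_lipschitz_on {0..T} R\<^sub>t"
      by (rule bounded_lipschitz_on_inverse[OF D\<^sub>t]) (use DR\<^sub>t in auto)
    have P: "bounded_lipschitz_on {0..T} P"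
      unfolding P_def by (rule bounded_lipschitz_on_compose[OF R\<^sub>t R])
    obtain c where c: "c > 0" "\<And>x t. t \<in> {0..T} \<Longrightarrow> P t x \<bullet> x \<ge> c * (norm x)\<^sup>2"
      using coercive[OF T] unfolding P_def R_def R\<^sub>t_def by blast
    show ?thesis
    proof (rule evolution_exists[OF M svM T c(1) P])
      show "bounded_lipschitz_on {0..T} S"
        unfolding S_def by (rule bounded_lipschitz_on_compose[OF D D\<^sub>t])
      show "bounded_lipschitz_on {0..T} Q"
        unfolding Q_def by (intro bounded_lipschitz_on_add bounded_lipschitz_on_const
            bounded_lipschitz_on_compose P D' R)
      show "P t x \<bullet> y = x \<bullet> P t y" if "t \<in> {0..T}" for t x y
      proof -
        have t: "t \<ge> 0" using that by simp
        have "P t x \<bullet> y = P t x \<bullet> S t (P t y)" by (simp add: PS[OF t])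
        also have "\<dots> = S t (P t x) \<bullet> P t y" unfolding S_def using symmetric[OF t] by simp
        finally show ?thesis by (simp add: PS[OF t])
      qed
    qed (use PS c(2) in auto)
  qed
  have velocity: "S t (Q t y - op_apply M y) = D' t (R t y) - D t (D\<^sub>t t (op_apply A y))"
    if t: "t \<ge> 0" and y: "y \<in> Domain A" for t y
  proof -
    have "Q t y - op_apply M y = P t (D' t (R t y)) - op_apply A y"
      using apM[OF y] by (simp add: Q_def blinfun.add_left blinfun.scaleR_left)
    then show ?thesis by (simp add: blinfun.diff_right PS[OF t]) (simp add: S_def)
  qed
  have dom: "R t y \<in> Domain (A\<^sub>B t) \<longleftrightarrow> y \<in> Domain A" if "t \<ge> 0" for t y
    using domains[OF that] by (simp add: R_def A_def)
  have inter: "op_apply (A\<^sub>B t) (R t y) = D\<^sub>t t (op_apply A y)" if "t \<ge> 0" "y \<in> Domain A" for t y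
    using intertwining[OF that(1)] that(2) by (simp add: R_def A_def)
  have Dc: "continuous_on {0..} D"
    unfolding continuous_on_eq_continuous_within
    using has_vector_derivative_continuous[OF D_der] by auto
  have Rc: "continuous_on {0..} R"
    by (rule continuous_on_blinfun_inverse[OF Dc]) (use DR in auto)

  have y0: "D 0 x\<^sub>0 \<in> Domain M"
    using dom[of 0 "D 0 x\<^sub>0"] x\<^sub>0 by (simp add: DR' domM)
  obtain y E where y: "y 0 = D 0 x\<^sub>0" "strong_solution M S Q {0..} y" and E: "countable E"
    and yE: "\<And>t. t \<in> {0..} - E \<Longrightarrow>
      (y has_vector_derivative S t (Q t (y t) - op_apply M (y t))) (at t within {0..}) \<and>
      continuous (at t within {0..}) (\<lambda>s. op_apply M (y s))"
    using strong_solution_halfline_exists[OF ev y0] by blast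
  have yA: "y t \<in> Domain A" if "t \<ge> 0" for t using y(2) that by (simp add: strong_solution_def domM)
  have yc: "continuous_on {0..} y" using y(2) by (simp add: strong_solution_def)
  define x where "x t = R t (y t)" for t
  have "is_solution A\<^sub>B x\<^sub>0 x"
    unfolding is_solution_def
  proof (intro conjI allI impI exI[of _ E] ballI)
    show "continuous_on {0..} x" unfolding x_def by (intro continuous_intros Rc yc)
    show "x 0 = x\<^sub>0" by (simp add: x_def y(1) DR')
    show "x t \<in> Domain (A\<^sub>B t)" if "t \<ge> 0" for t using dom[OF that] yA[OF that] by (simp add: x_def)
    show "countable E" by (rule E)
    fix t assume tE: "t \<in> {0..} - E"
    then have t: "t \<ge> 0" "t \<in> {0..}" by auto
    have Rt: "(R \<longlongrightarrow> R t) (at t within {0..})" using Rc t by (simp add: continuous_on_def)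
    have "((\<lambda>s. R s (y s)) has_vector_derivative
        R t (S t (Q t (y t) - op_apply M (y t)) - D' t (R t (y t)))) (at t within {0..})"
      by (rule has_vector_derivative_blinfun_inverse_apply[OF D_der[OF t(1)] conjunct1[OF yE[OF tE]] Rt t(2)])
        (use DR in auto)
    moreover have "R t (S t (Q t (y t) - op_apply M (y t)) - D' t (R t (y t))) = - op_apply (A\<^sub>B t) (x t)"
      using velocity[OF t(1) yA[OF t(1)]] inter[OF t(1) yA[OF t(1)]]
      by (simp add: x_def blinfun.minus_right DR'[OF t(1)])
    ultimately show "(x has_vector_derivative - op_apply (A\<^sub>B t) (x t)) (at t within {0..})"
      by (simp add: x_def[abs_def])
    \<comment> \<open>By intertwining, the operator at x(s) is \<open>D\<^sub>t s\<close> applied to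
      M y - \<omega> y, so continuity of M y at t carries over to the velocity of x.\<close>
    have "continuous (at t within {0..}) (\<lambda>s. - D\<^sub>t s (op_apply M (y s) - \<omega> *\<^sub>R y s))"
      using conjunct2[OF yE[OF tE]] D\<^sub>t_cont yc t
      by (intro continuous_intros) (auto simp: continuous_on_eq_continuous_within)
    then show "continuous (at t within {0..}) (\<lambda>s. - op_apply (A\<^sub>B s) (x s))"
      using t(2)
    proof (rule continuous_transform_within[OF _ zero_less_one])
      fix s :: real assume "s \<in> {0..}"
      then have s: "s \<ge> 0" by simp
      show "- D\<^sub>t s (op_apply M (y s) - \<omega> *\<^sub>R y s) = - op_apply (A\<^sub>B s) (x s)"
        using inter[OF s yA[OF s]] apM[OF yA[OF s]] by (simp add: x_def)
    qed
  qed
  moreover have "z t = x t" if z: "is_solution A\<^sub>B x\<^sub>0 z" and t: "t \<ge> 0" for z t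
  proof -
    obtain E' where E': "countable E'" "\<And>t. t \<in> {0..} - E' \<Longrightarrow>
        (z has_vector_derivative - op_apply (A\<^sub>B t) (z t)) (at t within {0..})"
      using z unfolding is_solution_def by blast
    have zR: "z t = R t (D t (z t))" if "t \<ge> 0" for t by (simp add: DR'[OF that])
    have zA: "D t (z t) \<in> Domain A" if t: "t \<ge> 0" for t
      using dom[OF t, of "D t (z t)"] z t by (simp add: is_solution_def DR'[OF t])
    \<comment> \<open>Conversely, D carries every competing solution to a strong solution of the
      transformed equation with the same initial value, to which uniqueness applies.\<close>
    have "strong_solution M S Q {0..} (\<lambda>t. D t (z t))"
      unfolding strong_solution_def
    proof (intro conjI ballI exI[of _ E'])
      show "continuous_on {0..} (\<lambda>t. D t (z t))"
        using z by (intro continuous_intros Dc) (simp add: is_solution_def)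
      show "D t (z t) \<in> Domain M" if "t \<in> {0..}" for t using zA that by (simp add: domM)
      fix t assume tE: "t \<in> {0..} - E'"
      then have t: "t \<ge> 0" by simp
      have "((\<lambda>t. D t (z t)) has_vector_derivative D t (- op_apply (A\<^sub>B t) (z t)) + D' t (z t)) (at t within {0..})"
        by (rule blinfun.has_vector_derivative[OF D_der[OF t] E'(2)[OF tE]])
      moreover have "D t (- op_apply (A\<^sub>B t) (z t)) + D' t (z t) =
          S t (Q t (D t (z t)) - op_apply M (D t (z t)))"
        using inter[OF t zA[OF t]] velocity[OF t zA[OF t]] by (simp add: blinfun.minus_right DR'[OF t])
      ultimately show "((\<lambda>t. D t (z t)) has_vector_derivative
          S t (Q t (D t (z t)) - op_apply M (D t (z t)))) (at t within {0..})" by simp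
    qed (rule E')
    moreover have "D 0 (z 0) = y 0" using z y(1) by (simp add: is_solution_def)
    ultimately have "D t (z t) = y t"
      using strong_solution_halfline_unique[OF ev _ y(2) _ t, of "\<lambda>t. D t (z t)"] by blast
    then show ?thesis using zR[OF t] by (simp add: x_def)
  qed
  ultimately show "\<exists>x. is_solution A\<^sub>B x\<^sub>0 x \<and> (\<forall>y. is_solution A\<^sub>B x\<^sub>0 y \<longrightarrow> (\<forall>t\<ge>0. y t = x t))"
    by blast
qed

end
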